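(* Every connected Cayley graph of the infinite dihedral group $\mathbb{Z}_2\ast\mathbb{Z}_2$ (i.e. $\mathsf{Cay}(\mathbb{Z}_2\ast\mathbb{Z}_2;S)$ for every finite generating set $S$) has a Hamiltonian double ray.
   Context: For a finite generating set $S$ of a group $G$ with $1\notin S$, $\mathsf{Cay}(G;S)$ is the undirected simple graph with vertex set $G$ in which $g$ and $gs$ are adjacent for all $g\in G$, $s\in S$. A double ray is a two-way infinite path (an infinite connected 2-regular graph); a double ray that is a subgraph of a graph is Hamiltonian if it contains all vertices of the graph. *)

theory Defs
  imports "HOL-Algebra.Algebra"
begin

section \<open>Free products of two groups\<close>

text \<open>
  The elements of the free product are the reduced words: finite words whose letters are
  non-identity elements of the two factors, no two consecutive letters coming from the same
  factor. The letter of \<open>x\<close> in the first factor is \<open>Inl x\<close>, of \<open>y\<close> in the second \<open>Inr y\<close>.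
\<close>

abbreviation fp_letters :: "('a, 'm) monoid_scheme \<Rightarrow> ('b, 'n) monoid_scheme \<Rightarrow> ('a + 'b) set"
  where "fp_letters G H \<equiv> Inl ` (carrier G - {\<one>\<^bsub>G\<^esub>}) \<union> Inr ` (carrier H - {\<one>\<^bsub>H\<^esub>})"

definition reduced_words :: "('a, 'm) monoid_scheme \<Rightarrow> ('b, 'n) monoid_scheme \<Rightarrow> ('a + 'b) list set"
  where "reduced_words G H =
    {w. set w \<subseteq> fp_letters G H \<and> successively (\<lambda>x y. isl x \<noteq> isl y) w}"

text \<open>
  The reduced form of \<open>x # w\<close> for a letter \<open>x\<close> and a reduced word \<open>w\<close>: if \<open>w\<close> begins with a
  letter of the same factor, the two letters are multiplied, and dropped if they cancel.
\<close>

fun letter_mult ::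
    "('a, 'm) monoid_scheme \<Rightarrow> ('b, 'n) monoid_scheme \<Rightarrow> 'a + 'b \<Rightarrow> ('a + 'b) list \<Rightarrow> ('a + 'b) list"
  where
    "letter_mult G H (Inl x) (Inl y # w) =
       (if x \<otimes>\<^bsub>G\<^esub> y = \<one>\<^bsub>G\<^esub> then w else Inl (x \<otimes>\<^bsub>G\<^esub> y) # w)"
  | "letter_mult G H (Inr x) (Inr y # w) =
       (if x \<otimes>\<^bsub>H\<^esub> y = \<one>\<^bsub>H\<^esub> then w else Inr (x \<otimes>\<^bsub>H\<^esub> y) # w)"
  | "letter_mult G H x w = x # w"

definition free_product ::
    "('a, 'm) monoid_scheme \<Rightarrow> ('b, 'n) monoid_scheme \<Rightarrow> ('a + 'b) list monoid"
  where "free_product G H =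
    \<lparr>carrier = reduced_words G H, monoid.mult = foldr (letter_mult G H), one = []\<rparr>"

definition infinite_dihedral_group :: "(int + int) list monoid"
  where "infinite_dihedral_group = free_product (integer_mod_group 2) (integer_mod_group 2)"

lemma reduced_words_Nil [simp]: "[] \<in> reduced_words G H"
  by (simp add: reduced_words_def)

lemma reduced_words_Cons:
  "x # w \<in> reduced_words G H \<longleftrightarrow>
     x \<in> fp_letters G H \<and> w \<in> reduced_words G H \<and> (w \<noteq> [] \<longrightarrow> isl x \<noteq> isl (hd w))"
  by (cases w) (auto simp: reduced_words_def)

lemma letter_mult_eq_Cons:
  "w = [] \<or> isl x \<noteq> isl (hd w) \<Longrightarrow> letter_mult G H x w = x # w"
  by (cases "(G, H, x, w)" rule: letter_mult.cases) auto

lemma letter_mult_closed: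
  assumes "group G" "group H" and x: "x \<in> fp_letters G H" and w: "w \<in> reduced_words G H"
  shows "letter_mult G H x w \<in> reduced_words G H"
proof (cases "w = [] \<or> isl x \<noteq> isl (hd w)")
  case True
  then show ?thesis using x w by (simp only: letter_mult_eq_Cons reduced_words_Cons) blast
next
  case False
  interpret G: group G by fact
  interpret H: group H by fact
  from False obtain y v where y: "w = y # v" "isl x = isl y" by (cases w) auto
  have v: "y \<in> fp_letters G H" "v \<in> reduced_words G H" "v \<noteq> [] \<longrightarrow> isl y \<noteq> isl (hd v)"
    using w unfolding y reduced_words_Cons by auto
  show ?thesis
    using x v y by (cases x; cases y) (auto simp: reduced_words_Cons)
qed

lemma foldr_letter_mult_closed:
  assumes "group G" "group H" "set u \<subseteq> fp_letters G H" "w \<in> reduced_words G H"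
  shows "foldr (letter_mult G H) u w \<in> reduced_words G H"
  using assms(3)
proof (induction u)
  case (Cons a u)
  then show ?case
    using letter_mult_closed[OF assms(1,2), of a "foldr (letter_mult G H) u w"] by simp
qed (simp add: assms(4))

lemma letter_mult_letter_mult:
  assumes "group G" "group H" "w \<in> reduced_words G H"
  shows "x \<in> carrier G - {\<one>\<^bsub>G\<^esub>} \<Longrightarrow> y \<in> carrier G - {\<one>\<^bsub>G\<^esub>} \<Longrightarrow>
      letter_mult G H (Inl x) (letter_mult G H (Inl y) w) =
        (if x \<otimes>\<^bsub>G\<^esub> y = \<one>\<^bsub>G\<^esub> then w else letter_mult G H (Inl (x \<otimes>\<^bsub>G\<^esub> y)) w)"
    and "x' \<in> carrier H - {\<one>\<^bsub>H\<^esub>} \<Longrightarrow> y' \<in> carrier H - {\<one>\<^bsub>H\<^esub>} \<Longrightarrow>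
      letter_mult G H (Inr x') (letter_mult G H (Inr y') w) =
        (if x' \<otimes>\<^bsub>H\<^esub> y' = \<one>\<^bsub>H\<^esub> then w else letter_mult G H (Inr (x' \<otimes>\<^bsub>H\<^esub> y')) w)"
proof -
  interpret G: group G by fact
  interpret H: group H by fact
  show "letter_mult G H (Inl x) (letter_mult G H (Inl y) w) =
        (if x \<otimes>\<^bsub>G\<^esub> y = \<one>\<^bsub>G\<^esub> then w else letter_mult G H (Inl (x \<otimes>\<^bsub>G\<^esub> y)) w)"
    if x: "x \<in> carrier G - {\<one>\<^bsub>G\<^esub>}" and y: "y \<in> carrier G - {\<one>\<^bsub>G\<^esub>}"
  proof (cases "\<exists>z v. w = Inl z # v")
    case True
    then obtain z v where w: "w = Inl z # v" by blast
    have z: "z \<in> carrier G" "z \<noteq> \<one>\<^bsub>G\<^esub>" and hd: "v \<noteq> [] \<longrightarrow> \<not> isl (hd v)"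
      using assms(3) w by (auto simp: reduced_words_Cons)
    have Lv: "letter_mult G H (Inl t) v = Inl t # v" for t
      using hd by (intro letter_mult_eq_Cons) auto
    have assoc: "x \<otimes>\<^bsub>G\<^esub> y \<otimes>\<^bsub>G\<^esub> z = x \<otimes>\<^bsub>G\<^esub> (y \<otimes>\<^bsub>G\<^esub> z)"
      using x y z G.m_assoc by auto
    show ?thesis
    proof (cases "y \<otimes>\<^bsub>G\<^esub> z = \<one>\<^bsub>G\<^esub>")
      case yz: True
      have *: "x \<otimes>\<^bsub>G\<^esub> y \<otimes>\<^bsub>G\<^esub> z = x" using assoc yz x by simp
      show ?thesis
      proof (cases "x \<otimes>\<^bsub>G\<^esub> y = \<one>\<^bsub>G\<^esub>")
        case True
        then have "x = z" using * z by simp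
        then show ?thesis using True yz Lv w by simp
      next
        case False
        then show ?thesis using yz Lv w * x by simp
      qed
    next
      case yz: False
      show ?thesis
      proof (cases "x \<otimes>\<^bsub>G\<^esub> y = \<one>\<^bsub>G\<^esub>")
        case True
        then have "x \<otimes>\<^bsub>G\<^esub> (y \<otimes>\<^bsub>G\<^esub> z) = z" using assoc z by simp
        then show ?thesis using True yz Lv w z by simp
      next
        case False
        then show ?thesis using yz Lv w assoc by simp
      qed
    qed
  next
    case False
    have "isl (hd w) = False" if "w \<noteq> []"
      using that False by (cases w; cases "hd w") auto
    then have "letter_mult G H (Inl t) w = Inl t # w" for t
      by (intro letter_mult_eq_Cons) auto
    then show ?thesis by simp
  qed
  show "letter_mult G H (Inr x') (letter_mult G H (Inr y') w) =
        (if x' \<otimes>\<^bsub>H\<^esub> y' = \<one>\<^bsub>H\<^esub> then w else letter_mult G H (Inr (x' \<otimes>\<^bsub>H\<^esub> y')) w)"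
    if x: "x' \<in> carrier H - {\<one>\<^bsub>H\<^esub>}" and y: "y' \<in> carrier H - {\<one>\<^bsub>H\<^esub>}"
  proof (cases "\<exists>z v. w = Inr z # v")
    case True
    then obtain z v where w: "w = Inr z # v" by blast
    have z: "z \<in> carrier H" "z \<noteq> \<one>\<^bsub>H\<^esub>" and hd: "v \<noteq> [] \<longrightarrow> isl (hd v)"
      using assms(3) w by (auto simp: reduced_words_Cons)
    have Lv: "letter_mult G H (Inr t) v = Inr t # v" for t
      using hd by (intro letter_mult_eq_Cons) auto
    have assoc: "x' \<otimes>\<^bsub>H\<^esub> y' \<otimes>\<^bsub>H\<^esub> z = x' \<otimes>\<^bsub>H\<^esub> (y' \<otimes>\<^bsub>H\<^esub> z)"
      using x y z H.m_assoc by auto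
    show ?thesis
    proof (cases "y' \<otimes>\<^bsub>H\<^esub> z = \<one>\<^bsub>H\<^esub>")
      case yz: True
      have *: "x' \<otimes>\<^bsub>H\<^esub> y' \<otimes>\<^bsub>H\<^esub> z = x'" using assoc yz x by simp
      show ?thesis
      proof (cases "x' \<otimes>\<^bsub>H\<^esub> y' = \<one>\<^bsub>H\<^esub>")
        case True
        then have "x' = z" using * z by simp
        then show ?thesis using True yz Lv w by simp
      next
        case False
        then show ?thesis using yz Lv w * x by simp
      qed
    next
      case yz: False
      show ?thesis
      proof (cases "x' \<otimes>\<^bsub>H\<^esub> y' = \<one>\<^bsub>H\<^esub>")
        case True
        then have "x' \<otimes>\<^bsub>H\<^esub> (y' \<otimes>\<^bsub>H\<^esub> z) = z" using assoc z by simp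
        then show ?thesis using True yz Lv w z by simp
      next
        case False
        then show ?thesis using yz Lv w assoc by simp
      qed
    qed
  next
    case False
    have "isl (hd w) = True" if "w \<noteq> []"
      using that False by (cases w; cases "hd w") auto
    then have "letter_mult G H (Inr t) w = Inr t # w" for t
      by (intro letter_mult_eq_Cons) auto
    then show ?thesis by simp
  qed
qed

lemma foldr_letter_mult_letter_mult:
  assumes "group G" "group H" "x \<in> fp_letters G H" "p \<in> reduced_words G H" "w \<in> reduced_words G H"
  shows "foldr (letter_mult G H) (letter_mult G H x p) w =
         letter_mult G H x (foldr (letter_mult G H) p w)"
proof (cases "\<exists>y q. p = y # q \<and> isl x = isl y")
  case True
  then obtain y q where p: "p = y # q" and iso: "isl x = isl y" by blast
  have y: "y \<in> fp_letters G H" and q: "set q \<subseteq> fp_letters G H"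
    using assms(4) p by (auto simp: reduced_words_Cons reduced_words_def)
  have fq: "foldr (letter_mult G H) q w \<in> reduced_words G H"
    using foldr_letter_mult_closed assms q by blast
  show ?thesis
  proof (cases x)
    case x: (Inl x')
    then obtain y' where "y = Inl y'" using iso by (cases y) auto
    moreover from this have "x' \<in> carrier G - {\<one>\<^bsub>G\<^esub>}" "y' \<in> carrier G - {\<one>\<^bsub>G\<^esub>}"
      using assms(3) x y by auto
    ultimately show ?thesis using letter_mult_letter_mult(1)[OF assms(1,2) fq] x p by simp
  next
    case x: (Inr x')
    then obtain y' where "y = Inr y'" using iso by (cases y) auto
    moreover from this have "x' \<in> carrier H - {\<one>\<^bsub>H\<^esub>}" "y' \<in> carrier H - {\<one>\<^bsub>H\<^esub>}"
      using assms(3) x y by auto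
    ultimately show ?thesis using letter_mult_letter_mult(2)[OF assms(1,2) fq] x p by simp
  qed
next
  case False
  then have "letter_mult G H x p = x # p"
    by (intro letter_mult_eq_Cons) (cases p; auto)
  then show ?thesis by simp
qed

lemma group_free_product:
  assumes "group G" "group H"
  shows "group (free_product G H)"
proof (rule groupI)
  interpret G: group G by fact
  interpret H: group H by fact
  have letters: "set u \<subseteq> fp_letters G H" if "u \<in> reduced_words G H" for u
    using that by (simp add: reduced_words_def)
  show "x \<otimes>\<^bsub>free_product G H\<^esub> y \<in> carrier (free_product G H)"
    if "x \<in> carrier (free_product G H)" "y \<in> carrier (free_product G H)" for x y
    using that letters foldr_letter_mult_closed[OF assms] by (simp add: free_product_def)
  show "\<one>\<^bsub>free_product G H\<^esub> \<in> carrier (free_product G H)"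
    by (simp add: free_product_def)
  show "\<one>\<^bsub>free_product G H\<^esub> \<otimes>\<^bsub>free_product G H\<^esub> x = x" for x
    by (simp add: free_product_def)
  have assoc: "foldr (letter_mult G H) (foldr (letter_mult G H) u v) w =
        foldr (letter_mult G H) u (foldr (letter_mult G H) v w)"
    if "set u \<subseteq> fp_letters G H" "v \<in> reduced_words G H" "w \<in> reduced_words G H" for u v w
    using that(1)
  proof (induction u)
    case (Cons a u)
    then show ?case
      using that(2,3) assms
      by (simp add: foldr_letter_mult_letter_mult foldr_letter_mult_closed)
  qed simp
  show "x \<otimes>\<^bsub>free_product G H\<^esub> y \<otimes>\<^bsub>free_product G H\<^esub> z =
        x \<otimes>\<^bsub>free_product G H\<^esub> (y \<otimes>\<^bsub>free_product G H\<^esub> z)"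
    if "x \<in> carrier (free_product G H)" "y \<in> carrier (free_product G H)"
      "z \<in> carrier (free_product G H)" for x y z
    using that letters assoc by (simp add: free_product_def)
  have "\<exists>v \<in> reduced_words G H. foldr (letter_mult G H) v u = []"
    if "u \<in> reduced_words G H" for u
    using that
  proof (induction u)
    case (Cons a u)
    have a: "a \<in> fp_letters G H" and u: "u \<in> reduced_words G H"
      using Cons.prems by (auto simp: reduced_words_Cons)
    obtain v where v: "v \<in> reduced_words G H" "foldr (letter_mult G H) v u = []"
      using Cons.IH u by blast
    obtain b where b: "b \<in> fp_letters G H" "letter_mult G H b (a # u) = u"
    proof (cases a)
      case (Inl x)
      then have "x \<in> carrier G" "x \<noteq> \<one>\<^bsub>G\<^esub>" using a by auto
      then show ?thesis using that[of "Inl (inv\<^bsub>G\<^esub> x)"] Inl by auto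
    next
      case (Inr x)
      then have "x \<in> carrier H" "x \<noteq> \<one>\<^bsub>H\<^esub>" using a by auto
      then show ?thesis using that[of "Inr (inv\<^bsub>H\<^esub> x)"] Inr by auto
    qed
    have b': "[b] \<in> reduced_words G H" using b(1) by (simp add: reduced_words_Cons)
    have "foldr (letter_mult G H) (foldr (letter_mult G H) v [b]) (a # u) = []"
      using assoc[OF letters[OF v(1)] b' Cons.prems] b(2) v(2) by simp
    then show ?case
      using foldr_letter_mult_closed[OF assms letters[OF v(1)] b'] by blast
  next
    case Nil
    show ?case by (rule bexI[of _ "[]"]) simp_all
  qed
  then show "\<exists>y \<in> carrier (free_product G H). y \<otimes>\<^bsub>free_product G H\<^esub> x = \<one>\<^bsub>free_product G H\<^esub>"
    if "x \<in> carrier (free_product G H)" for x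
    using that by (simp add: free_product_def)
qed

lemma group_infinite_dihedral_group: "group infinite_dihedral_group"
  by (simp add: infinite_dihedral_group_def group_free_product)

section \<open>Graphs\<close>

record 'a ugraph =
  verts :: "'a set"
  edges :: "'a set set"

definition simple_graph :: "'a ugraph \<Rightarrow> bool"
  where "simple_graph \<Gamma> \<longleftrightarrow> (\<forall>e \<in> edges \<Gamma>. e \<subseteq> verts \<Gamma> \<and> card e = 2)"

definition subgraph :: "'a ugraph \<Rightarrow> 'a ugraph \<Rightarrow> bool"
  where "subgraph \<Delta> \<Gamma> \<longleftrightarrow>
    simple_graph \<Delta> \<and> simple_graph \<Gamma> \<and> verts \<Delta> \<subseteq> verts \<Gamma> \<and> edges \<Delta> \<subseteq> edges \<Gamma>"

definition connected_graph :: "'a ugraph \<Rightarrow> bool"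
  where "connected_graph \<Gamma> \<longleftrightarrow> verts \<Gamma> \<noteq> {} \<and>
    (\<forall>u \<in> verts \<Gamma>. \<forall>v \<in> verts \<Gamma>. (u, v) \<in> {(x, y). {x, y} \<in> edges \<Gamma>}\<^sup>*)"

definition regular_graph :: "nat \<Rightarrow> 'a ugraph \<Rightarrow> bool"
  where "regular_graph k \<Gamma> \<longleftrightarrow>
    (\<forall>v \<in> verts \<Gamma>. finite {e \<in> edges \<Gamma>. v \<in> e} \<and> card {e \<in> edges \<Gamma>. v \<in> e} = k)"

definition double_ray :: "'a ugraph \<Rightarrow> bool"
  where "double_ray \<Gamma> \<longleftrightarrow>
    simple_graph \<Gamma> \<and> infinite (verts \<Gamma>) \<and> connected_graph \<Gamma> \<and> regular_graph 2 \<Gamma>"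

definition hamiltonian_double_ray :: "'a ugraph \<Rightarrow> 'a ugraph \<Rightarrow> bool"
  where "hamiltonian_double_ray \<Delta> \<Gamma> \<longleftrightarrow>
    double_ray \<Delta> \<and> subgraph \<Delta> \<Gamma> \<and> verts \<Delta> = verts \<Gamma>"

definition cayley_graph :: "('a, 'm) monoid_scheme \<Rightarrow> 'a set \<Rightarrow> 'a ugraph"
  where "cayley_graph G S =
    \<lparr>verts = carrier G, edges = {{g, g \<otimes>\<^bsub>G\<^esub> s} | g s. g \<in> carrier G \<and> s \<in> S}\<rparr>"

lemma simple_graph_cayley_graph:
  assumes "group G" "S \<subseteq> carrier G" "\<one>\<^bsub>G\<^esub> \<notin> S"
  shows "simple_graph (cayley_graph G S)"
proof -
  interpret group G by fact
  have "card {g, g \<otimes>\<^bsub>G\<^esub> s} = 2" "g \<otimes>\<^bsub>G\<^esub> s \<in> carrier G"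
    if "g \<in> carrier G" "s \<in> S" for g s
  proof -
    have s: "s \<in> carrier G" "s \<noteq> \<one>\<^bsub>G\<^esub>" using that assms(2,3) by auto
    then have "g \<noteq> g \<otimes>\<^bsub>G\<^esub> s" using that(1) l_cancel[of g s "\<one>\<^bsub>G\<^esub>"] by auto
    then show "card {g, g \<otimes>\<^bsub>G\<^esub> s} = 2" by simp
    show "g \<otimes>\<^bsub>G\<^esub> s \<in> carrier G" using s that(1) by simp
  qed
  note edge = this
  show ?thesis
    unfolding simple_graph_def
  proof
    fix e assume "e \<in> edges (cayley_graph G S)"
    then obtain g s where "e = {g, g \<otimes>\<^bsub>G\<^esub> s}" "g \<in> carrier G" "s \<in> S"
      unfolding cayley_graph_def ugraph.simps by blast
    then show "e \<subseteq> verts (cayley_graph G S) \<and> card e = 2"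
      using edge[of g s] by (simp only: cayley_graph_def ugraph.simps) blast
  qed
qed

end

theory Submission
  imports Defs
begin

text \<open>
  Identify the group with the pairs of an integer and a bit, the rotation \<open>R n\<close> being
  \<open>(n, False)\<close> and the reflection \<open>F n\<close> being \<open>(n, True)\<close>, and let \<open>A\<close> and \<open>B\<close> be the rotations and
  reflections in \<open>S\<close>. Then \<open>F x\<close> and \<open>R r\<close> are adjacent iff \<open>x - r \<in> B\<close>, and rotations (and
  reflections) are adjacent iff they differ by an element of \<open>A\<close>. Generation means that \<open>B\<close> is
  nonempty and that \<open>A\<close> together with the differences of \<open>B\<close> has greatest common divisor 1.

  The heart is the case \<open>A = {}\<close>. Shrink \<open>B\<close> until no proper subset has coprime differences. A
  Hamiltonian double ray is a pair of perfect matchings whose union is connected. Take reflections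
  \<open>\<alpha> < \<beta>\<close> whose index difference is even and \<open>\<gamma>\<close> of the other parity: the edges of the labels
  \<open>\<alpha>\<close>, \<open>\<beta>\<close> form infinitely long zigzag columns, and edges of label \<open>\<gamma>\<close> together with those of the
  remaining labels are inserted along a sparse sequence of switches that links all columns into one
  double ray. The order in which columns are visited is a recurrent walk on a system of
  representatives modulo \<open>h = gcd (\<beta> - \<alpha>) (\<gamma> - \<alpha>)\<close>. The exception, four reflections of
  which exactly three have the same parity, is settled by a direct construction on a hexagonal strip.
  Rotations are then added one at a time, traversing the translates of the old ray back and forth.
\<close>

section \<open>Hamiltonian double rays on the reflection edges\<close>

text \<open>Take \<open>h = gcd (\<beta> - \<alpha>) (\<gamma> - \<alpha>)\<close>. It is odd, so
  the residues modulo \<open>2 * h\<close> fall into pairs \<open>n\<close>, \<open>n + h\<close>,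
  and the walk uses one of each pair. A switch with label \<open>b\<close> moves it by
  \<open>b - \<gamma>\<close>, never by \<open>\<gamma> - b\<close>: the walk is directed, and the
  obstacle is to make it strongly connected. With exactly one remaining label and
  \<open>g = b - \<gamma>\<close> odd this is impossible: by coprimality the steps \<open>g\<close>
  form one directed cycle through all residues modulo \<open>2 * h\<close>, and no half of it allows
  a return. This is the exceptional case of four labels. Minimality of \<open>B\<close> supplies
  what the other cases need. No remaining step is divisible by \<open>h\<close>, since its label
  could be dropped; this keeps the switches distinct. Of two remaining steps neither lies in the
  group generated by \<open>h\<close> and the other, which leaves a second direction for turning
  back. Finally a \<open>\<gamma>\<close>-switch displaces by
  \<open>2 * \<gamma> - \<alpha> - \<beta>\<close>, so \<open>\<gamma>\<close> must not be the
  midpoint of \<open>\<alpha>\<close> and \<open>\<beta>\<close>.\<close>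

text \<open>
  The rotations \<open>r k\<close> and reflections \<open>f k\<close> of a double ray \<open>\<dots>, f 0, r 0, f 1, r 1, \<dots>\<close> in which
  every edge comes from a reflection in \<open>B\<close>.
\<close>

definition haar_ray :: "int set \<Rightarrow> bool"
  where "haar_ray B \<longleftrightarrow> (\<exists>f r :: int \<Rightarrow> int. bij f \<and> bij r \<and>
    (\<forall>k. f k - r k \<in> B \<and> f (k + 1) - r k \<in> B))"

text \<open>The orbit of \<open>0\<close> is invariant in both directions, hence everything. A
  repeated value would make it periodic, hence finite, but the integers are infinite.\<close>

lemma bij_enumeration:
  fixes f :: "int \<Rightarrow> int"
  assumes f: "bij f" and trans: "\<And>Z. (\<And>x. f x \<in> Z \<longleftrightarrow> x \<in> Z) \<Longrightarrow> Z = {} \<or> Z = UNIV"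
  shows "\<exists>z :: int \<Rightarrow> int. bij z \<and> (\<forall>k. z (k + 1) = f (z k))"
proof -
  define z where "z k = (if k \<ge> 0 then (f ^^ nat k) 0 else (inv_into UNIV f ^^ nat (- k)) 0)" for k :: int
  have ff: "f (inv_into UNIV f x) = x" for x
    using f by (simp add: bij_is_surj surj_f_inv_f)
  have step: "z (k + 1) = f (z k)" for k
  proof (cases "k \<ge> 0")
    case True
    then have "nat (k + 1) = Suc (nat k)" by simp
    then show ?thesis using True by (simp add: z_def)
  next
    case False
    then have "nat (- k) = Suc (nat (- (k + 1)))" by simp
    then show ?thesis using False ff by (cases "k = -1") (auto simp: z_def)
  qed
  have "range z = {} \<or> range z = UNIV"
  proof (rule trans)
    fix x
    show "f x \<in> range z \<longleftrightarrow> x \<in> range z"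
    proof
      assume "f x \<in> range z"
      then obtain k where "f x = z k" by blast
      then have "f x = f (z (k - 1))" using step[of "k - 1"] by simp
      then show "x \<in> range z" using f by (simp add: bij_is_inj inj_eq)
    qed (use step in \<open>metis rangeE rangeI\<close>)
  qed
  then have surj: "range z = UNIV" by blast
  have "inj z"
  proof (rule ccontr)
    assume "\<not> inj z"
    then obtain i j where ij: "z i = z j" "i < j"
      unfolding inj_def by (metis linorder_neqE)
    have up: "z (i + int t) = z (j + int t)" for t
    proof (induction t)
      case (Suc t)
      then show ?case using step[of "i + int t"] step[of "j + int t"] by (simp add: algebra_simps)
    qed (use ij in simp)
    have "z (i - int t) = z (j - int t)" for t
    proof (induction t)
      case (Suc t)
      have "f (z (i - int (Suc t))) = f (z (j - int (Suc t)))"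
        using Suc step[of "i - int (Suc t)"] step[of "j - int (Suc t)"]
        by (simp add: algebra_simps)
      then show ?case using f by (simp add: bij_is_inj inj_eq)
    qed (use ij in simp)
    then have per: "z (i + t) = z (j + t)" for t
      using up[of "nat t"] by (cases "t \<ge> 0") (auto, metis (no_types, opaque_lifting) add_uminus_conv_diff int_nat_eq linorder_not_le minus_minus neg_0_le_iff_le nle_le)
    have per': "z (k + (j - i)) = z k" for k
      using per[of "k - i"] by (simp add: algebra_simps)
    have "z (k + int t * (j - i)) = z k" for k t
    proof (induction t)
      case (Suc t)
      then show ?case using per'[of "k + int t * (j - i)"] by (simp add: algebra_simps)
    qed simp
    then have per2: "z (k + t * (j - i)) = z k" for k t
      by (cases t) (simp, metis (no_types, opaque_lifting) add.commute diff_add_cancel minus_mult_minus mult_minus_left uminus_add_conv_diff)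
    have "range z \<subseteq> z ` {0..<j - i}"
    proof
      fix x assume "x \<in> range z"
      then obtain k where "x = z k" by blast
      also have "\<dots> = z (k mod (j - i))"
        using per2[of "k mod (j - i)" "k div (j - i)"] by (simp only: mod_div_mult_eq)
      finally show "x \<in> z ` {0..<j - i}" using ij by auto
    qed
    then have "finite (UNIV :: int set)" using surj by (metis finite_atLeastLessThan_int finite_surj)
    then show False by simp
  qed
  then show ?thesis using surj step by (auto simp: bij_def)
qed

text \<open>The assumption \<open>trans\<close> says that the union of the two matchings is
  connected. Going out along \<open>\<phi>\<close> and back along \<open>\<psi>\<close> permutes the
  reflections, and connectedness makes this permutation a single orbit.\<close>

lemma haar_ray_of_matchings:
  fixes \<phi> \<psi> :: "int \<Rightarrow> int"
  assumes "bij \<phi>" "bij \<psi>" and lab: "\<And>n. n - \<phi> n \<in> B" "\<And>n. n - \<psi> n \<in> B"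
    and trans: "\<And>Z. (\<And>n n'. \<phi> n = \<psi> n' \<Longrightarrow> n \<in> Z \<longleftrightarrow> n' \<in> Z) \<Longrightarrow> Z = {} \<or> Z = UNIV"
  shows "haar_ray B"
proof -
  define f where "f = inv_into UNIV \<psi> \<circ> \<phi>"
  have \<psi>f: "\<psi> (f n) = \<phi> n" for n
    using assms(2) by (simp add: f_def bij_is_surj surj_f_inv_f)
  have f: "bij f" unfolding f_def using assms(1,2) bij_comp bij_imp_bij_inv by blast
  have "\<exists>z :: int \<Rightarrow> int. bij z \<and> (\<forall>k. z (k + 1) = f (z k))"
  proof (rule bij_enumeration[OF f trans])
    fix Z n n' assume Z: "\<And>x. f x \<in> Z \<longleftrightarrow> x \<in> Z" and "\<phi> n = \<psi> n'"
    then have "f n = n'" using assms(2) \<psi>f[of n] by (simp add: bij_is_inj inj_eq)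
    then show "n \<in> Z \<longleftrightarrow> n' \<in> Z" using Z by blast
  qed
  then obtain z :: "int \<Rightarrow> int" where z: "bij z" "\<And>k. z (k + 1) = f (z k)" by blast
  have "bij (\<phi> \<circ> z)" using z(1) assms(1) by (rule bij_comp)
  moreover have "z k - (\<phi> \<circ> z) k \<in> B \<and> z (k + 1) - (\<phi> \<circ> z) k \<in> B" for k
    using lab(1)[of "z k"] lab(2)[of "z (k + 1)"] z(2) \<psi>f by simp
  ultimately show ?thesis unfolding haar_ray_def using z(1) by blast
qed

text \<open>
  One half \<open>U\<close> of the reflections is matched to the rotations by \<open>\<delta>\<close> and by the label \<open>c\<close>, so that
  \<open>U\<close> and its translate by \<open>w\<close> split into parallel \<open>\<delta>\<close>-lines. The switch set \<open>Y\<close> cuts these lines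
  into segments; a segment ending in \<open>y\<close> continues in the other half, runs back, and comes
  out at \<open>\<sigma> y\<close>. Hence the union of the two matchings is connected iff \<open>\<sigma>\<close> is transitive on \<open>Y\<close>.
\<close>

lemma haar_ray_pairing:
  fixes U Y B :: "int set" and \<delta> \<sigma> :: "int \<Rightarrow> int"
  assumes c: "c \<in> B" and w: "w + c \<in> B" and U: "\<And>n. n + w \<in> U \<longleftrightarrow> n \<notin> U"
    and \<delta>: "bij_betw \<delta> U U" "\<And>n. n \<in> U \<Longrightarrow> n + c - \<delta> n \<in> B"
    and Y: "Y \<subseteq> U" "Y \<noteq> {}"
    and \<sigma>: "bij_betw \<sigma> Y Y" "\<And>y. y \<in> Y \<Longrightarrow> \<sigma> y - \<delta> y - w + c \<in> B"
    and trans: "\<And>Z. (\<And>y. y \<in> Y \<Longrightarrow> \<sigma> y \<in> Z \<longleftrightarrow> y \<in> Z) \<Longrightarrow> Y \<inter> Z = {} \<or> Y \<subseteq> Z"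
    and fwd: "\<And>n. n \<in> U \<Longrightarrow> \<exists>i. (\<delta> ^^ i) n \<in> Y"
    and bwd: "\<And>n. n \<in> U \<Longrightarrow> \<exists>y\<in>Y. \<exists>i. (\<delta> ^^ i) y = n"
  shows "haar_ray B"
proof -
  define \<sigma>' where "\<sigma>' = inv_into Y \<sigma>"
  have \<sigma>': "y \<in> Y \<Longrightarrow> \<sigma> (\<sigma>' y) = y" "y \<in> Y \<Longrightarrow> \<sigma>' y \<in> Y" "y \<in> Y \<Longrightarrow> \<sigma>' (\<sigma> y) = y" for y
    using \<sigma>(1) unfolding \<sigma>'_def bij_betw_def
    by (auto simp: f_inv_into_f inv_into_into)
  have \<sigma>Y: "y \<in> Y \<Longrightarrow> \<sigma> y \<in> Y" for y using \<sigma>(1) by (auto simp: bij_betw_def)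
  define \<delta>' where "\<delta>' = inv_into U \<delta>"
  have \<delta>': "n \<in> U \<Longrightarrow> \<delta> (\<delta>' n) = n" "n \<in> U \<Longrightarrow> \<delta>' n \<in> U" "n \<in> U \<Longrightarrow> \<delta>' (\<delta> n) = n" for n
    using \<delta>(1) unfolding \<delta>'_def bij_betw_def
    by (auto simp: f_inv_into_f inv_into_into)
  have \<delta>U: "n \<in> U \<Longrightarrow> \<delta> n \<in> U" for n using \<delta>(1) by (auto simp: bij_betw_def)
  have Uw: "n - w \<in> U \<longleftrightarrow> n \<notin> U" for n using U[of "n - w"] by auto
  \<comment> \<open>Away from \<open>Y\<close> the two matchings alternate along the
    \<open>\<delta>\<close>-lines, forwards in \<open>U\<close> and backwards in its translate. At
    \<open>y\<close> in \<open>Y\<close> the rotation \<open>y - c\<close> is rematched to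
    \<open>y + w\<close>, and \<open>\<delta> y + w - c\<close>, which this frees, to
    \<open>\<sigma> y\<close>.\<close>
  define \<phi> where "\<phi> n = (if n \<in> U then \<delta> n - c else n - c)" for n
  define \<psi> where "\<psi> n = (if n \<in> U then if n \<in> Y then \<delta> (\<sigma>' n) + w - c else n - c
      else if n - w \<in> Y then n - w - c else \<delta> (n - w) + w - c)" for n
  define \<phi>' where "\<phi>' m = (if m + c \<in> U then \<delta>' (m + c) else m + c)" for m
  define \<psi>' where "\<psi>' m = (if m + c \<in> U then if m + c \<in> Y then m + c + w else m + c
      else (let x = \<delta>' (m + c - w) in if x \<in> Y then \<sigma> x else x + w))" for m
  have "bij \<phi>"
    by (rule bij_betw_byWitness[where f' = \<phi>']) (auto simp: \<phi>_def \<phi>'_def \<delta>' \<delta>U)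
  moreover have "bij \<psi>"
  proof (rule bij_betw_byWitness[where f' = \<psi>'])
    show "\<forall>n\<in>UNIV. \<psi>' (\<psi> n) = n"
    proof
      fix n
      consider "n \<in> Y" | "n \<in> U" "n \<notin> Y" | "n \<notin> U" "n - w \<in> Y" | "n \<notin> U" "n - w \<notin> Y" by blast
      then show "\<psi>' (\<psi> n) = n"
      proof cases
        case 1
        then have "n \<in> U" "\<sigma>' n \<in> U" using Y \<sigma>' by blast+
        then show ?thesis using 1 U \<sigma>' \<delta>' \<delta>U by (simp add: \<psi>_def \<psi>'_def)
      next
        case 2
        then show ?thesis by (simp add: \<psi>_def \<psi>'_def)
      next
        case 3
        then show ?thesis using Uw by (simp add: \<psi>_def \<psi>'_def)
      next
        case 4
        then have "n - w \<in> U" using Uw by blast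
        then show ?thesis using 4 U \<delta>' \<delta>U by (simp add: \<psi>_def \<psi>'_def)
      qed
    qed
    show "\<forall>m\<in>UNIV. \<psi> (\<psi>' m) = m"
    proof
      fix m
      show "\<psi> (\<psi>' m) = m"
      proof (cases "m + c \<in> U")
        case True
        then show ?thesis using U by (auto simp: \<psi>_def \<psi>'_def)
      next
        case False
        then have x: "\<delta>' (m + c - w) \<in> U" "\<delta> (\<delta>' (m + c - w)) = m + c - w"
          using Uw \<delta>' by blast+
        show ?thesis
        proof (cases "\<delta>' (m + c - w) \<in> Y")
          case True
          then show ?thesis using x False \<sigma>Y \<sigma>' Y(1)
            by (simp add: \<psi>_def \<psi>'_def) blast
        next
          case F: False
          then have "\<delta>' (m + c - w) + w \<notin> U" using x U by blast
          then show ?thesis using x False F by (simp add: \<psi>_def \<psi>'_def)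
        qed
      qed
    qed
  qed auto
  moreover have "n - \<phi> n \<in> B" for n
    using \<delta>(2)[of n] c by (simp add: \<phi>_def algebra_simps)
  moreover have "n - \<psi> n \<in> B" for n
  proof -
    have "n - (\<delta> (\<sigma>' n) + w - c) \<in> B" if "n \<in> Y"
      using \<sigma>(2)[of "\<sigma>' n"] \<sigma>' that by (simp add: algebra_simps)
    moreover have "n - (\<delta> (n - w) + w - c) \<in> B" if "n \<notin> U"
      using \<delta>(2)[of "n - w"] Uw that by (simp add: algebra_simps)
    ultimately show ?thesis using c w by (auto simp: \<psi>_def add.commute)
  qed
  moreover have "Z = {} \<or> Z = UNIV"
    if Z: "\<And>n n'. \<phi> n = \<psi> n' \<Longrightarrow> n \<in> Z \<longleftrightarrow> n' \<in> Z" for Z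
  proof -
    have r1: "n \<in> Z \<longleftrightarrow> \<delta> n \<in> Z" if "n \<in> U" "\<delta> n \<notin> Y" for n
      by (rule Z) (use that \<delta>U in \<open>simp add: \<phi>_def \<psi>_def\<close>)
    have r2: "n \<in> Z \<longleftrightarrow> \<delta> n + w \<in> Z" if "n \<in> U" "\<delta> n \<in> Y" for n
      by (rule Z) (use that \<delta>U U in \<open>simp add: \<phi>_def \<psi>_def\<close>)
    have r3: "\<delta> x + w \<in> Z \<longleftrightarrow> x + w \<in> Z" if "x \<in> U" "x \<notin> Y" for x
      by (rule Z) (use that \<delta>U U in \<open>simp add: \<phi>_def \<psi>_def\<close>)
    have r4: "\<delta> x + w \<in> Z \<longleftrightarrow> \<sigma> x \<in> Z" if "x \<in> Y" for x
    proof (rule Z)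
      have "x \<in> U" "\<sigma> x \<in> U" using that Y \<sigma>Y by blast+
      then show "\<phi> (\<delta> x + w) = \<psi> (\<sigma> x)"
        using that \<delta>U U \<sigma>Y \<sigma>' by (simp add: \<phi>_def \<psi>_def)
    qed
    have \<delta>iU: "n \<in> U \<Longrightarrow> (\<delta> ^^ i) n \<in> U" for n i
      by (induction i) (use \<delta>U in auto)
    have "\<sigma> y \<in> Z \<longleftrightarrow> y \<in> Z" if y: "y \<in> Y" for y
    proof -
      have yU: "y \<in> U" using y Y by blast
      \<comment> \<open>The segment of \<open>y\<close> ends at the next switch on its line,
        \<open>j + 1\<close> steps ahead. Fact \<open>a\<close> follows it forwards in
        \<open>U\<close>, \<open>r2\<close> crosses to the translate, and \<open>b\<close> runs back
        and leaves at \<open>\<sigma> y\<close>.\<close>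
      define P where "P i \<longleftrightarrow> (\<delta> ^^ Suc i) y \<in> Y" for i
      have "\<exists>i. P i"
        using fwd[OF \<delta>U[OF yU]] unfolding P_def by (simp add: funpow_swap1)
      define j where "j = (LEAST i. P i)"
      have Pj: "P j" unfolding j_def using \<open>\<exists>i. P i\<close> by (metis LeastI)
      have nP: "\<not> P i" if "i < j" for i using that unfolding j_def by (rule not_less_Least)
      have a: "i \<le> j \<Longrightarrow> y \<in> Z \<longleftrightarrow> (\<delta> ^^ i) y \<in> Z" for i
      proof (induction i)
        case (Suc i)
        then have "\<not> P i" using nP by simp
        then show ?case using Suc r1[OF \<delta>iU[OF yU, of i]] by (simp add: P_def)
      qed simp
      have b: "i \<le> j \<Longrightarrow> (\<delta> ^^ Suc i) y + w \<in> Z \<longleftrightarrow> \<sigma> y \<in> Z" for i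
      proof (induction i)
        case 0
        then show ?case using r4[OF y] by simp
      next
        case (Suc i)
        then have "\<not> P i" using nP by simp
        then show ?case using Suc r3[OF \<delta>iU[OF yU, of "Suc i"]] by (simp add: P_def)
      qed
      have "(\<delta> ^^ j) y \<in> Z \<longleftrightarrow> (\<delta> ^^ Suc j) y + w \<in> Z"
        using r2[OF \<delta>iU[OF yU, of j]] Pj by (simp add: P_def)
      then show ?thesis using a[of j] b[of j] by simp
    qed
    then have YX: "Y \<inter> Z = {} \<or> Y \<subseteq> Z" by (rule trans)
    \<comment> \<open>By \<open>bwd\<close> every reflection lies on a segment that starts at a
      switch, so it shares its component with some switch.\<close>
    have c1: "\<exists>y'\<in>Y. (\<delta> ^^ i) y \<in> Z \<longleftrightarrow> y' \<in> Z" if "y \<in> Y" for i y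
    proof (induction i)
      case 0
      then show ?case using that by auto
    next
      case (Suc i)
      have "y \<in> U" using that Y by blast
      then show ?case
        using Suc r1[OF \<delta>iU, of y i] by (cases "(\<delta> ^^ Suc i) y \<in> Y") auto
    qed
    have c2: "\<exists>y'\<in>Y. (\<delta> ^^ Suc i) y + w \<in> Z \<longleftrightarrow> y' \<in> Z" if "y \<in> Y" for i y
    proof (induction i)
      case 0
      then show ?case using r4[OF that] \<sigma>Y[OF that] by auto
    next
      case (Suc i)
      have yU: "y \<in> U" using that Y by blast
      show ?case
      proof (cases "(\<delta> ^^ Suc i) y \<in> Y")
        case True
        then show ?thesis using r4[OF True] \<sigma>Y[OF True] by auto
      next
        case False
        then show ?thesis using Suc r3[OF \<delta>iU[OF yU] False] by auto
      qed
    qed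
    have U1: "\<exists>y\<in>Y. n \<in> Z \<longleftrightarrow> y \<in> Z" if "n \<in> U" for n
      using bwd[OF that] c1 by blast
    have U2: "\<exists>y\<in>Y. n \<in> Z \<longleftrightarrow> y \<in> Z" if "n \<notin> U" for n
    proof -
      have u: "n - w \<in> U" using that Uw by blast
      then obtain y i where "y \<in> Y" "(\<delta> ^^ i) y = \<delta>' (n - w)" using bwd \<delta>' by metis
      then have "(\<delta> ^^ Suc i) y = n - w" using \<delta>' u by simp
      then show ?thesis using c2[OF \<open>y \<in> Y\<close>, of i] by simp
    qed
    show ?thesis using YX U1 U2 by blast
  qed
  ultimately show ?thesis by (rule haar_ray_of_matchings)
qed

section \<open>Half sections\<close>

text \<open>
  A half section selects one of \<open>n\<close>, \<open>n + h\<close> for each multiple \<open>n\<close> of \<open>e\<close>. It is walkable if any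
  two of its residues modulo \<open>2 * h\<close> are joined by steps from \<open>D\<close> that stay inside it.
\<close>

definition half_section :: "int \<Rightarrow> int \<Rightarrow> int set \<Rightarrow> bool"
  where "half_section h e W \<longleftrightarrow>
    (\<forall>n\<in>W. e dvd n) \<and> (\<forall>n. e dvd n \<longrightarrow> (n + h \<in> W \<longleftrightarrow> n \<notin> W))"

text \<open>Steps are directed: \<open>- g\<close> is not allowed along with \<open>g\<close>. The
  step \<open>0\<close> changes the representative modulo \<open>N\<close>.\<close>

definition step_rel :: "int \<Rightarrow> int set \<Rightarrow> int set \<Rightarrow> (int \<times> int) set"
  where "step_rel N D W = {(n, n'). n \<in> W \<and> n' \<in> W \<and> (\<exists>g\<in>insert 0 D. N dvd n' - n - g)}"

definition strongly_walkable :: "int \<Rightarrow> int set \<Rightarrow> int set \<Rightarrow> bool"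
  where "strongly_walkable N D W \<longleftrightarrow> (\<forall>n\<in>W. \<forall>n'\<in>W. (n, n') \<in> (step_rel N D W)\<^sup>*)"

lemma step_relI:
  "n \<in> W \<Longrightarrow> n' \<in> W \<Longrightarrow> g \<in> insert 0 D \<Longrightarrow> N dvd n' - n - g \<Longrightarrow> (n, n') \<in> step_rel N D W"
  unfolding step_rel_def by blast

lemma step_rel_mono: "D \<subseteq> D' \<Longrightarrow> step_rel N D W \<subseteq> step_rel N D' W"
  unfolding step_rel_def by blast

lemma half_section_period:
  assumes "half_section h e W" "e dvd h"
  shows "n + 2 * h \<in> W \<longleftrightarrow> n \<in> W"
proof (cases "e dvd n")
  case True
  then have "e dvd n + h" using assms(2) by simp
  then have "n + h + h \<in> W \<longleftrightarrow> n \<in> W"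
    using assms(1) True unfolding half_section_def by blast
  then show ?thesis by (simp add: algebra_simps)
next
  case False
  then have "\<not> e dvd n + 2 * h" using assms(2) by (simp add: dvd_add_left_iff)
  then show ?thesis using False assms(1) unfolding half_section_def by blast
qed

lemma half_section_cong:
  assumes W: "half_section h e W" "e dvd h" and d: "2 * h dvd n' - n"
  shows "n' \<in> W \<longleftrightarrow> n \<in> W"
proof -
  have up: "n + int t * (2 * h) \<in> W \<longleftrightarrow> n \<in> W" for n t
  proof (induction t)
    case (Suc t)
    then show ?case
      using half_section_period[OF W, of "n + int t * (2 * h)"] by (simp add: algebra_simps)
  qed simp
  obtain k where k: "n' = n + k * (2 * h)" using d by (metis add.commute diff_add_cancel dvdE mult.commute)
  show ?thesis
  proof (cases "k \<ge> 0")
    case True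
    then show ?thesis using up[of n "nat k"] k by simp
  next
    case False
    then show ?thesis using up[of n' "nat (- k)"] k by simp
  qed
qed

text \<open>The bound \<open>e div gcd e g\<close> is the order of \<open>g\<close> modulo
  \<open>e\<close>. Bezout gives some multiple of \<open>g\<close>, and reducing its factor modulo
  the order makes it nonnegative, as directed steps require.\<close>

lemma multiple_mod_gcd:
  fixes e g n :: int
  assumes "e > 0" "gcd e g dvd n"
  shows "\<exists>j < nat (e div gcd e g). e dvd n - int j * g"
proof -
  define m where "m = e div gcd e g"
  have "gcd e g > 0" "gcd e g dvd e" using assms(1) by auto
  then have m: "m > 0" "e = m * gcd e g"
    using assms(1) unfolding m_def by (auto simp: pos_imp_zdiv_pos_iff zdvd_imp_le)
  obtain u v where uv: "u * e + v * g = gcd e g" using bezout_int by blast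
  obtain t where t: "n = gcd e g * t" using assms(2) by blast
  define j where "j = (v * t) mod m"
  obtain q where q: "v * t = m * q + j" unfolding j_def by (metis mult_div_mod_eq)
  obtain g' where g': "g = gcd e g * g'" by (meson dvdE gcd_dvd2)
  have mg: "m * g = e * g'"
    by (subst g', subst (2) m(2)) (simp only: mult_ac)
  have "n = (u * e + v * g) * t" unfolding uv by (rule t)
  also have "\<dots> = e * (u * t) + v * t * g" by (simp add: algebra_simps)
  also have "v * t * g = q * (m * g) + j * g" unfolding q by (simp add: algebra_simps)
  finally have "n - j * g = e * (u * t + q * g')" unfolding mg by (simp only: distrib_left) simp
  moreover have "0 \<le> j" "j < m" using m unfolding j_def by auto
  ultimately show ?thesis
    by (intro exI[of _ "nat j"]) (auto simp: m_def[symmetric])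
qed

lemma multiple_mod_gcd_unique:
  fixes e g :: int
  assumes "e > 0" "i < nat (e div gcd e g)" "j < nat (e div gcd e g)"
    and "e dvd (int i - int j) * g"
  shows "i = j"
proof -
  define m where "m = e div gcd e g"
  have d: "gcd e g \<noteq> 0" "e = gcd e g * m" "g = gcd e g * (g div gcd e g)"
    using assms(1) by (auto simp: m_def)
  have "gcd e g * m dvd gcd e g * ((int i - int j) * (g div gcd e g))"
    using assms(4) d by (metis mult.left_commute)
  then have "gcd e g = 0 \<or> m dvd (int i - int j) * (g div gcd e g)"
    by (simp only: dvd_mult_cancel_left)
  then have "m dvd (int i - int j) * (g div gcd e g)" using d(1) by blast
  moreover have "coprime m (g div gcd e g)"
    using assms(1) unfolding m_def by (simp add: div_gcd_coprime)
  ultimately have "m dvd int i - int j" by (simp add: coprime_dvd_mult_left_iff)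
  moreover have "\<bar>int i - int j\<bar> < m" using assms(2,3) unfolding m_def by linarith
  ultimately show ?thesis using zdvd_imp_le[of m "\<bar>int i - int j\<bar>"] by fastforce
qed

text \<open>
  The translates of \<open>W\<close> by multiples of \<open>g\<close> fill the finer lattice; the last translate is shifted by
  an extra \<open>\<beta>\<close> so that the step \<open>g\<close> leads from it back into \<open>W\<close>.
\<close>

lemma half_section_extend:
  fixes h e g \<beta> :: int
  assumes e: "e > 0" "e dvd h"
    and W: "half_section h e W" and conn: "strongly_walkable (2 * h) D W"
    and \<beta>: "e dvd \<beta>" "\<exists>n\<in>W. n - \<beta> \<in> W" "\<exists>n\<in>W. n + (e div gcd e g) * g + \<beta> \<in> W"
  shows "\<exists>W'. half_section h (gcd e g) W' \<and> strongly_walkable (2 * h) (insert g D) W' \<and> W \<subseteq> W' \<and>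
    (\<forall>n\<in>W'. \<exists>n0\<in>W. \<exists>i k. n = n0 + i * g + k * \<beta>)"
proof (cases "e dvd g")
  case True
  then have "gcd e g = e" using e by (simp add: gcd_proj1_if_dvd)
  moreover have "strongly_walkable (2 * h) (insert g D) W"
    using conn rtrancl_mono[OF step_rel_mono[of D "insert g D" "2 * h" W]]
    unfolding strongly_walkable_def by blast
  moreover have "\<forall>n\<in>W. \<exists>n0\<in>W. \<exists>i k. n = n0 + i * g + k * \<beta>"
  proof
    fix n assume "n \<in> W"
    moreover have "n = n + 0 * g + 0 * \<beta>" by simp
    ultimately show "\<exists>n0\<in>W. \<exists>i k. n = n0 + i * g + k * \<beta>" by blast
  qed
  ultimately show ?thesis using W by (intro exI[of _ W]) simp
next
  case False
  define m where "m = nat (e div gcd e g)"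
  have gp: "gcd e g > 0" "gcd e g dvd e" using e by auto
  then have me: "int m * gcd e g = e" using e by (simp add: m_def pos_imp_zdiv_nonneg_iff)
  have "m \<noteq> 0"
  proof
    assume "m = 0"
    then show False using me e(1) by simp
  qed
  moreover have "m \<noteq> 1" using me False by (metis gcd_dvd2 mult_1 of_nat_1)
  ultimately have m: "m \<ge> 2" by simp
  define b where "b j = int j * g + (if j = m - 1 then \<beta> else 0)" for j
  define W' where "W' = {n. \<exists>j<m. n - b j \<in> W}"
  have e_dvd: "e dvd n - b j \<longleftrightarrow> e dvd n - int j * g" for n j
  proof -
    define t where "t = (if j = m - 1 then \<beta> else 0)"
    have "e dvd t" using \<beta>(1) by (simp add: t_def)
    then have "e dvd n - int j * g - t \<longleftrightarrow> e dvd n - int j * g" by (rule dvd_diff_left_iff)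
    moreover have "n - b j = n - int j * g - t" unfolding b_def t_def by (rule diff_diff_add[symmetric])
    ultimately show ?thesis by (simp only:)
  qed
  have uniq: "i = j" if "i < m" "j < m" "e dvd n - b i" "e dvd n - b j" for i j n
  proof -
    have "e dvd (n - int j * g) - (n - int i * g)" using that e_dvd by (meson dvd_diff)
    then have "e dvd (int i - int j) * g" by (simp add: algebra_simps)
    then show ?thesis using multiple_mod_gcd_unique that e(1) unfolding m_def by blast
  qed
  have We: "n \<in> W \<Longrightarrow> e dvd n" for n using W unfolding half_section_def by blast
  have sec: "half_section h (gcd e g) W'"
    unfolding half_section_def
  proof (intro conjI ballI allI impI)
    fix n assume "n \<in> W'"
    then obtain j where "e dvd n - int j * g" using We e_dvd unfolding W'_def by blast
    then have "gcd e g dvd (n - int j * g) + int j * g"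
      using dvd_trans[OF gcd_dvd1[of e g]] by (intro dvd_add dvd_mult) auto
    then show "gcd e g dvd n" by simp
  next
    fix n assume "gcd e g dvd n"
    then obtain j where j: "j < m" "e dvd n - b j"
      using multiple_mod_gcd[OF e(1)] e_dvd unfolding m_def by blast
    then have j': "e dvd n + h - b j" using dvd_add[OF j(2) e(2)] by (simp add: algebra_simps)
    have "n \<in> W' \<longleftrightarrow> n - b j \<in> W" using j We uniq unfolding W'_def by blast
    moreover have "n + h \<in> W' \<longleftrightarrow> n + h - b j \<in> W" using j(1) j' We uniq unfolding W'_def by blast
    moreover have "n - b j + h \<in> W \<longleftrightarrow> n - b j \<notin> W" using W j(2) unfolding half_section_def by blast
    ultimately show "n + h \<in> W' \<longleftrightarrow> n \<notin> W'" by (simp add: algebra_simps)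
  qed
  let ?S = "step_rel (2 * h) (insert g D) W'"
  define R where "R i j \<longleftrightarrow> (\<forall>x\<in>W. \<forall>y\<in>W. (x + b i, y + b j) \<in> ?S\<^sup>*)" for i j
  have inW': "x \<in> W \<Longrightarrow> j < m \<Longrightarrow> x + b j \<in> W'" for x j unfolding W'_def by auto
  have Rrefl: "R j j" if "j < m" for j
  proof -
    have "(x + b j, y + b j) \<in> ?S\<^sup>*" if "(x, y) \<in> (step_rel (2 * h) D W)\<^sup>*" for x y
      using that
    proof (induction rule: rtrancl_induct)
      case (step y z)
      from step(2) obtain d where d: "y \<in> W" "z \<in> W" "d \<in> insert 0 D" "2 * h dvd z - y - d"
        unfolding step_rel_def by blast
      have "(y + b j, z + b j) \<in> ?S"
        by (rule step_relI[of _ _ _ d]) (use d inW' \<open>j < m\<close> in auto)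
      then show ?case using step(3) by (meson rtrancl.rtrancl_into_rtrancl)
    qed simp
    then show ?thesis using conn unfolding R_def strongly_walkable_def by blast
  qed
  obtain w0 where "w0 \<in> W" using \<beta>(2) by blast
  have Rtrans: "R i k" if "R i j" "R j k" for i j k
    unfolding R_def
  proof (intro ballI)
    fix x y assume "x \<in> W" "y \<in> W"
    then have "(x + b i, w0 + b j) \<in> ?S\<^sup>*" "(w0 + b j, y + b k) \<in> ?S\<^sup>*"
      using that \<open>w0 \<in> W\<close> unfolding R_def by blast+
    then show "(x + b i, y + b k) \<in> ?S\<^sup>*" by (rule rtrancl_trans)
  qed
  \<comment> \<open>One step between two translates is enough, because each translate is strongly
    connected by itself.\<close>
  have Rstep: "R i j" if ij: "i < m" "j < m" and n: "n \<in> W" "n + (b i + g - b j) \<in> W" for i j n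
    unfolding R_def
  proof (intro ballI)
    fix x y assume xy: "x \<in> W" "y \<in> W"
    have "(n + b i, n + (b i + g - b j) + b j) \<in> ?S"
      by (rule step_relI[of _ _ _ g]) (use n ij inW'[of n i] inW'[of "n + (b i + g - b j)" j] in simp_all)
    moreover have "(x + b i, n + b i) \<in> ?S\<^sup>*" "(n + (b i + g - b j) + b j, y + b j) \<in> ?S\<^sup>*"
      using Rrefl ij xy n unfolding R_def by blast+
    ultimately show "(x + b i, y + b j) \<in> ?S\<^sup>*"
      by (blast intro: rtrancl_trans)
  qed
  \<comment> \<open>The translates are linked in a cycle. Only the two links at the shifted last
    translate need care: \<open>\<beta>(2)\<close> supplies the step into it,
    \<open>\<beta>(3)\<close> the step from it back to the start.\<close>
  have Rsuc: "R j (Suc j)" if "Suc j < m" for j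
  proof (cases "Suc j = m - 1")
    case True
    then have "m = Suc (Suc j)" using m by simp
    then have "b j + g - b (Suc j) = - \<beta>" by (simp add: b_def algebra_simps)
    moreover obtain n where "n \<in> W" "n - \<beta> \<in> W" using \<beta>(2) by blast
    ultimately show ?thesis using that by (intro Rstep[of _ _ n]) auto
  next
    case False
    then have "b j + g - b (Suc j) = 0" using that by (simp add: b_def algebra_simps)
    then show ?thesis using that \<open>w0 \<in> W\<close> by (intro Rstep[of _ _ w0]) auto
  qed
  have "e div gcd e g = int m" using e gp by (simp add: m_def pos_imp_zdiv_nonneg_iff)
  then have "b (m - 1) + g - b 0 = (e div gcd e g) * g + \<beta>"
    using m by (simp add: b_def of_nat_diff algebra_simps)
  then have Rwrap: "R (m - 1) 0"
    using \<beta>(3) m by (elim bexE, intro Rstep) (auto simp: algebra_simps)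
  have R0: "R 0 j" if "j < m" for j
    using that
  proof (induction j)
    case 0
    then show ?case by (rule Rrefl)
  next
    case (Suc j)
    then show ?case using Rsuc[of j] Rtrans[of 0 j "Suc j"] by simp
  qed
  have Rlast: "R j (m - 1)" if "j < m" for j
  proof -
    have "j \<le> m - 1" using that by simp
    then show ?thesis
    proof (induction rule: inc_induct)
      case base
      then show ?case using m by (intro Rrefl) simp
    next
      case (step n)
      then show ?case using Rsuc[of n] Rtrans[of n "Suc n" "m - 1"] by simp
    qed
  qed
  have "R i j" if "i < m" "j < m" for i j
    using Rlast[OF that(1)] Rwrap R0[OF that(2)] Rtrans by blast
  then have "strongly_walkable (2 * h) (insert g D) W'"
    unfolding strongly_walkable_def
  proof (intro ballI)
    fix n n' assume "n \<in> W'" "n' \<in> W'"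
    then obtain i j where "i < m" "j < m" "n - b i \<in> W" "n' - b j \<in> W" unfolding W'_def by blast
    then have "(n - b i + b i, n' - b j + b j) \<in> ?S\<^sup>*"
      using \<open>\<And>i j. i < m \<Longrightarrow> j < m \<Longrightarrow> R i j\<close> unfolding R_def by blast
    then show "(n, n') \<in> ?S\<^sup>*" by simp
  qed
  moreover have "W \<subseteq> W'" using m inW'[of _ 0] by (auto simp: b_def)
  moreover have "\<exists>n0\<in>W. \<exists>i k. n = n0 + i * g + k * \<beta>" if "n \<in> W'" for n
  proof -
    obtain j where "n - b j \<in> W" using \<open>n \<in> W'\<close> unfolding W'_def by blast
    moreover have "n = (n - b j) + int j * g + (if j = m - 1 then 1 else 0) * \<beta>"
      by (simp add: b_def)
    ultimately show ?thesis by blast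
  qed
  ultimately show ?thesis using sec by blast
qed

text \<open>Even steps never leave the even numbers, so no step is ever blocked; working modulo
  \<open>2 * h\<close> replaces negative multiples by nonnegative ones.\<close>

lemma all_even_walk:
  assumes F: "finite F" and h: "(h::int) > 0" and D: "F \<subseteq> D" "\<forall>g\<in>F. even g"
    and "even n" "even n'" and "Gcd (insert (2 * h) F) dvd n' - n"
  shows "(n, n') \<in> (step_rel (2 * h) D {n. even n})\<^sup>*"
  using F D(1,2) assms(5-7)
proof (induction F arbitrary: n n' rule: finite_induct)
  case empty
  then have "2 * h dvd n' - n" using h by simp
  then have "(n, n') \<in> step_rel (2 * h) D {n. even n}"
    using empty by (intro step_relI[of _ _ _ 0]) auto
  then show ?case by blast
next
  case (insert g F)
  define e where "e = Gcd (insert (2 * h) F)"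
  have "e > 0" using h unfolding e_def by (metis Gcd_0_iff Gcd_int_greater_eq_0 insert_subset linorder_not_le mult_eq_0_iff nless_le order_antisym_conv singletonD zero_neq_numeral)
  moreover have "gcd e g dvd n' - n"
    using insert.prems(5) by (simp add: e_def insert_commute gcd.commute)
  ultimately obtain j where j: "e dvd n' - n - int j * g"
    using multiple_mod_gcd by blast
  have g: "g \<in> D" "even g" using insert.prems by auto
  have "(n, n + int i * g) \<in> (step_rel (2 * h) D {n. even n})\<^sup>*" for i
  proof (induction i)
    case (Suc i)
    have "(n + int i * g, n + int (Suc i) * g) \<in> step_rel (2 * h) D {n. even n}"
      using g insert.prems(3) by (intro step_relI[of _ _ _ g]) (auto simp: algebra_simps)
    then show ?case using Suc by (rule rtrancl_into_rtrancl[rotated])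
  qed simp
  moreover have "(n + int j * g, n') \<in> (step_rel (2 * h) D {n. even n})\<^sup>*"
  proof (rule insert.IH)
    show "Gcd (insert (2 * h) F) dvd n' - (n + int j * g)"
      using j unfolding e_def by (simp only: diff_diff_eq)
  qed (use insert.prems g in auto)
  ultimately show ?case by (rule rtrancl_trans)
qed

lemma half_section_all_even:
  fixes h :: int
  assumes "finite D" "h > 0" "odd h" "\<forall>g\<in>D. even g" "Gcd (insert h D) = 1"
  shows "half_section h 1 {n. even n} \<and> strongly_walkable (2 * h) D {n. even n}"
proof
  show "half_section h 1 {n. even n}" using assms(3) by (simp add: half_section_def)
  show "strongly_walkable (2 * h) D {n. even n}"
    unfolding strongly_walkable_def
  proof (intro ballI)
    fix n n' :: int assume n: "n \<in> {n. even n}" "n' \<in> {n. even n}"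
    \<comment> \<open>The aim is that \<open>G\<close> divides \<open>2\<close>: it is even, and
      half of it divides \<open>h\<close> and all of \<open>D\<close>.\<close>
    define G where "G = Gcd (insert (2 * h) D)"
    have "even G" using assms(4) unfolding G_def by (intro Gcd_greatest) auto
    then obtain k where k: "G = 2 * k" by blast
    have "k dvd x" if "x \<in> insert h D" for x
    proof (cases "x = h")
      case True
      have "G dvd 2 * h" unfolding G_def by (intro Gcd_dvd) simp
      then show ?thesis using k True by simp
    next
      case False
      then have "G dvd x" unfolding G_def using that by (intro Gcd_dvd) simp
      then show ?thesis using k by (metis dvd_mult_right)
    qed
    then have "k dvd Gcd (insert h D)" by (intro Gcd_greatest)
    then have "k dvd 1" unfolding assms(5) .
    then have "G dvd 2" unfolding k by simp
    then have "G dvd n' - n" using n by (auto intro: dvd_trans[of G 2])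
    then show "(n, n') \<in> (step_rel (2 * h) D {n. even n})\<^sup>*"
      using all_even_walk[OF assms(1,2) order_refl assms(4)] n unfolding G_def by auto
  qed
qed

text \<open>
  A walkable half section built from two steps. Row \<open>y\<close> consists of \<open>o'\<close> consecutive
  \<open>g1\<close>-steps, half of a full \<open>g1\<close>-cycle modulo \<open>2 * h\<close>, and a \<open>g2\<close>-step leads to the next row. Row
  \<open>y + 1\<close> starts \<open>L (y + 1) - L y\<close> positions later than a plain \<open>g2\<close>-translate of row \<open>y\<close>, and the
  total offset \<open>T\<close> is chosen so that row \<open>m\<close> is row \<open>0\<close> again. As \<open>T \<ge> 1\<close>, going round loses
  position until the start of a row is reached.
\<close>

locale odd_step =
  fixes h g1 g2 :: int
  assumes h: "h > 0" "odd h" and g1: "odd g1" "\<not> h dvd g1" and g2: "\<not> gcd h g1 dvd g2"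
begin

definition e where "e = gcd h g1"
definition o' where "o' = h div e"
definition m where "m = nat (e div gcd e g2)"

lemma e: "e > 0" "e dvd h" "e dvd g1" "e * o' = h"
  using h unfolding e_def o'_def by (auto intro: dvd_mult_div_cancel)

text \<open>As \<open>g1\<close> is odd, the factor \<open>2\<close> adds nothing. Hence
  \<open>g1\<close> has order \<open>2 * o'\<close> modulo \<open>2 * h\<close>.\<close>

lemma gcd2h: "gcd (2 * h) g1 = e"
proof -
  have "coprime g1 2" using g1(1) by simp
  then show ?thesis unfolding e_def by (simp add: gcd_mult_left_left_cancel)
qed

lemma two_o: "nat (2 * h div gcd (2 * h) g1) = nat (2 * o')"
proof -
  have "2 * h div e = 2 * o'" using e by (metis nonzero_mult_div_cancel_left less_irrefl mult.left_commute)
  then show ?thesis using gcd2h by simp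
qed

lemma o_ge: "o' \<ge> 3"
proof -
  have "o' > 0" using e h by (metis zero_less_mult_pos)
  moreover have "odd o'" using even_mult_iff[of e o', unfolded e(4)] h(2) by blast
  moreover have "o' \<noteq> 1" using e(3,4) g1(2) by (metis mult.right_neutral)
  ultimately show ?thesis by presburger
qed

lemma m_gcd: "int m * gcd e g2 = e"
  using e(1) by (simp add: m_def pos_imp_zdiv_nonneg_iff)

lemma m_ge: "m \<ge> 3"
proof -
  have "m \<noteq> 0" using m_gcd e(1) by (intro notI) simp
  moreover have "odd e" using even_mult_iff[of e o', unfolded e(4)] h(2) by blast
  then have "odd m" using m_gcd by (metis even_mult_iff even_of_nat)
  moreover have "m \<noteq> 1"
  proof
    assume "m = 1"
    then have "gcd e g2 = e" using m_gcd by simp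
    then show False using g2 unfolding e_def by (metis gcd_dvd2)
  qed
  ultimately show ?thesis by presburger
qed

text \<open>Since \<open>g1\<close> is an odd multiple of \<open>e\<close>, half of its cycle
  amounts to the translation by \<open>h\<close>. So the two halves of a row are exchanged by adding
  \<open>h\<close>, as a half section demands.\<close>

lemma og: "2 * h dvd o' * g1 - h"
proof -
  have *: "2 * h' dvd q * g - h'" if "d * q = h'" "g = d * (2 * s + 1)" for d q h' g s :: int
  proof -
    have "q * g - h' = 2 * h' * s" unfolding that(2) that(1)[symmetric] by (simp add: algebra_simps)
    then show ?thesis by simp
  qed
  obtain t where t: "g1 = e * t" using e(3) by blast
  then have "odd t" using g1(1) by (metis even_mult_iff)
  then obtain s where "t = 2 * s + 1" by (rule oddE)
  then have "g1 = e * (2 * s + 1)" using t by (simp only:)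
  then show ?thesis by (rule *[OF e(4)])
qed

lemma T_ex: "\<exists>T. 1 \<le> T \<and> T \<le> 2 * o' \<and> 2 * h dvd int m * g2 + T * g1"
proof -
  obtain v where v: "g2 = gcd e g2 * v" by (meson dvdE gcd_dvd2)
  have "int m * g2 = int m * (gcd e g2 * v)" using v by (rule arg_cong)
  also have "\<dots> = e * v" using m_gcd by (metis mult.assoc)
  finally have "int m * g2 = e * v" .
  then have "gcd (2 * h) g1 dvd - (int m * g2)" using gcd2h by simp
  then obtain j where j: "j < nat (2 * o')" "2 * h dvd - (int m * g2) - int j * g1"
    using multiple_mod_gcd[of "2 * h", OF _ \<open>gcd (2 * h) g1 dvd - (int m * g2)\<close>] h(1)
    unfolding two_o by (metis mult_pos_pos zero_less_numeral)
  then have j': "2 * h dvd int m * g2 + int j * g1"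
    using dvd_minus_iff[of "2 * h" "- (int m * g2) - int j * g1"] by (simp add: algebra_simps)
  \<comment> \<open>If the rows already close up without an offset, a full \<open>g1\<close>-cycle
    is inserted, because \<open>T\<close> has to be positive.\<close>
  show ?thesis
  proof (cases "j = 0")
    case True
    have "2 * h dvd 2 * (o' * g1 - h) + 2 * h" using dvd_add[OF dvd_mult[OF og, of 2] dvd_refl] .
    then have "2 * h dvd 2 * o' * g1" by (simp add: algebra_simps)
    then show ?thesis using True j' o_ge by (intro exI[of _ "2 * o'"]) auto
  next
    case False
    then show ?thesis using j j' by (intro exI[of _ "int j"]) auto
  qed
qed

definition T where "T = (SOME T. 1 \<le> T \<and> T \<le> 2 * o' \<and> 2 * h dvd int m * g2 + T * g1)"

lemma T: "1 \<le> T" "T \<le> 2 * o'" "2 * h dvd int m * g2 + T * g1"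
  using someI_ex[OF T_ex] unfolding T_def by blast+

text \<open>The offset is used up as early as possible, by at most \<open>o' - 1\<close> per row so
  that a \<open>g2\<close>-step can still hit the next row. All of \<open>T \<le> 2 * o'\<close> is
  used by row \<open>m\<close>, as \<open>2 * o' \<le> 3 * (o' - 1)\<close> and
  \<open>m \<ge> 3\<close>.\<close>

definition L :: "nat \<Rightarrow> int" where "L y = min T (int y * (o' - 1))"

lemma L_step: "L y \<le> L (Suc y)" "L (Suc y) - L y \<le> o' - 1"
  using o_ge T by (auto simp: L_def min_def algebra_simps)

lemma L_0: "L 0 = 0" and L_1: "1 \<le> L (Suc 0)" and L_m: "L m = T"
proof -
  have "3 * (o' - 1) \<le> int m * (o' - 1)" using m_ge o_ge by (intro mult_right_mono) auto
  then show "L 0 = 0" "1 \<le> L (Suc 0)" "L m = T" using o_ge T by (auto simp: L_def min_def)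
qed

text \<open>Position \<open>x\<close> in row \<open>y\<close>. With \<open>y < m\<close> and
  \<open>0 \<le> x < 2 * o'\<close> these are coordinates for the multiples of
  \<open>gcd e g2\<close> modulo \<open>2 * h\<close>, by \<open>P_inj\<close> and
  \<open>P_surj\<close>; \<open>W\<close> is the part with \<open>x < o'\<close>.\<close>

definition P :: "int \<Rightarrow> nat \<Rightarrow> int" where "P x y = int y * g2 + L y * g1 + x * g1"

definition W :: "int set"
  where "W = {n. \<exists>y<m. \<exists>x. 0 \<le> x \<and> x < o' \<and> 2 * h dvd n - P x y}"

lemma P_wrap: "2 * h dvd P x m - P x 0"
  using T(3) by (simp add: P_def L_0 L_m)

lemma dvd_P: "2 * h dvd n - P x y \<Longrightarrow> e dvd n - int y * g2"
proof -
  assume "2 * h dvd n - P x y"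
  then have "e dvd (n - P x y) + (L y + x) * g1"
    using e by (intro dvd_add dvd_mult) (auto intro: dvd_trans)
  then show ?thesis by (simp add: P_def algebra_simps)
qed

lemma P_inj:
  assumes "y < m" "y' < m" "0 \<le> x" "x < 2 * o'" "0 \<le> x'" "x' < 2 * o'"
    "2 * h dvd n - P x y" "2 * h dvd n - P x' y'"
  shows "y = y' \<and> x = x'"
proof -
  have "e dvd (n - int y' * g2) - (n - int y * g2)" using assms dvd_P by (meson dvd_diff)
  then have "e dvd (int y - int y') * g2" by (simp add: algebra_simps)
  then have y: "y = y'" using multiple_mod_gcd_unique assms(1,2) e(1) unfolding m_def by blast
  have "2 * h dvd (n - P x' y') - (n - P x y)" using assms by (meson dvd_diff)
  then have "2 * h dvd (int (nat x) - int (nat x')) * g1"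
    using y assms by (simp add: P_def algebra_simps)
  then have "nat x = nat x'"
    using multiple_mod_gcd_unique[of "2 * h" "nat x" g1 "nat x'"] assms h two_o by auto
  then show ?thesis using y assms by auto
qed

lemma P_surj:
  assumes "gcd e g2 dvd n"
  shows "\<exists>y<m. \<exists>x. 0 \<le> x \<and> x < 2 * o' \<and> 2 * h dvd n - P x y"
proof -
  obtain y where y: "y < m" "e dvd n - int y * g2"
    using multiple_mod_gcd[OF e(1) assms] unfolding m_def by blast
  have "e dvd (n - int y * g2) - L y * g1" using dvd_diff[OF y(2) dvd_mult[OF e(3)]] .
  then have "gcd (2 * h) g1 dvd n - int y * g2 - L y * g1" using gcd2h by simp
  then obtain j where "j < nat (2 * o')" "2 * h dvd n - int y * g2 - L y * g1 - int j * g1"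
    using multiple_mod_gcd[of "2 * h" g1] h(1) two_o by auto
  then have "0 \<le> int j \<and> int j < 2 * o' \<and> 2 * h dvd n - P (int j) y"
    by (simp add: P_def algebra_simps)
  then show ?thesis using y by blast
qed

lemma half_section_W: "half_section h (gcd e g2) W"
  unfolding half_section_def
proof (intro conjI ballI allI impI)
  fix n assume "n \<in> W"
  then obtain y where "e dvd n - int y * g2" unfolding W_def using dvd_P by blast
  then have "gcd e g2 dvd (n - int y * g2) + int y * g2"
    using dvd_trans[OF gcd_dvd1[of e g2]] by (intro dvd_add dvd_mult) auto
  then show "gcd e g2 dvd n" by simp
next
  fix n assume "gcd e g2 dvd n"
  then obtain y x where yx: "y < m" "0 \<le> x" "x < 2 * o'" "2 * h dvd n - P x y"
    using P_surj by blast
  define x' where "x' = (if x < o' then x + o' else x - o')"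
  have yx': "0 \<le> x'" "x' < 2 * o'" using yx unfolding x'_def by auto
  have "2 * h dvd n + h - P x' y"
  proof (cases "x < o'")
    case True
    have "2 * h dvd (n - P x y) - (o' * g1 - h)" using dvd_diff[OF yx(4) og] .
    then show ?thesis using True by (simp add: x'_def P_def algebra_simps)
  next
    case False
    have "2 * h dvd (n - P x y) + (o' * g1 - h) + 2 * h"
      using dvd_add[OF dvd_add[OF yx(4) og] dvd_refl] .
    then show ?thesis using False by (simp add: x'_def P_def algebra_simps)
  qed
  note yx'' = this
  have "n \<in> W \<longleftrightarrow> x < o'"
  proof
    assume "n \<in> W"
    then obtain y1 x1 where "y1 < m" "0 \<le> x1" "x1 < o'" "2 * h dvd n - P x1 y1"
      unfolding W_def by blast
    then show "x < o'" using P_inj[of y y1 x x1 n] yx o_ge by auto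
  qed (use yx in \<open>auto simp: W_def\<close>)
  moreover have "n + h \<in> W \<longleftrightarrow> x' < o'"
  proof
    assume "n + h \<in> W"
    then obtain y1 x1 where "y1 < m" "0 \<le> x1" "x1 < o'" "2 * h dvd n + h - P x1 y1"
      unfolding W_def by blast
    then show "x' < o'" using P_inj[of y y1 x' x1 "n + h"] yx yx' yx'' o_ge by auto
  qed (use yx yx' yx'' in \<open>auto simp: W_def\<close>)
  ultimately show "n + h \<in> W \<longleftrightarrow> n \<notin> W" unfolding x'_def using yx by auto
qed

lemma P_in_W: "y \<le> m \<Longrightarrow> 0 \<le> x \<Longrightarrow> x < o' \<Longrightarrow> P x y \<in> W"
proof (cases "y = m")
  case True
  then show "0 \<le> x \<Longrightarrow> x < o' \<Longrightarrow> P x y \<in> W"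
    unfolding W_def using m_ge P_wrap[of x] by (auto intro!: exI[of _ 0] exI[of _ x])
next
  case False
  then show "y \<le> m \<Longrightarrow> 0 \<le> x \<Longrightarrow> x < o' \<Longrightarrow> P x y \<in> W"
    unfolding W_def by (auto intro!: exI[of _ y] exI[of _ x])
qed

abbreviation S where "S \<equiv> step_rel (2 * h) {g1, g2} W"

lemma walk_right:
  assumes "y \<le> m" "0 \<le> x"
  shows "x + int i < o' \<Longrightarrow> (P x y, P (x + int i) y) \<in> S\<^sup>*"
proof (induction i)
  case (Suc i)
  have "(P (x + int i) y, P (x + int (Suc i)) y) \<in> S"
    by (rule step_relI[of _ _ _ g1])
      (use assms Suc.prems P_in_W[of y "x + int i"] P_in_W[of y "x + int (Suc i)"] in \<open>auto simp: P_def algebra_simps\<close>)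
  then show ?case using Suc by (auto intro: rtrancl_into_rtrancl)
qed simp

text \<open>A \<open>g2\<close>-step lowers the position by the increment of \<open>L\<close>. Where
  this would become negative, the walk moves right just far enough to land on position
  \<open>0\<close>.\<close>

lemma walk_up:
  assumes "y < m" "0 \<le> x" "x < o'"
  shows "(P x y, P (max 0 (x - (L (Suc y) - L y))) (Suc y)) \<in> S\<^sup>*"
proof -
  define l where "l = L (Suc y) - L y"
  define x' where "x' = max x l"
  have l: "0 \<le> l" "l < o'" using L_step[of y] unfolding l_def by auto
  have "(P x y, P (x + int (nat (x' - x))) y) \<in> S\<^sup>*"
    using assms l by (intro walk_right) (auto simp: x'_def)
  then have "(P x y, P x' y) \<in> S\<^sup>*" by (simp add: x'_def)
  moreover have "(P x' y, P (x' - l) (Suc y)) \<in> S"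
    by (rule step_relI[of _ _ _ g2])
      (use assms l P_in_W[of y x'] P_in_W[of "Suc y" "x' - l"] in \<open>auto simp: x'_def P_def l_def algebra_simps\<close>)
  moreover have "x' - l = max 0 (x - (L (Suc y) - L y))" unfolding x'_def l_def by auto
  ultimately show ?thesis by (simp add: rtrancl_into_rtrancl)
qed

lemma walk_wrap:
  assumes "0 \<le> x" "x < o'"
  shows "(P x m, P x 0) \<in> S"
proof (rule step_relI[of _ _ _ 0])
  have "2 * h dvd - (P x m - P x 0)" using P_wrap by (simp only: dvd_minus_iff)
  then show "2 * h dvd P x 0 - P x m - 0" by simp
qed (use assms P_in_W in auto)

lemma walk_bottom:
  assumes "y < m" "0 \<le> x" "x < o'"
  shows "\<exists>x'. 0 \<le> x' \<and> x' \<le> max 0 (x - (L (Suc y) - L y)) \<and> (P x y, P x' 0) \<in> S\<^sup>*"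
proof -
  have "y \<le> m - 1" using assms by simp
  then show ?thesis using assms(2,3)
  proof (induction arbitrary: x rule: inc_induct)
    case base
    then have "(P x (m - 1), P (max 0 (x - (L m - L (m - 1)))) m) \<in> S\<^sup>*"
      using walk_up[of "m - 1" x] m_ge by simp
    moreover have "(P (max 0 (x - (L m - L (m - 1)))) m, P (max 0 (x - (L m - L (m - 1)))) 0) \<in> S"
      using walk_wrap L_step[of "m - 1"] base m_ge by auto
    ultimately show ?case using m_ge
      by (intro exI[of _ "max 0 (x - (L m - L (m - 1)))"]) (auto intro: rtrancl_into_rtrancl)
  next
    case (step y)
    define x1 where "x1 = max 0 (x - (L (Suc y) - L y))"
    have x1: "0 \<le> x1" "x1 < o'" using L_step[of y] step.prems unfolding x1_def by auto
    obtain x' where x': "0 \<le> x'" "x' \<le> max 0 (x1 - (L (Suc (Suc y)) - L (Suc y)))" "(P x1 (Suc y), P x' 0) \<in> S\<^sup>*"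
      using step.IH[OF x1] by blast
    have "x' \<le> x1" using x'(2) x1 L_step[of "Suc y"] by linarith
    moreover have "(P x y, P x1 (Suc y)) \<in> S\<^sup>*"
      unfolding x1_def using step by (intro walk_up) auto
    ultimately show ?case using x' unfolding x1_def by (meson rtrancl_trans)
  qed
qed

lemma walk_to_origin:
  assumes "0 \<le> x" "x < o'"
  shows "(P x 0, P 0 0) \<in> S\<^sup>*"
  using assms
proof (induction "nat x" arbitrary: x rule: less_induct)
  case less
  obtain x' where x': "0 \<le> x'" "x' \<le> max 0 (x - L (Suc 0))" "(P x 0, P x' 0) \<in> S\<^sup>*"
    using walk_bottom[of 0 x] less.prems m_ge L_0 by auto
  show ?case
  proof (cases "x = 0")
    case False
    then have "nat x' < nat x" using x' less.prems L_1 by auto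
    then have "(P x' 0, P 0 0) \<in> S\<^sup>*" using less.hyps x' less.prems by auto
    then show ?thesis using x'(3) by (rule rtrancl_trans[rotated])
  qed simp
qed

lemma walk_from_origin:
  assumes "y \<le> m" "0 \<le> x" "x < o'"
  shows "(P 0 0, P x y) \<in> S\<^sup>*"
proof -
  have "(P 0 0, P 0 y) \<in> S\<^sup>*" using assms(1)
  proof (induction y)
    case (Suc y)
    have "max 0 (0 - (L (Suc y) - L y)) = 0" using L_step[of y] by simp
    then have "(P 0 y, P 0 (Suc y)) \<in> S\<^sup>*"
      using walk_up[of y 0] Suc.prems o_ge by simp
    then show ?case using Suc by (auto intro: rtrancl_trans)
  qed simp
  moreover have "(P 0 y, P (0 + int (nat x)) y) \<in> S\<^sup>*"
    using assms by (intro walk_right) auto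
  ultimately show ?thesis using assms by (auto intro: rtrancl_trans)
qed

lemma strongly_walkable_W: "strongly_walkable (2 * h) {g1, g2} W"
  unfolding strongly_walkable_def
proof (intro ballI)
  fix n n' assume n: "n \<in> W" "n' \<in> W"
  obtain x y where xy: "y < m" "0 \<le> x" "x < o'" "2 * h dvd n - P x y"
    using n unfolding W_def by blast
  obtain x' y' where xy': "y' < m" "0 \<le> x'" "x' < o'" "2 * h dvd n' - P x' y'"
    using n unfolding W_def by blast
  have "2 * h dvd - (n - P x y)" using xy by (simp only: dvd_minus_iff)
  then have "(n, P x y) \<in> S"
    using xy n P_in_W by (intro step_relI[of _ _ _ 0]) auto
  moreover obtain x'' where x'': "0 \<le> x''" "x'' \<le> max 0 (x - (L (Suc y) - L y))" "(P x y, P x'' 0) \<in> S\<^sup>*"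
    using walk_bottom xy by blast
  moreover have "x'' < o'" using x'' xy L_step[of y] by auto
  then have "(P x'' 0, P 0 0) \<in> S\<^sup>*" using x'' walk_to_origin by blast
  moreover have "(P 0 0, P x' y') \<in> S\<^sup>*" using xy' walk_from_origin by auto
  moreover have "(P x' y', n') \<in> S"
    using xy' n P_in_W by (intro step_relI[of _ _ _ 0]) auto
  ultimately show "(n, n') \<in> S\<^sup>*" by (meson converse_rtrancl_into_rtrancl rtrancl_trans rtrancl_into_rtrancl)
qed

text \<open>Two members at the odd distance \<open>g1\<close>, from which
  \<open>half_section_extend_finite\<close> obtains its shifts.\<close>

lemma pair_in_W: "P 0 0 \<in> W \<and> P 0 0 + g1 \<in> W"
  using P_in_W[of 0 0] P_in_W[of 0 1] o_ge by (auto simp: P_def algebra_simps)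

end

text \<open>Each new step is adjoined with shift \<open>0\<close> or \<open>g1\<close>. If both
  failed, the translation by \<open>M\<close> would exchange \<open>V\<close> with its complement
  among the multiples of \<open>e\<close>, and the failure for \<open>g1\<close> would make
  \<open>V\<close> closed under adding \<open>g1\<close>. But \<open>h\<close> such additions amount
  to adding \<open>h\<close> modulo \<open>2 * h\<close>, as \<open>g1\<close> is odd, and this
  leaves \<open>V\<close>.\<close>

lemma half_section_extend_finite:
  fixes h g1 d :: int
  assumes h: "h > 0" and g1: "odd g1" "d dvd g1" and d: "d > 0" "d dvd h"
    and W: "half_section h d W" "strongly_walkable (2 * h) D W" and n0: "n0 \<in> W" "n0 + g1 \<in> W"
    and F: "finite F"
  shows "\<exists>W'. half_section h (Gcd (insert d F)) W' \<and> strongly_walkable (2 * h) (D \<union> F) W' \<and> W \<subseteq> W'"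
  using F
proof (induction F rule: finite_induct)
  case empty
  then show ?case using W d(1) by (intro exI[of _ W]) simp
next
  case (insert g F)
  define e where "e = Gcd (insert d F)"
  have "e dvd d" unfolding e_def by (intro Gcd_dvd) simp
  moreover have "e \<ge> 0" unfolding e_def by simp
  ultimately have e: "e > 0" "e dvd h" "e dvd g1" using d g1 by (auto intro: dvd_trans simp: le_less)
  obtain V where V: "half_section h e V" "strongly_walkable (2 * h) (D \<union> F) V" "W \<subseteq> V"
    using insert.IH unfolding e_def by blast
  have nV: "n0 \<in> V" "n0 + g1 \<in> V" using n0 V by blast+
  define M where "M = (e div gcd e g) * g"
  obtain v where v: "g = gcd e g * v" by (meson dvdE gcd_dvd2)
  have "M = (e div gcd e g) * (gcd e g * v)" unfolding M_def using v by (rule arg_cong)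
  also have "\<dots> = e * v" by (metis dvd_div_mult_self gcd_dvd1 mult.assoc)
  finally have M: "e dvd M" by simp
  have Ve: "n \<in> V \<Longrightarrow> e dvd n" for n using V(1) unfolding half_section_def by blast
  have Vh: "e dvd n \<Longrightarrow> n + h \<in> V \<longleftrightarrow> n \<notin> V" for n using V(1) unfolding half_section_def by blast
  have "\<exists>\<beta>\<in>{0, g1}. \<exists>n\<in>V. n + M + \<beta> \<in> V"
  proof (rule ccontr)
    assume "\<not> ?thesis"
    then have "n + M + 0 \<notin> V" and no2: "n + M + g1 \<notin> V" if "n \<in> V" for n
      using that by blast+
    then have no: "n + M \<notin> V" if "n \<in> V" for n using that by simp
    have pred_mem: "n \<in> V" if "n + M + h \<in> V" "e dvd n" for n
    proof (rule ccontr)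
      assume "n \<notin> V"
      then have "n + h \<in> V" using Vh that by blast
      then have "n + h + M \<notin> V" by (rule no)
      then show False using that(1) by (simp add: algebra_simps)
    qed
    have inv_step: "n + g1 \<in> V" if "n \<in> V" for n
    proof (rule pred_mem)
      have en: "e dvd n" using Ve that .
      then have "n + M + g1 + h \<in> V" using Vh[of "n + M + g1"] no2[OF that] M e by simp
      then show "n + g1 + M + h \<in> V" by (simp add: algebra_simps)
      show "e dvd n + g1" using en e by simp
    qed
    have "n0 + int i * g1 \<in> V" for i
    proof (induction i)
      case (Suc i)
      then show ?case using inv_step[OF Suc] by (simp add: algebra_simps)
    qed (use nV in simp)
    from this[of "nat h"] have "n0 + h * g1 \<in> V" using h by simp
    moreover have "2 * h dvd (n0 + h * g1) - (n0 + h)"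
    proof -
      obtain s where "g1 = 2 * s + 1" using g1(1) by (rule oddE)
      then have "(n0 + h * g1) - (n0 + h) = (2 * h) * s" by (simp add: algebra_simps)
      then show ?thesis by simp
    qed
    ultimately have "n0 + h \<in> V" using half_section_cong[OF V(1) e(2)] by blast
    then show False using Vh Ve nV by blast
  qed
  then obtain \<beta> where \<beta>: "\<beta> \<in> {0, g1}" "\<exists>n\<in>V. n + M + \<beta> \<in> V" by blast
  have "e dvd \<beta>" using \<beta>(1) e by auto
  moreover have "\<exists>n\<in>V. n - \<beta> \<in> V"
    by (rule bexI[of _ "n0 + \<beta>"]) (use \<beta>(1) nV in auto)
  ultimately obtain W' where "half_section h (gcd e g) W'" "V \<subseteq> W'"
    "strongly_walkable (2 * h) (insert g (D \<union> F)) W'"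
    using half_section_extend[OF e(1,2) V(1,2), of \<beta> g] \<beta>(2) unfolding M_def by blast
  moreover have "gcd e g = Gcd (insert d (insert g F))"
    unfolding e_def by (simp add: ac_simps)
  ultimately show ?case using V(3) by (intro exI[of _ W']) auto
qed

lemma half_section_exists:
  fixes h :: int
  assumes "finite D" "h > 0" "odd h" "Gcd (insert h D) = 1"
    and "(\<forall>g\<in>D. even g) \<or> (\<exists>g1\<in>D. \<exists>g2\<in>D. odd g1 \<and> \<not> h dvd g1 \<and> \<not> gcd h g1 dvd g2)"
  shows "\<exists>W. half_section h 1 W \<and> strongly_walkable (2 * h) D W"
  using assms(5)
proof
  assume "\<forall>g\<in>D. even g"
  then show ?thesis using half_section_all_even[OF assms(1-3) _ assms(4)] by blast
next
  assume "\<exists>g1\<in>D. \<exists>g2\<in>D. odd g1 \<and> \<not> h dvd g1 \<and> \<not> gcd h g1 dvd g2"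
  then obtain g1 g2 where g: "g1 \<in> D" "g2 \<in> D" "odd g1" "\<not> h dvd g1" "\<not> gcd h g1 dvd g2" by blast
  interpret odd_step h g1 g2 using assms(2,3) g by unfold_locales
  define d where "d = gcd (gcd h g1) g2"
  have d: "d > 0" "d dvd h" "d dvd g1" "d dvd g2"
    unfolding d_def using assms(2) by (auto intro: dvd_trans)
  have "half_section h d W" using half_section_W unfolding d_def e_def .
  then obtain W' where W': "half_section h (Gcd (insert d D)) W'" "strongly_walkable (2 * h) ({g1, g2} \<union> D) W'"
    using half_section_extend_finite[OF assms(2) g(3) d(3,1,2) _ strongly_walkable_W _ _ assms(1)] pair_in_W
    by blast
  have "Gcd (insert d D) dvd x" if "x \<in> insert h D" for x
    using that Gcd_dvd[of d "insert d D"] Gcd_dvd[of x "insert d D"] d(2) by (auto intro: dvd_trans)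
  then have "Gcd (insert d D) dvd Gcd (insert h D)" by (rule Gcd_greatest)
  then have "Gcd (insert d D) dvd 1" unfolding assms(4) .
  moreover define c where "c = Gcd (insert d D)"
  ultimately have "c dvd 1" "c \<ge> 0" by simp_all
  then have "Gcd (insert d D) = 1" unfolding c_def[symmetric] by simp
  moreover have "{g1, g2} \<union> D = D" using g by blast
  ultimately show ?thesis using W' by auto
qed

section \<open>Lifting walks on residues to walks on the integers\<close>

definition exact_path :: "int set \<Rightarrow> int set \<Rightarrow> int list \<Rightarrow> bool"
  where "exact_path D W ps \<longleftrightarrow> ps \<noteq> [] \<and> set ps \<subseteq> W \<and> successively (\<lambda>p p'. p' - p \<in> insert 0 D) ps"

lemma exact_path_append:
  assumes "exact_path D W ps" "exact_path D W qs" "hd qs = last ps"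
  shows "exact_path D W (ps @ tl qs) \<and> last (ps @ tl qs) = last qs \<and> hd (ps @ tl qs) = hd ps
    \<and> set (ps @ tl qs) = set ps \<union> set qs"
proof -
  obtain q qs' where qs: "qs = q # qs'" using assms(2) unfolding exact_path_def by (cases qs) auto
  have "last ps \<in> set ps" using assms(1) unfolding exact_path_def by simp
  then show ?thesis
    using assms unfolding qs exact_path_def
    by (auto simp: successively_append_iff successively_Cons)
qed

text \<open>Membership in \<open>W\<close> depends only on the residue modulo \<open>2 * h\<close>,
  so the steps can be replayed exactly; only the end point is determined merely up to
  congruence.\<close>

lemma exact_path_lift:
  assumes "half_section h 1 W" "(n, n') \<in> (step_rel (2 * h) D W)\<^sup>*" "n \<in> W"
  shows "\<exists>ps. exact_path D W ps \<and> hd ps = n \<and> 2 * h dvd last ps - n'"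
  using assms(2)
proof (induction rule: rtrancl_induct)
  case base
  show ?case using assms(3) by (intro exI[of _ "[n]"]) (simp add: exact_path_def)
next
  case (step y z)
  then obtain ps where ps: "exact_path D W ps" "hd ps = n" "2 * h dvd last ps - y" by blast
  obtain g where g: "z \<in> W" "g \<in> insert 0 D" "2 * h dvd z - y - g"
    using step(2) unfolding step_rel_def by blast
  have "2 * h dvd (last ps - y) - (z - y - g)" using ps(3) g(3) by (rule dvd_diff)
  then have d: "2 * h dvd last ps + g - z" by (simp add: algebra_simps)
  then have "last ps + g \<in> W" using half_section_cong[OF assms(1) one_dvd] g(1) by blast
  then have "exact_path D W (ps @ [last ps + g])"
    using ps(1) g(2) unfolding exact_path_def by (auto simp: successively_append_iff)
  moreover have "hd (ps @ [last ps + g]) = n" using ps(1,2) by (simp add: exact_path_def)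
  ultimately show ?case using d by (intro exI[of _ "ps @ [last ps + g]"]) simp
qed

lemma exact_path_visiting:
  assumes W: "half_section h 1 W" "strongly_walkable (2 * h) D W" and "n \<in> W"
    and F: "finite F" "F \<subseteq> W"
  shows "\<exists>ps. exact_path D W ps \<and> hd ps = n \<and> (\<forall>f\<in>F. \<exists>p\<in>set ps. 2 * h dvd p - f)"
  using F
proof (induction F rule: finite_induct)
  case empty
  show ?case using assms(3) by (intro exI[of _ "[n]"]) (simp add: exact_path_def)
next
  case (insert f F)
  then obtain ps where ps: "exact_path D W ps" "hd ps = n" "\<forall>f\<in>F. \<exists>p\<in>set ps. 2 * h dvd p - f"
    by auto
  have l: "last ps \<in> W" using ps(1) unfolding exact_path_def by (meson last_in_set subsetD)
  then obtain qs where qs: "exact_path D W qs" "hd qs = last ps" "2 * h dvd last qs - f"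
    using exact_path_lift[OF W(1)] W(2) insert.prems unfolding strongly_walkable_def by (metis insert_subset)
  have "last qs \<in> set qs" using qs(1) by (simp add: exact_path_def)
  then have "\<forall>f'\<in>insert f F. \<exists>p\<in>set (ps @ tl qs). 2 * h dvd p - f'"
    using exact_path_append[OF ps(1) qs(1,2)] ps(3) qs(3) by auto
  then show ?case using exact_path_append[OF ps(1) qs(1,2)] ps(2) by metis
qed

text \<open>
  Unlike in \<open>step_rel\<close>, the steps are exact here and not just taken modulo \<open>2 * h\<close>.
\<close>

lemma recurrent_walk:
  fixes h :: int
  assumes W: "half_section h 1 W" "strongly_walkable (2 * h) D W" and h: "h > 0"
  shows "\<exists>G :: int \<Rightarrow> int. (\<forall>i. G i \<in> W \<and> G (i + 1) - G i \<in> insert 0 D) \<and>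
    (\<forall>n\<in>W. \<forall>N. (\<exists>i\<ge>N. 2 * h dvd G i - n) \<and> (\<exists>i\<le>N. 2 * h dvd G i - n))"
proof -
  have "0 \<in> W \<or> 0 + h \<in> W" using W(1) unfolding half_section_def by (meson one_dvd)
  then obtain n where n: "n \<in> W" by blast
  have "finite (W \<inter> {0..<2 * h})" by simp
  then obtain ps where ps: "exact_path D W ps" "hd ps = n"
    and cov: "\<forall>f\<in>W \<inter> {0..<2 * h}. \<exists>p\<in>set ps. 2 * h dvd p - f"
    using exact_path_visiting[OF W n] by blast
  have "last ps \<in> W" using ps(1) unfolding exact_path_def by (meson last_in_set subsetD)
  then have "(last ps, n) \<in> (step_rel (2 * h) D W)\<^sup>*"
    using W(2) n unfolding strongly_walkable_def by blast
  then obtain qs where qs: "exact_path D W qs" "hd qs = last ps" "2 * h dvd last qs - n"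
    using exact_path_lift[OF W(1)] \<open>last ps \<in> W\<close> by blast
  define rs where "rs = ps @ tl qs"
  define k where "k = length rs"
  define \<Delta> where "\<Delta> = last rs - n"
  have rs: "exact_path D W rs" "hd rs = n" "set ps \<subseteq> set rs" "2 * h dvd \<Delta>"
    using exact_path_append[OF ps(1) qs(1,2)] ps(2) qs(3) unfolding rs_def \<Delta>_def by auto
  have k: "k > 0" using rs(1) unfolding k_def exact_path_def by simp
  have path: "exact_path D W (n # rs)" using rs(1,2) n
    unfolding exact_path_def by (auto simp: successively_Cons)
  define p where "p j = (n # rs) ! j" for j
  have pW: "p j \<in> W" if "j \<le> k" for j
    using path that unfolding p_def exact_path_def k_def
    by (metis le_imp_less_Suc length_Cons nth_mem subsetD)
  have pD: "p (Suc j) - p j \<in> insert 0 D" if "j < k" for j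
    using path that successively_nth[of _ "n # rs" j] unfolding p_def exact_path_def k_def by auto
  have p0: "p 0 = n" and pk: "p k = n + \<Delta>"
    using rs(1) unfolding p_def k_def \<Delta>_def exact_path_def by (auto simp: last_conv_nth nth_Cons')
  \<comment> \<open>The path \<open>n # rs\<close> visits all residues of \<open>W\<close> and ends
    displaced by \<open>\<Delta>\<close>, a multiple of \<open>2 * h\<close>. Its translates by the
    multiples of \<open>\<Delta>\<close> fit together end to start, in both directions.\<close>
  define G where "G i = p (nat (i mod int k)) + (i div int k) * \<Delta>" for i
  have md: "0 \<le> i mod int k" "i mod int k < int k" for i using k by auto
  have shift: "2 * h dvd (x + t * \<Delta>) - x" for x t using rs(4) by simp
  have GW: "G i \<in> W" for i
  proof -
    have "nat (i mod int k) \<le> k" using md[of i] by linarith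
    then show ?thesis unfolding G_def
      using half_section_cong[OF W(1) one_dvd shift] pW by blast
  qed
  have GD: "G (i + 1) - G i \<in> insert 0 D" for i
  proof -
    define j where "j = nat (i mod int k)"
    have j: "j < k" "int j = i mod int k" using md[of i] unfolding j_def by linarith+
    have i: "i = int k * (i div int k) + int j" using j(2) by simp
    have "G (i + 1) = p (Suc j) + (i div int k) * \<Delta>"
    proof (cases "Suc j < k")
      case True
      have "i + 1 = int k * (i div int k) + int (Suc j)" using i by linarith
      then have "(i + 1) div int k = i div int k" "(i + 1) mod int k = int (Suc j)"
        using True int_div_pos_eq[of "i + 1" "int k" "i div int k" "int (Suc j)"]
          int_mod_pos_eq[of "i + 1" "int k" "i div int k" "int (Suc j)"] by simp_all
      then show ?thesis unfolding G_def by (simp del: of_nat_Suc)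
    next
      case False
      then have "Suc j = k" using j by simp
      then have "i + 1 = int k * (i div int k + 1) + 0" using i by (simp add: algebra_simps)
      then have "(i + 1) div int k = i div int k + 1" "(i + 1) mod int k = 0"
        using k int_div_pos_eq[of "i + 1" "int k" "i div int k + 1" 0]
          int_mod_pos_eq[of "i + 1" "int k" "i div int k + 1" 0] by simp_all
      then show ?thesis unfolding G_def using \<open>Suc j = k\<close> p0 pk by (simp add: algebra_simps)
    qed
    then show ?thesis using pD[OF j(1)] unfolding G_def j_def[symmetric] by simp
  qed
  have hit: "\<exists>j<k. \<forall>t. 2 * h dvd G (int k * t + int j) - m" if "m \<in> W" for m
  proof -
    define f where "f = m mod (2 * h)"
    have "2 * h dvd f - m" unfolding f_def by (simp add: mod_eq_dvd_iff[symmetric])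
    then have "f \<in> W" using half_section_cong[OF W(1) one_dvd] that by blast
    moreover have "0 \<le> f" "f < 2 * h" using h unfolding f_def by auto
    ultimately have "f \<in> W \<inter> {0..<2 * h}" by simp
    then obtain q where q: "q \<in> set rs" "2 * h dvd q - f" using cov rs(3) by blast
    obtain j where "j < k" "rs ! j = q" using q(1) unfolding k_def by (metis in_set_conv_nth)
    then have j: "Suc j \<le> k" "p (Suc j) = q" unfolding p_def by auto
    have "\<exists>j<k. 2 * h dvd p j - q"
    proof (cases "Suc j = k")
      case True
      then have "p 0 - q = - \<Delta>" using p0 pk j by simp
      then show ?thesis using k rs(4) by (intro exI[of _ 0]) simp
    next
      case False
      then show ?thesis using j by (intro exI[of _ "Suc j"]) simp
    qed
    then obtain j' where j': "j' < k" "2 * h dvd p j' - q" by blast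
    have "2 * h dvd G (int k * t + int j') - m" for t
    proof -
      have "(int k * t + int j') div int k = t" "(int k * t + int j') mod int k = int j'"
        using j' by auto
      then have "G (int k * t + int j') = p j' + t * \<Delta>" unfolding G_def by simp
      moreover have "2 * h dvd ((p j' + t * \<Delta>) - p j') + (p j' - q) + (q - f) + (f - m)"
        using shift[of "p j'" t] j'(2) q(2) \<open>2 * h dvd f - m\<close> by (intro dvd_add)
      ultimately show ?thesis by (simp add: algebra_simps)
    qed
    then show ?thesis using j'(1) by blast
  qed
  have "(\<exists>i\<ge>N. 2 * h dvd G i - m) \<and> (\<exists>i\<le>N. 2 * h dvd G i - m)" if m: "m \<in> W" for m N
  proof -
    obtain j where j: "j < k" "\<And>t. 2 * h dvd G (int k * t + int j) - m" using hit[OF m] by blast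
    have "int k * \<bar>N\<bar> \<ge> \<bar>N\<bar>" using k by (simp add: mult_le_cancel_right1)
    then have "int k * \<bar>N\<bar> + int j \<ge> N" by linarith
    moreover have "int k * (- \<bar>N\<bar> - 1) + int j \<le> N"
      using \<open>int k * \<bar>N\<bar> \<ge> \<bar>N\<bar>\<close> j(1) by (simp add: algebra_simps)
    ultimately show ?thesis using j(2) by blast
  qed
  then show ?thesis using GW GD by blast
qed

section \<open>The column construction\<close>

text \<open>Here the switches form an injective two-way sequence and \<open>\<sigma>\<close> is its
  successor map, which is automatically transitive.\<close>

lemma haar_ray_pairing_seq:
  fixes U B :: "int set" and \<delta> y :: "int \<Rightarrow> int"
  assumes "c \<in> B" "w + c \<in> B" "\<And>n. n + w \<in> U \<longleftrightarrow> n \<notin> U"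
    and "bij_betw \<delta> U U" "\<And>n. n \<in> U \<Longrightarrow> n + c - \<delta> n \<in> B"
    and y: "inj y" "\<And>k. y k \<in> U" "\<And>k. y (k + 1) - \<delta> (y k) - w + c \<in> B"
    and fwd: "\<And>n. n \<in> U \<Longrightarrow> \<exists>i k. (\<delta> ^^ i) n = y k"
    and bwd: "\<And>n. n \<in> U \<Longrightarrow> \<exists>k i. (\<delta> ^^ i) (y k) = n"
  shows "haar_ray B"
proof -
  define \<sigma> where "\<sigma> x = y (inv_into UNIV y x + 1)" for x
  have \<sigma>y: "\<sigma> (y k) = y (k + 1)" for k using y(1) by (simp add: \<sigma>_def)
  show ?thesis
  proof (rule haar_ray_pairing[of c B w U \<delta> "range y" \<sigma>])
    show "bij_betw \<sigma> (range y) (range y)"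
    proof (rule bij_betw_byWitness[where f' = "\<lambda>x. y (inv_into UNIV y x - 1)"])
      show "\<sigma> ` range y \<subseteq> range y" using \<sigma>y by auto
    qed (use y(1) \<sigma>y in \<open>auto simp: \<sigma>_def\<close>)
    show "x \<in> range y \<Longrightarrow> \<sigma> x - \<delta> x - w + c \<in> B" for x using y(3) \<sigma>y by auto
    show "range y \<inter> Z = {} \<or> range y \<subseteq> Z" if Z: "\<And>x. x \<in> range y \<Longrightarrow> \<sigma> x \<in> Z \<longleftrightarrow> x \<in> Z" for Z
    proof -
      have step: "y (k + 1) \<in> Z \<longleftrightarrow> y k \<in> Z" for k using Z[of "y k"] \<sigma>y by simp
      have "y k \<in> Z \<longleftrightarrow> y 0 \<in> Z" for k
      proof (induction k rule: int_induct[where k = 0])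
        case (step1 i)
        then show ?case using step[of i] by simp
      next
        case (step2 i)
        then show ?case using step[of "i - 1"] by simp
      qed simp
      then show ?thesis by blast
    qed
    show "\<exists>i. (\<delta> ^^ i) n \<in> range y" if "n \<in> U" for n using fwd[OF that] by auto
    show "\<exists>x\<in>range y. \<exists>i. (\<delta> ^^ i) x = n" if "n \<in> U" for n using bwd[OF that] by blast
  qed (use assms in auto)
qed

lemma translation_funpow: "((\<lambda>n. n + q) ^^ i) n = n + int i * (q :: int)"
  by (induction i) (auto simp: algebra_simps)

lemma slow_walk_bound:
  fixes G :: "int \<Rightarrow> int"
  assumes "\<And>i. \<bar>G (i + 1) - G i\<bar> \<le> M"
  shows "\<bar>G i - G j\<bar> \<le> M * \<bar>i - j\<bar>"
proof -
  have *: "\<bar>G (j + int t) - G j\<bar> \<le> M * int t" for j t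
  proof (induction t)
    case (Suc t)
    have "\<bar>G (j + int t + 1) - G j\<bar> \<le> M + M * int t"
      using assms[of "j + int t"] Suc by linarith
    then show ?case by (simp add: algebra_simps)
  qed simp
  show ?thesis using *[of j "nat (i - j)"] *[of i "nat (j - i)"] by (cases "i \<ge> j") auto
qed

text \<open>Any window of \<open>q\<close> consecutive factors will do, since the order of
  \<open>\<kappa>\<close> modulo \<open>q\<close> is at most \<open>q\<close>.\<close>

lemma block_residue:
  fixes \<kappa> q r k0 :: int
  assumes "q > 0" "gcd q \<kappa> dvd r"
  shows "\<exists>k. k0 \<le> k \<and> k < k0 + q \<and> q dvd r - k * \<kappa>"
proof -
  have "gcd q \<kappa> dvd k0 * \<kappa>" by (intro dvd_mult) simp
  then have "gcd q \<kappa> dvd r - k0 * \<kappa>" using assms(2) by (intro dvd_diff)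
  then obtain j where j: "j < nat (q div gcd q \<kappa>)" "q dvd r - k0 * \<kappa> - int j * \<kappa>"
    using multiple_mod_gcd[OF assms(1)] by blast
  have "q div gcd q \<kappa> \<le> q" 
  proof -
    have "gcd q \<kappa> > 0" using assms(1) by simp
    then have "gcd q \<kappa> \<ge> 1" by linarith
    then show ?thesis using zdiv_mono2[of q 1 "gcd q \<kappa>"] assms(1) by simp
  qed
  then have "int j < q" using j(1) by linarith
  then show ?thesis using j(2) by (intro exI[of _ "k0 + int j"]) (simp add: algebra_simps)
qed

text \<open>
  Here \<open>\<delta>\<close> is the translation by \<open>\<beta> - \<alpha>\<close>. The switches are \<open>y k = k * \<kappa> + G (k div L)\<close> for a recurrent
  walk \<open>G\<close>: within a block of length \<open>L\<close> they run, with label \<open>\<gamma>\<close>, through all columns congruent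
  to \<open>G (k div L)\<close> modulo \<open>2 * h\<close>, and a step of \<open>G\<close> uses another label.
\<close>

lemma haar_ray_columns:
  fixes B :: "int set" and \<alpha> \<beta> \<gamma> :: int
  defines "h \<equiv> gcd (\<beta> - \<alpha>) (\<gamma> - \<alpha>)" and "D \<equiv> (\<lambda>b. b - \<gamma>) ` (B - {\<alpha>, \<beta>, \<gamma>})"
  assumes B: "finite B" "\<alpha> \<in> B" "\<beta> \<in> B" "\<gamma> \<in> B"
    and par: "\<alpha> < \<beta>" "even (\<beta> - \<alpha>)" "odd (\<gamma> - \<alpha>)" and ne: "2 * \<gamma> \<noteq> \<alpha> + \<beta>"
    and D: "\<forall>g\<in>D. \<not> h dvd g"
    and W: "half_section h 1 W" "strongly_walkable (2 * h) D W"
  shows "haar_ray B"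
proof -
  define Q where "Q = \<beta> - \<alpha>"
  \<comment> \<open>The displacement of a switch with label \<open>\<gamma>\<close>: the sum of
    \<open>Q\<close>, \<open>w - \<beta>\<close> and \<open>\<gamma>\<close> for
    \<open>w = \<gamma> - \<beta>\<close>.\<close>
  define \<kappa> where "\<kappa> = 2 * \<gamma> - \<alpha> - \<beta>"
  have Q: "Q > 0" "h dvd Q" "even Q" using par unfolding Q_def h_def by auto
  have h: "h > 0" "h dvd \<gamma> - \<alpha>" using par unfolding h_def by auto
  have h_odd: "odd h" using h(2) par(3) by (metis dvd_trans)
  then have cop: "coprime 2 h" by simp
  have Q2: "2 * h dvd Q" using Q cop by (simp add: divides_mult)
  have \<kappa>: "\<kappa> = 2 * (\<gamma> - \<alpha>) - Q" "\<kappa> \<noteq> 0" using ne unfolding \<kappa>_def Q_def by auto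
  have \<kappa>2: "2 * h dvd \<kappa>" unfolding \<kappa>(1) using dvd_diff[OF mult_dvd_mono[OF dvd_refl h(2)] Q2] .
  \<comment> \<open>This lets \<open>\<gamma>\<close>-switches alone reach all columns in one class
    modulo \<open>2 * h\<close>.\<close>
  have gcd_Q\<kappa>: "gcd Q \<kappa> dvd 2 * h"
  proof -
    obtain R where R: "Q = 2 * R" using Q(3) by blast
    have "gcd Q \<kappa> dvd \<kappa> + Q" by (intro dvd_add) auto
    then have "gcd Q \<kappa> dvd 2 * (\<gamma> - \<alpha>)" unfolding \<kappa>(1) by simp
    then have "gcd Q \<kappa> dvd gcd (2 * R) (2 * (\<gamma> - \<alpha>))"
      unfolding R[symmetric] by (intro gcd_greatest) auto
    then have "gcd Q \<kappa> dvd 2 * gcd R (\<gamma> - \<alpha>)"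
      using gcd_mult_distrib_int[of 2 R "\<gamma> - \<alpha>"] by simp
    moreover have "gcd R (\<gamma> - \<alpha>) dvd h" unfolding h_def Q_def[symmetric]
      by (intro gcd_greatest) (auto simp: R intro: dvd_trans[of _ R])
    then have "2 * gcd R (\<gamma> - \<alpha>) dvd 2 * h" by (intro mult_dvd_mono) auto
    ultimately show ?thesis by (meson dvd_trans)
  qed
  obtain G :: "int \<Rightarrow> int" where GW: "\<And>i. G i \<in> W" and GD: "\<And>i. G (i + 1) - G i \<in> insert 0 D"
    and G_up: "\<And>n N. n \<in> W \<Longrightarrow> \<exists>i\<ge>N. 2 * h dvd G i - n"
    and G_down: "\<And>n N. n \<in> W \<Longrightarrow> \<exists>i\<le>N. 2 * h dvd G i - n"
    using recurrent_walk[OF W h(1)] by blast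
  have "finite D" using B(1) unfolding D_def by simp
  define M' where "M' = (\<Sum>g\<in>D. \<bar>g\<bar>)"
  have "\<bar>g\<bar> \<le> M'" if "g \<in> D" for g
    unfolding M'_def using that \<open>finite D\<close> by (intro member_le_sum) auto
  moreover have M'0: "M' \<ge> 0" unfolding M'_def by (intro sum_nonneg) auto
  ultimately have M: "\<bar>G (i + 1) - G i\<bar> \<le> M'" for i using GD[of i] by auto
  \<comment> \<open>A block needs length at least \<open>Q\<close> to meet every column of its
    class, and more than \<open>2 * M'\<close> for the drift \<open>k * \<kappa>\<close> to outrun
    the walk \<open>G\<close>.\<close>
  define L where "L = Q + 2 * M' + 1"
  have L: "L > 0" "L \<ge> Q" "L > 2 * M'" using Q M'0 unfolding L_def by auto
  define y where "y k = k * \<kappa> + G (k div L)" for k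
  have cong: "n' \<in> W \<longleftrightarrow> n \<in> W" if "2 * h dvd n' - n" for n n'
    using half_section_cong[OF W(1) one_dvd that] .
  have bound: "\<bar>G i - G j\<bar> \<le> M' * \<bar>i - j\<bar>" for i j using M by (rule slow_walk_bound)
  have y_ne: "y k \<noteq> y k'" if "k' < k" for k k'
  proof
    assume eq: "y k = y k'"
    define q q' where "q = k div L" and "q' = k' div L"
    have qq: "q' \<le> q" using that L unfolding q_def q'_def by (intro zdiv_mono1) auto
    have E: "(k - k') * \<kappa> = G q' - G q" using eq unfolding y_def q_def q'_def by (simp add: algebra_simps)
    \<comment> \<open>In the same block the drift separates the switches. In adjacent blocks a
      coincidence would force a step of \<open>G\<close> divisible by \<open>h\<close>, hence
      \<open>0\<close>. In more distant blocks the drift exceeds what \<open>G\<close> can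
      compensate.\<close>
    consider "q = q'" | "q = q' + 1" | "q \<ge> q' + 2" using qq by linarith
    then show False
    proof cases
      case 1
      then show False using E \<kappa>(2) that by simp
    next
      case 2
      have "G q - G q' \<in> insert 0 D" using GD[of q'] 2 by simp
      moreover have "h dvd G q - G q'"
      proof -
        have "h dvd \<kappa>" using \<kappa>2 by (rule dvd_mult_right)
        then have "h dvd G q' - G q" unfolding E[symmetric] by (rule dvd_mult)
        then show ?thesis by (metis dvd_minus_iff minus_diff_eq)
      qed
      ultimately have "G q - G q' = 0" using D by blast
      then show False using E \<kappa>(2) that by simp
    next
      case 3
      have kq: "k = L * q + k mod L" "k' = L * q' + k' mod L" unfolding q_def q'_def by simp_all
      have "0 \<le> k mod L" "k' mod L < L" using L by auto
      then have "L * (q - q' - 1) < k - k'" using kq by (simp add: algebra_simps)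
      also have "\<dots> \<le> \<bar>(k - k') * \<kappa>\<bar>"
        using \<kappa>(2) that by (simp add: abs_mult mult_le_cancel_left1)
      also have "\<dots> \<le> M' * (q - q')" unfolding E using bound[of q' q] 3 by simp
      finally have "L * (q - q' - 1) < M' * (q - q')" .
      moreover have "2 * M' * (q - q' - 1) \<le> L * (q - q' - 1)"
        using L 3 by (intro mult_right_mono) auto
      moreover have "M' * (q - q') \<le> M' * (2 * (q - q' - 1))"
        using 3 M'0 by (intro mult_left_mono) auto
      ultimately show False by (simp add: algebra_simps)
    qed
  qed
  have "inj y"
  proof (rule injI, rule ccontr)
    fix k k' assume "y k = y k'" "k \<noteq> k'"
    then show False using y_ne[of k k'] y_ne[of k' k] by (cases "k < k'") auto
  qed
  have yW: "y k \<in> W" for k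
  proof -
    have "2 * h dvd y k - G (k div L)" using \<kappa>2 unfolding y_def by simp
    then show ?thesis using cong GW by blast
  qed
  have y_step: "y (k + 1) - y k - \<kappa> + \<gamma> \<in> B" for k
  proof -
    have mods: "k div L = (k + 1) div L \<or> (k + 1) div L = k div L + 1"
    proof -
      have "k div L \<le> (k + 1) div L" using L by (intro zdiv_mono1) auto
      moreover have "(k + 1) div L \<le> (k + L) div L" using L by (intro zdiv_mono1) auto
      moreover have "(k + L) div L = k div L + 1" using L by simp
      ultimately show ?thesis by linarith
    qed
    then have "G ((k + 1) div L) - G (k div L) \<in> insert 0 D" using GD[of "k div L"] by auto
    moreover have "y (k + 1) - y k - \<kappa> = G ((k + 1) div L) - G (k div L)"
      unfolding y_def by (simp add: algebra_simps)
    ultimately show ?thesis using B unfolding D_def by auto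
  qed
  have block: "\<exists>k. k div L = q \<and> Q dvd n - y k" if "2 * h dvd G q - n" for q n
  proof -
    have "2 * h dvd n - G q" using that by (metis dvd_minus_iff minus_diff_eq)
    then have "gcd Q \<kappa> dvd n - G q" using gcd_Q\<kappa> by (rule dvd_trans[rotated])
    then obtain k where k: "q * L \<le> k" "k < q * L + Q" "Q dvd n - G q - k * \<kappa>"
      using block_residue[OF Q(1)] by blast
    have "k div L = q" using k L int_div_pos_eq[of k L q "k - q * L"] by (simp add: algebra_simps)
    moreover from this have "Q dvd n - y k" using k(3) unfolding y_def by (simp add: algebra_simps)
    ultimately show ?thesis by blast
  qed
  \<comment> \<open>After normalizing the direction of the drift, late blocks lie high and early
    blocks lie low. Recurrence of \<open>G\<close> then puts switches arbitrarily far up and down in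
    every column of \<open>W\<close>.\<close>
  define s where "s = sgn \<kappa>"
  have s: "s = 1 \<or> s = -1" "s * \<kappa> = \<bar>\<kappa>\<bar>" "\<bar>\<kappa>\<bar> \<ge> 1"
    using \<kappa>(2) unfolding s_def by (auto simp: sgn_if)
  have sG: "\<bar>s * G q\<bar> \<le> \<bar>G 0\<bar> + M' * \<bar>q\<bar>" for q
    using bound[of q 0] s(1) by auto
  have sy: "s * y k = k * \<bar>\<kappa>\<bar> + s * G (k div L)" for k
    unfolding y_def s(2)[symmetric] by (simp add: algebra_simps)
  have y_large: "s * y k \<ge> q - \<bar>G 0\<bar>" if "k div L = q" "q \<ge> 0" for k q
  proof -
    have kq: "k = L * q + k mod L" unfolding that(1)[symmetric] by simp
    have "0 \<le> L * q" "0 \<le> k mod L" using L that by auto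
    then have "k * 1 \<le> k * \<bar>\<kappa>\<bar>" using s(3) kq by (intro mult_left_mono) linarith+
    moreover have "(M' + 1) * q \<le> L * q" using L M'0 that by (intro mult_right_mono) linarith+
    ultimately show ?thesis
      using sy[of k] sG[of q] kq \<open>0 \<le> k mod L\<close> that by (simp add: algebra_simps)
  qed
  have y_small: "s * y k \<le> q + L + \<bar>G 0\<bar>" if "k div L = q" "q < 0" for k q
  proof -
    have kq: "k = L * q + k mod L" unfolding that(1)[symmetric] by simp
    have kmod: "k mod L < L" using L by auto
    have "L * q \<le> L * (- 1)" using L that by (intro mult_left_mono) auto
    then have "k \<le> 0" using kq kmod by linarith
    then have "k * \<bar>\<kappa>\<bar> \<le> k * 1" using s(3) by (intro mult_left_mono_neg) auto
    moreover have "L * q \<le> (M' + 1) * q" using L M'0 that by (intro mult_right_mono_neg) linarith+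
    ultimately show ?thesis
      using sy[of k] sG[of q] kq kmod that by (simp add: algebra_simps)
  qed
  have ex_large: "\<exists>k. Q dvd n - y k \<and> s * y k \<ge> N" if "n \<in> W" for n N
  proof -
    obtain q where q: "q \<ge> \<bar>N\<bar> + \<bar>G 0\<bar>" "2 * h dvd G q - n" using G_up[OF \<open>n \<in> W\<close>] by blast
    obtain k where k: "k div L = q" "Q dvd n - y k" using block[OF q(2)] by blast
    have "N \<le> s * y k" using y_large[OF k(1)] q(1) by linarith
    then show ?thesis using k(2) by blast
  qed
  have ex_small: "\<exists>k. Q dvd n - y k \<and> s * y k \<le> N" if "n \<in> W" for n N
  proof -
    obtain q where q: "q \<le> - \<bar>N\<bar> - \<bar>G 0\<bar> - L" "2 * h dvd G q - n" using G_down[OF \<open>n \<in> W\<close>] by blast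
    obtain k where k: "k div L = q" "Q dvd n - y k" using block[OF q(2)] by blast
    have "s * y k \<le> N" using y_small[OF k(1)] q(1) L(1) by linarith
    then show ?thesis using k(2) by blast
  qed
  have above: "\<exists>k. Q dvd n - y k \<and> y k \<ge> n" if "n \<in> W" for n
    using s(1) ex_large[OF that, of n] ex_small[OF that, of "- n"] by auto
  have below: "\<exists>k. Q dvd n - y k \<and> y k \<le> n" if "n \<in> W" for n
    using s(1) ex_small[OF that, of n] ex_large[OF that, of "- n"] by auto
  show ?thesis
  proof (rule haar_ray_pairing_seq[of \<beta> B "\<gamma> - \<beta>" W "\<lambda>n. n + Q" y])
    show "n + (\<gamma> - \<beta>) \<in> W \<longleftrightarrow> n \<notin> W" for n
    proof -
      have "h dvd (\<gamma> - \<alpha>) - Q" using dvd_diff[OF h(2) Q(2)] .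
      then obtain t where t: "\<gamma> - \<beta> = h * t" unfolding Q_def by auto
      have "odd (\<gamma> - \<beta>)" using par by auto
      then have "odd t" unfolding t by simp
      then obtain u where u: "t = 2 * u + 1" by (rule oddE)
      have "(n + (\<gamma> - \<beta>)) - (n + h) = (2 * h) * u" unfolding t u by (simp add: algebra_simps)
      then have "n + (\<gamma> - \<beta>) \<in> W \<longleftrightarrow> n + h \<in> W" by (intro cong) simp
      then show ?thesis using W(1) unfolding half_section_def by (meson one_dvd)
    qed
    have WQ: "n + Q \<in> W \<longleftrightarrow> n \<in> W" "n - Q \<in> W \<longleftrightarrow> n \<in> W" for n
      using Q2 by (auto intro!: cong)
    show "bij_betw (\<lambda>n. n + Q) W W"
      by (rule bij_betw_byWitness[where f' = "\<lambda>n. n - Q"]) (use WQ in auto)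
    show "y (k + 1) - (y k + Q) - (\<gamma> - \<beta>) + \<beta> \<in> B" for k
      using y_step[of k] unfolding \<kappa>_def Q_def by (simp add: algebra_simps)
    show "\<exists>i k. ((\<lambda>n. n + Q) ^^ i) n = y k" if "n \<in> W" for n
    proof -
      obtain k where k: "Q dvd n - y k" "y k \<ge> n" using above[OF \<open>n \<in> W\<close>] by blast
      then obtain t where t: "n - y k = Q * t" by blast
      then have "t \<le> 0" using k(2) Q(1) by (smt (verit) mult_pos_pos)
      then have "y k = n + int (nat (- t)) * Q" using t by (simp add: algebra_simps)
      then show ?thesis unfolding translation_funpow by metis
    qed
    show "\<exists>k i. ((\<lambda>n. n + Q) ^^ i) (y k) = n" if "n \<in> W" for n
    proof -
      obtain k where k: "Q dvd n - y k" "y k \<le> n" using below[OF \<open>n \<in> W\<close>] by blast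
      then obtain t where t: "n - y k = Q * t" by blast
      then have "t \<ge> 0" using k(2) Q(1) by (smt (verit) mult_pos_neg)
      then have "n = y k + int (nat t) * Q" using t by (simp add: algebra_simps)
      then show ?thesis unfolding translation_funpow by metis
    qed
  qed (use B yW \<open>inj y\<close> in \<open>auto simp: Q_def\<close>)
qed

section \<open>The hexagonal construction\<close>

text \<open>All displacements are congruent to \<open>\<tau>\<close> modulo the period, so the
  residue of the \<open>j\<close>-th iterate, and with it the next displacement, is known in
  advance.\<close>

lemma funpow_periodic_displacement:
  fixes a :: "int \<Rightarrow> int"
  assumes per: "\<And>n m. q dvd n - m \<Longrightarrow> a n = a m" and \<tau>: "\<And>n. q dvd a n - \<tau>"
  shows "((\<lambda>n. n + a n) ^^ i) n = n + (\<Sum>j<i. a (n + int j * \<tau>))"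
    and "q dvd ((\<lambda>n. n + a n) ^^ i) n - (n + int i * \<tau>)"
proof -
  have "q dvd (n + (\<Sum>j<i. a (n + int j * \<tau>))) - (n + int i * \<tau>)" for i
  proof (induction i)
    case (Suc i)
    then have "q dvd ((n + (\<Sum>j<i. a (n + int j * \<tau>))) - (n + int i * \<tau>)) + (a (n + int i * \<tau>) - \<tau>)"
      using \<tau> by (rule dvd_add)
    then show ?case by (simp add: algebra_simps)
  qed simp
  note * = this
  show **: "((\<lambda>n. n + a n) ^^ i) n = n + (\<Sum>j<i. a (n + int j * \<tau>))" for i
  proof (induction i)
    case (Suc i)
    have "a (n + (\<Sum>j<i. a (n + int j * \<tau>))) = a (n + int i * \<tau>)" using * by (rule per)
    then show ?case using Suc by simp
  qed simp
  show "q dvd ((\<lambda>n. n + a n) ^^ i) n - (n + int i * \<tau>)" unfolding ** by (rule *)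
qed

lemma sum_periodic_shift:
  fixes f :: "int \<Rightarrow> int"
  assumes "r > 0" "\<And>x. f (x + r) = f x"
  shows "(\<Sum>x\<in>{0..<r}. f (x + t)) = (\<Sum>x\<in>{0..<r}. f x)"
proof -
  have up: "f (x + int i * r) = f x" for x i
  proof (induction i)
    case (Suc i)
    then show ?case using assms(2)[of "x + int i * r"] by (simp add: algebra_simps)
  qed simp
  have per: "f (x + k * r) = f x" for x k
  proof (cases "k \<ge> 0")
    case True
    then show ?thesis using up[of x "nat k"] by simp
  next
    case False
    then show ?thesis using up[of "x + k * r" "nat (- k)"] by simp
  qed
  have f_mod: "f (x mod r) = f x" for x
    using per[of "x mod r" "x div r"] by simp
  have "(\<Sum>x\<in>{0..<r}. f (x + t)) = (\<Sum>x\<in>{0..<r}. f ((x + t) mod r))"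
    unfolding f_mod ..
  also have "\<dots> = (\<Sum>x\<in>{0..<r}. f x)"
  proof (rule sum.reindex_bij_witness[where i = "\<lambda>x. (x - t) mod r" and j = "\<lambda>x. (x + t) mod r"])
    fix x assume x: "x \<in> {0..<r}"
    show "((x + t) mod r - t) mod r = x" "((x - t) mod r + t) mod r = x"
      using x by (simp_all add: mod_diff_left_eq mod_add_left_eq)
  qed (use assms(1) in auto)
  finally show ?thesis .
qed

lemma int_div_less_iff:
  fixes d m n :: int
  assumes "d > 0"
  shows "m div d < n \<longleftrightarrow> m < d * n"
proof
  have m: "m = d * (m div d) + m mod d" "0 \<le> m mod d" "m mod d < d" using assms by auto
  show "m < d * n" if "m div d < n"
  proof -
    have "d * (m div d) \<le> d * (n - 1)" using assms that by (intro mult_left_mono) auto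
    moreover have "d * (n - 1) = d * n - d" by (simp add: right_diff_distrib)
    ultimately show ?thesis using m by linarith
  qed
  show "m div d < n" if "m < d * n"
  proof (rule ccontr)
    assume "\<not> m div d < n"
    then have "d * n \<le> d * (m div d)" using assms by (intro mult_left_mono) auto
    then show False using that m by linarith
  qed
qed

text \<open>As \<open>p\<close> is coprime to \<open>q\<close>, the points \<open>b + i * p\<close>
  visit each residue modulo \<open>q\<close> exactly once.\<close>

lemma count_rotation:
  fixes p q k b :: int
  assumes "q > 0" "coprime p q" "0 \<le> k" "k \<le> q"
  shows "(\<Sum>i<nat q. if (b + int i * p) mod q < k then 1 else 0) = k"
proof -
  define f where "f i = nat ((b + int i * p) mod q)" for i
  have "inj_on f {..<nat q}"
  proof (rule inj_onI)
    fix i j assume ij: "i \<in> {..<nat q}" "j \<in> {..<nat q}" "f i = f j"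
    have "(b + int i * p) mod q = (b + int j * p) mod q"
      using ij(3) assms(1) unfolding f_def by (simp add: eq_nat_nat_iff)
    then have "q dvd (b + int i * p) - (b + int j * p)" by (simp only: mod_eq_dvd_iff)
    then have "q dvd (int i - int j) * p" by (simp add: algebra_simps)
    moreover have "gcd q p = 1" using assms(2) by (simp add: gcd.commute)
    ultimately show "i = j"
      using multiple_mod_gcd_unique[of q i p j] assms(1) ij by simp
  qed
  moreover have "f ` {..<nat q} \<subseteq> {..<nat q}"
    using assms(1) by (auto simp: f_def nat_less_iff)
  ultimately have bij: "bij_betw f {..<nat q} {..<nat q}"
    by (simp add: bij_betw_def endo_inj_surj)
  have "(\<Sum>i<nat q. if (b + int i * p) mod q < k then 1 else 0) = (\<Sum>i<nat q. if int (f i) < k then 1 else (0::int))"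
    using assms(1) by (intro sum.cong) (auto simp: f_def)
  also have "\<dots> = (\<Sum>x<nat q. if int x < k then 1 else 0)"
    using sum.reindex_bij_betw[OF bij, of "\<lambda>x. if int x < k then 1 else 0"] .
  also have "\<dots> = (\<Sum>x\<in>{..<nat q} \<inter> {x. int x < k}. 1)"
    by (subst sum.inter_restrict) (auto intro: sum.cong)
  also have "{..<nat q} \<inter> {x. int x < k} = {..<nat k}" using assms(3,4) by auto
  finally show ?thesis using assms(3) by simp
qed

text \<open>
  A map commuting with the translation by \<open>q\<close> has an infinite orbit through every point that
  returns displaced.
\<close>

lemma drifting_orbit:
  fixes \<theta> :: "int \<Rightarrow> int"
  assumes q: "q > 0" and per: "\<And>n t. \<theta> (n + q * t) = \<theta> n + q * t"
    and \<theta>q: "(\<theta> ^^ nat q) y0 = y0 + q * s" and s: "s \<noteq> 0"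
  shows "\<exists>y :: int \<Rightarrow> int. inj y \<and> y 0 = y0 \<and> (\<forall>k. y (k + 1) = \<theta> (y k)) \<and>
    (\<forall>k t. y (k + q * t) = y k + q * (s * t))"
proof -
  define y where "y k = (\<theta> ^^ nat (k mod q)) y0 + q * (s * (k div q))" for k
  have y_shift: "y (k + q * t) = y k + q * (s * t)" for k t
    using q by (simp add: y_def algebra_simps)
  have y_step: "y (k + 1) = \<theta> (y k)" for k
  proof -
    have k: "k = q * (k div q) + k mod q" "0 \<le> k mod q" "k mod q < q" using q by auto
    have \<theta>y: "\<theta> (y k) = (\<theta> ^^ Suc (nat (k mod q))) y0 + q * (s * (k div q))"
      unfolding y_def per by simp
    show ?thesis
    proof (cases "k mod q + 1 = q")
      case True
      then have "k + 1 = q * (k div q) + q" using k(1) by linarith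
      then have "k + 1 = q * (k div q + 1)" by (simp add: distrib_left)
      then have "(k + 1) div q = k div q + 1" "(k + 1) mod q = 0" using q by simp_all
      moreover have "Suc (nat (k mod q)) = nat q" using True k by linarith
      ultimately show ?thesis unfolding \<theta>y using \<theta>q by (simp add: y_def algebra_simps)
    next
      case False
      have k1: "k + 1 = q * (k div q) + (k mod q + 1)" using k(1) by linarith
      have "(k + 1) div q = k div q" "(k + 1) mod q = k mod q + 1"
        using False k(2,3) k1 int_div_pos_eq[of "k + 1" q "k div q" "k mod q + 1"]
          int_mod_pos_eq[of "k + 1" q "k div q" "k mod q + 1"] by simp_all
      moreover have "nat (k mod q + 1) = Suc (nat (k mod q))" using k(2) by linarith
      ultimately show ?thesis unfolding \<theta>y by (simp add: y_def)
    qed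
  qed
  have ne: False if "k < k'" "y k = y k'" for k k'
  proof -
    have fw: "y (k + int i) = y (k' + int i)" for i
    proof (induction i)
      case (Suc i)
      have "y (k + int i + 1) = y (k' + int i + 1)" unfolding y_step using Suc by simp
      then show ?case by (simp add: algebra_simps)
    qed (use that in simp)
    have "y (k + int i * (k' - k)) = y k" for i
    proof (induction i)
      case (Suc i)
      have "y (k + int i * (k' - k)) = y (k' + int i * (k' - k))"
        using fw[of "i * nat (k' - k)"] that(1) by simp
      then show ?case using Suc by (simp add: algebra_simps)
    qed simp
    from this[of "nat q"] have "y (k + q * (k' - k)) = y k" using q by simp
    then show False using y_shift q s that(1) by simp
  qed
  have "inj y"
  proof (rule injI, rule ccontr)
    fix k k' assume "y k = y k'" "k \<noteq> k'"
    then show False using ne[of k k'] ne[of k' k] by (cases "k < k'") auto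
  qed
  moreover have "y 0 = y0" using q by (simp add: y_def)
  ultimately show ?thesis using y_step y_shift by blast
qed

text \<open>
  With \<open>M = gcd (\<beta> - \<alpha>) (c - \<alpha>)\<close>, the map \<open>\<delta>\<close> uses the label \<open>\<beta>\<close> on \<open>k\<close> out of \<open>q\<close> cells and \<open>\<alpha>\<close>
  on the others, with \<open>k = p - \<epsilon>\<close> chosen such that \<open>\<delta>\<close> is transitive on each residue class modulo
  \<open>M\<close>. The switches follow \<open>\<theta> = \<delta> + 2 * w\<close>. Its displacements over a period sum to a nonzero
  number for one of the two signs \<open>\<epsilon>\<close>, so some \<open>\<theta>\<close>-orbit drifts and meets every \<open>\<delta>\<close>-line in both
  directions.
\<close>

lemma haar_ray_hexagonal:
  fixes \<alpha> \<beta> c \<gamma> :: int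
  assumes B: "\<alpha> \<in> B" "c \<in> B" "\<beta> \<in> B" "\<gamma> \<in> B"
    and lt: "\<alpha> < c" "c < \<beta>" and par: "even (c - \<alpha>)" "even (\<beta> - \<alpha>)" "odd (\<gamma> - c)"
    and gcd1: "gcd (gcd (\<beta> - \<alpha>) (c - \<alpha>)) (\<gamma> - c) = 1"
  shows "haar_ray B"
proof -
  define w where "w = \<gamma> - c"
  define Q where "Q = \<beta> - \<alpha>"
  define M where "M = gcd Q (c - \<alpha>)"
  have Q: "Q > 0" "even Q" using lt par unfolding Q_def by auto
  have M: "M > 0" "even M" using Q par unfolding M_def by auto
  obtain q where q: "Q = M * q" unfolding M_def by (meson dvdE gcd_dvd1)
  obtain p where p: "c - \<alpha> = M * p" unfolding M_def by (meson dvdE gcd_dvd2)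
  have "M * p > 0" "M * p < M * q" using lt p q unfolding Q_def by auto
  then have pq: "0 < p" "p < q" using M(1) by (auto simp: zero_less_mult_iff)
  have "M * gcd q p = M * 1"
  proof -
    have "gcd (M * q) (M * p) = M" using M_def[symmetric] unfolding p q .
    then show ?thesis using gcd_mult_distrib_int[of M q p] M(1) by simp
  qed
  then have cop: "gcd q p = 1" using M(1) by simp
  have "\<exists>\<epsilon>. (\<epsilon> = 1 \<or> \<epsilon> = -1) \<and> M * \<epsilon> + 2 * w \<noteq> 0"
    using M(1) by (cases "M + 2 * w = 0") (auto intro: exI[of _ 1] exI[of _ "-1"])
  then obtain \<epsilon> where \<epsilon>: "\<epsilon> = 1 \<or> \<epsilon> = -1" "M * \<epsilon> + 2 * w \<noteq> 0" by blast
  define k where "k = p - \<epsilon>"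
  have k: "0 \<le> k" "k \<le> q" using \<epsilon>(1) pq unfolding k_def by auto
  define \<chi> where "\<chi> n = (if (n div M) mod q < k then 1 else (0::int))" for n
  have \<chi>_per: "\<chi> n = \<chi> m" if "Q dvd n - m" for n m
  proof -
    obtain t where "n - m = Q * t" using \<open>Q dvd n - m\<close> by blast
    then have "n = m + M * (q * t)" unfolding q by (simp add: algebra_simps)
    then have "n div M = m div M + q * t" using M(1) by simp
    then show ?thesis unfolding \<chi>_def by simp
  qed
  define a where "a n = M * p - Q * \<chi> n" for n
  define \<delta> where "\<delta> n = n + a n" for n
  have \<delta>_fun: "\<delta> = (\<lambda>n. n + a n)" unfolding \<delta>_def ..
  have a_per: "a n = a m" if "Q dvd n - m" for n m using \<chi>_per[OF that] unfolding a_def by simp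
  have a_mod: "Q dvd a n - M * p" for n unfolding a_def by simp
  have \<delta>_sum: "(\<delta> ^^ i) n = n + (\<Sum>j<i. a (n + int j * (M * p)))" for i n
    unfolding \<delta>_fun by (rule funpow_periodic_displacement(1)[OF a_per a_mod])
  have \<delta>_mod: "Q dvd (\<delta> ^^ i) n - (n + int i * (M * p))" for i n
    unfolding \<delta>_fun by (rule funpow_periodic_displacement(2)[OF a_per a_mod])
  \<comment> \<open>With \<open>k = p\<close> the \<open>q\<close> displacements would cancel.
    Changing \<open>k\<close> by one leaves a single period \<open>Q\<close>, up to sign, so the
    iterates of \<open>\<delta>\<close> drift through a whole class modulo \<open>M\<close> instead
    of closing up.\<close>
  have \<delta>q: "(\<delta> ^^ nat q) n = n + Q * \<epsilon>" for n
  proof -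
    have "(\<Sum>j<nat q. \<chi> (n + int j * (M * p))) = (\<Sum>j<nat q. if (n div M + int j * p) mod q < k then 1 else 0)"
    proof (rule sum.cong[OF refl])
      fix j
      have "(n + int j * (M * p)) div M = n div M + int j * p"
        using M(1) div_mult_self2[of M n "int j * p"] by (simp add: mult.left_commute)
      then show "\<chi> (n + int j * (M * p)) = (if (n div M + int j * p) mod q < k then 1 else 0)"
        unfolding \<chi>_def by simp
    qed
    also have "\<dots> = k" using pq k cop by (intro count_rotation) (auto simp: coprime_iff_gcd_eq_1 gcd.commute)
    finally have "(\<Sum>j<nat q. \<chi> (n + int j * (M * p))) = k" .
    then have "(\<Sum>j<nat q. a (n + int j * (M * p))) = q * (M * p) - Q * k"
      unfolding a_def using pq by (simp add: sum_subtractf sum_distrib_left[symmetric])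
    then show ?thesis unfolding \<delta>_sum k_def q by (simp add: algebra_simps)
  qed
  have \<delta>_per: "(\<delta> ^^ i) (n + Q * t) = (\<delta> ^^ i) n + Q * t" for i n t
  proof (induction i)
    case (Suc i)
    have "\<delta> (m + Q * t) = \<delta> m + Q * t" for m
      using a_per[of "m + Q * t" m] by (simp add: \<delta>_def)
    then show ?case using Suc by simp
  qed simp
  have \<delta>_iter: "(\<delta> ^^ (nat q * j)) n = n + Q * (\<epsilon> * int j)" for j n
  proof (induction j)
    case (Suc j)
    have "(\<delta> ^^ (nat q * Suc j)) n = (\<delta> ^^ nat q) ((\<delta> ^^ (nat q * j)) n)"
      by (simp add: funpow_add)
    then show ?case unfolding Suc \<delta>q by (simp add: algebra_simps)
  qed simp
  define a' where "a' n = a n + 2 * w" for n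
  define \<theta> where "\<theta> n = n + a' n" for n
  have \<theta>_fun: "\<theta> = (\<lambda>n. n + a' n)" unfolding \<theta>_def ..
  define \<tau> where "\<tau> = M * p + 2 * w"
  have a'_per: "a' n = a' m" if "Q dvd n - m" for n m using a_per[OF that] unfolding a'_def by simp
  have a'_mod: "Q dvd a' n - \<tau>" for n using a_mod[of n] unfolding a'_def \<tau>_def by simp
  have \<theta>_sum: "(\<theta> ^^ i) n = n + (\<Sum>j<i. a' (n + int j * (\<tau>)))" for i n
    unfolding \<theta>_fun by (rule funpow_periodic_displacement(1)[OF a'_per a'_mod])
  have \<theta>_mod: "Q dvd (\<theta> ^^ i) n - (n + int i * (\<tau>))" for i n
    unfolding \<theta>_fun by (rule funpow_periodic_displacement(2)[OF a'_per a'_mod])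
  obtain R where R: "Q = 2 * R" using Q(2) by blast
  obtain N where N: "M = 2 * N" using M(2) by blast
  define \<rho> where "\<rho> = N * p + w"
  have \<tau>\<rho>: "\<tau> = 2 * \<rho>" unfolding \<tau>_def \<rho>_def N by simp
  have "(\<Sum>x\<in>{0..<R}. a' (2 * x)) = R * (M * \<epsilon> + 2 * w)"
  proof -
    \<comment> \<open>A cell has length \<open>M = 2 * N\<close> and contains \<open>N\<close> even
      numbers; the cells with \<open>\<chi> = 1\<close> are the first \<open>k\<close> of the
      period.\<close>
    have "(\<Sum>x\<in>{0..<R}. \<chi> (2 * x)) = (\<Sum>x\<in>{0..<R}. if x < k * N then 1 else 0)"
    proof (rule sum.cong[OF refl])
      fix x assume x: "x \<in> {0..<R}"
      have "2 * x < M * q" using x R q by auto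
      then have "2 * x div M < q" using M(1) by (simp only: int_div_less_iff)
      then have "(2 * x div M) mod q = 2 * x div M" using x M(1) by (simp add: pos_imp_zdiv_nonneg_iff)
      moreover have "2 * x div M < k \<longleftrightarrow> x < k * N"
        using int_div_less_iff[OF M(1), of "2 * x" k] unfolding N by (simp add: mult.assoc mult.commute)
      ultimately show "\<chi> (2 * x) = (if x < k * N then 1 else 0)" unfolding \<chi>_def by simp
    qed
    also have "\<dots> = (\<Sum>x\<in>{0..<R} \<inter> {x. x < k * N}. 1)"
      by (subst sum.inter_restrict) (auto intro: sum.cong)
    also have "{0..<R} \<inter> {x. x < k * N} = {0..<k * N}"
    proof -
      have "k * N \<le> q * N" using k M(1) N by (intro mult_right_mono) auto
      then have "k * N \<le> R" using R q N by (simp add: mult.commute)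
      then show ?thesis by auto
    qed
    finally have *: "(\<Sum>x\<in>{0..<R}. \<chi> (2 * x)) = k * N" using k M(1) N by simp
    have "(\<Sum>x\<in>{0..<R}. a' (2 * x)) = R * (M * p + 2 * w) - Q * (k * N)"
      unfolding a'_def a_def using * Q(1) R
      by (simp add: sum_subtractf sum.distrib sum_distrib_left[symmetric] algebra_simps)
    also have "\<dots> = R * (M * \<epsilon> + 2 * w)" unfolding k_def R N by (simp add: algebra_simps)
    finally show ?thesis .
  qed
  then have drift: "(\<Sum>x\<in>{0..<R}. a' (2 * x)) \<noteq> 0" using \<epsilon>(2) Q(1) R by simp
  \<comment> \<open>Averaging: as \<open>\<tau>\<close> is even, the total over all even starting
    points modulo \<open>Q\<close> is \<open>nat Q\<close> times the nonzero sum above, so some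
    starting point has a nonzero total displacement.\<close>
  have "\<exists>x. (\<Sum>j<nat Q. a' (2 * x + int j * \<tau>)) \<noteq> 0"
  proof (rule ccontr)
    assume "\<not> ?thesis"
    then have "0 = (\<Sum>x\<in>{0..<R}. \<Sum>j<nat Q. a' (2 * x + int j * \<tau>))" by simp
    also have "\<dots> = (\<Sum>j<nat Q. \<Sum>x\<in>{0..<R}. a' (2 * (x + int j * \<rho>)))"
      unfolding \<tau>\<rho> by (subst sum.swap) (simp add: algebra_simps)
    also have "\<dots> = (\<Sum>j<nat Q. \<Sum>x\<in>{0..<R}. a' (2 * x))"
    proof (rule sum.cong[OF refl])
      fix j
      have "a' (2 * (x + R)) = a' (2 * x)" for x by (rule a'_per) (simp add: R)
      then show "(\<Sum>x\<in>{0..<R}. a' (2 * (x + int j * \<rho>))) = (\<Sum>x\<in>{0..<R}. a' (2 * x))"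
        using sum_periodic_shift[of R "\<lambda>x. a' (2 * x)" "int j * \<rho>"] Q(1) R by simp
    qed
    finally show False using drift Q(1) by simp
  qed
  then obtain x where x: "(\<Sum>j<nat Q. a' (2 * x + int j * \<tau>)) \<noteq> 0" by blast
  have "Q dvd ((\<theta> ^^ nat Q) (2 * x) - (2 * x + Q * \<tau>)) + Q * \<tau>"
    using \<theta>_mod[of "nat Q" "2 * x"] Q(1) by (intro dvd_add) auto
  then obtain s where s: "(\<theta> ^^ nat Q) (2 * x) - 2 * x = Q * s" by auto
  then have "s \<noteq> 0" using x unfolding \<theta>_sum by auto
  moreover have "\<theta> (n + Q * t) = \<theta> n + Q * t" for n t
    using a'_per[of "n + Q * t" n] unfolding \<theta>_def by simp
  moreover have "(\<theta> ^^ nat Q) (2 * x) = 2 * x + Q * s" using s by simp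
  ultimately obtain y :: "int \<Rightarrow> int" where y: "inj y" "y 0 = 2 * x" "\<And>k. y (k + 1) = \<theta> (y k)"
    and y_shift: "\<And>k t. y (k + Q * t) = y k + Q * (s * t)"
    using drifting_orbit[OF Q(1), of \<theta> "2 * x" s] by blast
  have a_even: "even (a n)" for n unfolding a_def using M Q by simp
  have y_even: "even (y k)" for k
  proof (induction k rule: int_induct[where k = 0])
    case (step1 i)
    then show ?case using y(3)[of i] a_even unfolding \<theta>_def a'_def by simp
  next
    case (step2 i)
    then show ?case using y(3)[of "i - 1"] a_even[of "y (i - 1)"] unfolding \<theta>_def a'_def by simp
  qed (simp add: y(2))
  \<comment> \<open>Modulo \<open>M\<close> each \<open>\<theta>\<close>-step adds
    \<open>2 * w\<close>, and \<open>w\<close> is coprime to \<open>M\<close>, so the orbit meets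
    every even class.\<close>
  have y_tube: "\<exists>k. M dvd n - y k" if "even n" for n
  proof -
    have "gcd M (2 * w) dvd 2"
    proof -
      have "gcd M w = 1" using gcd1 unfolding M_def Q_def w_def .
      then have "gcd M (2 * w) = gcd M 2"
        by (intro gcd_mult_right_right_cancel) (simp add: coprime_iff_gcd_eq_1)
      then show ?thesis by simp
    qed
    moreover have "2 dvd n - 2 * x" using that by simp
    ultimately have "gcd M (2 * w) dvd n - 2 * x" by (rule dvd_trans)
    then obtain j where j: "M dvd n - 2 * x - int j * (2 * w)"
      using multiple_mod_gcd[OF M(1)] by blast
    have "M dvd n - y (int i) - (int j - int i) * (2 * w)" if "i \<le> j" for i
      using that
    proof (induction i)
      case 0
      then show ?case using j y(2) by simp
    next
      case (Suc i)
      have "M dvd a (y (int i))" unfolding a_def q by simp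
      then have "M dvd (n - y (int i) - (int j - int i) * (2 * w)) - a (y (int i))"
        using Suc by (intro dvd_diff[OF Suc.IH]) auto
      moreover have "y (int (Suc i)) = y (int i) + a (y (int i)) + 2 * w"
        using y(3)[of "int i"] unfolding \<theta>_def a'_def by (simp add: add.commute)
      ultimately show ?case by (simp add: algebra_simps)
    qed
    from this[of j] show ?thesis by auto
  qed
  have reach: "\<exists>i t. (\<delta> ^^ i) n = m + Q * t" if "M dvd m - n" for n m
  proof -
    obtain d where d: "m - n = M * d" using \<open>M dvd m - n\<close> by blast
    obtain i where i: "q dvd d - int i * p"
      using multiple_mod_gcd[of q p d] pq cop by auto
    have "Q dvd (m - n) - M * (int i * p)"
      unfolding d q right_diff_distrib[symmetric] using i by simp
    then have "Q dvd ((\<delta> ^^ i) n - (n + int i * (M * p))) - ((m - n) - M * (int i * p))"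
      using \<delta>_mod[of i n] by (rule dvd_diff[rotated])
    then have "Q dvd (\<delta> ^^ i) n - m" by (simp add: algebra_simps)
    then obtain t where "(\<delta> ^^ i) n - m = Q * t" by blast
    then show ?thesis by (intro exI[of _ i] exI[of _ t]) simp
  qed
  have \<epsilon>\<epsilon>: "\<epsilon> * \<epsilon> = 1" using \<epsilon>(1) by auto
  have ss: "\<bar>t\<bar> \<le> s * s * \<bar>t\<bar>" for t
  proof -
    have "1 \<le> s * s" using \<open>s \<noteq> 0\<close> by (smt (verit) mult_le_0_iff zero_less_mult_iff)
    then show ?thesis using mult_right_mono[of 1 "s * s" "\<bar>t\<bar>"] by simp
  qed
  show ?thesis
  proof (rule haar_ray_pairing_seq[of c B w "{n. even n}" \<delta> y])
    show "c \<in> B" "w + c \<in> B" using B unfolding w_def by auto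
    show "n + w \<in> {n. even n} \<longleftrightarrow> n \<notin> {n. even n}" for n using par(3) unfolding w_def by simp
    have \<delta>_even: "even (\<delta> n) \<longleftrightarrow> even n" for n using a_even[of n] unfolding \<delta>_def by simp
    define \<delta>' where "\<delta>' m = m - a (m - M * p)" for m
    have per1: "a (\<delta> n - M * p) = a n" and per2: "a (\<delta>' n) = a (n - M * p)" for n
      by (rule a_per, simp add: \<delta>_def \<delta>'_def a_def)+
    have inv1: "\<delta>' (\<delta> n) = n" for n
      unfolding \<delta>'_def[of "\<delta> n"] per1 by (simp add: \<delta>_def)
    have inv2: "\<delta> (\<delta>' n) = n" for n
      unfolding \<delta>_def[of "\<delta>' n"] per2 by (simp add: \<delta>'_def)
    have \<delta>'_even: "even (\<delta>' n) \<longleftrightarrow> even n" for n using a_even unfolding \<delta>'_def by simp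
    show "bij_betw \<delta> {n. even n} {n. even n}"
      by (rule bij_betw_byWitness[where f' = \<delta>']) (use inv1 inv2 \<delta>_even \<delta>'_even in auto)
    show "n + c - \<delta> n \<in> B" for n
    proof -
      have "c - M * p = \<alpha>" using p by simp
      then show ?thesis using B unfolding \<delta>_def a_def \<chi>_def Q_def by (auto simp: algebra_simps)
    qed
    show "inj y" by fact
    show "y k \<in> {n. even n}" for k using y_even by simp
    show "y (k + 1) - \<delta> (y k) - w + c \<in> B" for k
      using B(4) unfolding y(3) \<theta>_def \<delta>_def a'_def w_def by simp
    show "\<exists>i k. (\<delta> ^^ i) n = y k" if "n \<in> {n. even n}" for n
    proof -
      obtain k where k: "M dvd n - y k" using y_tube \<open>n \<in> {n. even n}\<close> by blast
      then have "M dvd y k - n" by (metis dvd_minus_iff minus_diff_eq)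
      then obtain i t where it: "(\<delta> ^^ i) n = y k + Q * t" using reach by blast
      \<comment> \<open>Moving along the orbit by \<open>Q * l\<close> indices shifts the switch by
        \<open>Q * (s * l)\<close>. The sign and size of \<open>l\<close> put the shifted switch
        ahead of \<open>y k + Q * t\<close> in the direction \<open>\<epsilon>\<close>, and
        \<open>j\<close> rounds of \<open>q\<close> iterates close the gap.\<close>
      define l where "l = \<epsilon> * s * \<bar>t\<bar>"
      define j where "j = nat (\<epsilon> * (s * l - t))"
      have "\<epsilon> * (s * l - t) = (\<epsilon> * \<epsilon>) * (s * s * \<bar>t\<bar>) - \<epsilon> * t" unfolding l_def by (simp add: algebra_simps)
      also have "\<dots> \<ge> 0" using ss[of t] \<epsilon>(1) unfolding \<epsilon>\<epsilon> by auto
      finally have "\<epsilon> * int j = (\<epsilon> * \<epsilon>) * (s * l - t)" unfolding j_def by (simp add: algebra_simps)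
      then have j: "\<epsilon> * int j = s * l - t" unfolding \<epsilon>\<epsilon> by simp
      have "(\<delta> ^^ (nat q * j + i)) n = y k + Q * t + Q * (\<epsilon> * int j)"
        unfolding funpow_add o_apply it \<delta>_iter ..
      also have "\<dots> = y (k + Q * l)" unfolding j y_shift by (simp add: algebra_simps)
      finally show ?thesis by blast
    qed
    show "\<exists>k i. (\<delta> ^^ i) (y k) = n" if "n \<in> {n. even n}" for n
    proof -
      obtain k where k: "M dvd n - y k" using y_tube \<open>n \<in> {n. even n}\<close> by blast
      then obtain i t where it: "(\<delta> ^^ i) (y k) = n + Q * t" using reach by blast
      define l where "l = - (\<epsilon> * s * \<bar>t\<bar>)"
      define j where "j = nat (- (\<epsilon> * (s * l + t)))"
      have "- (\<epsilon> * (s * l + t)) = (\<epsilon> * \<epsilon>) * (s * s * \<bar>t\<bar>) - \<epsilon> * t" unfolding l_def by (simp add: algebra_simps)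
      also have "\<dots> \<ge> 0" using ss[of t] \<epsilon>(1) unfolding \<epsilon>\<epsilon> by auto
      finally have "\<epsilon> * int j = - ((\<epsilon> * \<epsilon>) * (s * l + t))" unfolding j_def by (simp add: algebra_simps)
      then have j: "\<epsilon> * int j = - (s * l + t)" unfolding \<epsilon>\<epsilon> by simp
      have "(\<delta> ^^ (nat q * j + i)) (y (k + Q * l)) = n + Q * t + Q * (s * l) + Q * (\<epsilon> * int j)"
        unfolding funpow_add o_apply y_shift \<delta>_per it \<delta>_iter by simp
      also have "\<dots> = n" unfolding j by (simp add: algebra_simps)
      finally show ?thesis by blast
    qed
  qed
qed

section \<open>Coprime differences\<close>

definition diff_coprime :: "int set \<Rightarrow> bool"
  where "diff_coprime B \<longleftrightarrow> (\<forall>d. (\<forall>b\<in>B. \<forall>b'\<in>B. d dvd b - b') \<longrightarrow> d dvd 1)"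

lemma haar_ray_mono: "haar_ray B \<Longrightarrow> B \<subseteq> B' \<Longrightarrow> haar_ray B'"
  unfolding haar_ray_def by blast

lemma haar_ray_consecutive:
  assumes "a \<in> B" "a + 1 \<in> B"
  shows "haar_ray B"
proof (rule haar_ray_of_matchings[of "\<lambda>n. n - a" "\<lambda>n. n - (a + 1)"])
  show "bij (\<lambda>n. n - a)" by (rule bij_betw_byWitness[where f' = "\<lambda>n. n + a"]) auto
  show "bij (\<lambda>n. n - (a + 1))" by (rule bij_betw_byWitness[where f' = "\<lambda>n. n + (a + 1)"]) auto
  show "Z = {} \<or> Z = UNIV"
    if Z: "\<And>n n'. n - a = n' - (a + 1) \<Longrightarrow> n \<in> Z \<longleftrightarrow> n' \<in> Z" for Z
  proof -
    have step: "n \<in> Z \<longleftrightarrow> n + 1 \<in> Z" for n by (rule Z) simp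
    have "n \<in> Z \<longleftrightarrow> 0 \<in> Z" for n
    proof (induction n rule: int_induct[where k = 0])
      case (step1 i)
      then show ?case using step[of i] by simp
    next
      case (step2 i)
      then show ?case using step[of "i - 1"] by simp
    qed simp
    then show ?thesis by blast
  qed
qed (use assms in auto)

text \<open>For contradicting minimality: labels may be dropped if every common divisor of the
  remaining differences also divides their distance to some kept label.\<close>

lemma diff_coprimeI:
  assumes "diff_coprime B" "B' \<subseteq> B" "c \<in> B'"
    and "\<And>d b. \<forall>b\<in>B'. \<forall>b'\<in>B'. d dvd b - b' \<Longrightarrow> b \<in> B - B' \<Longrightarrow> d dvd b - c"
  shows "diff_coprime B'"
  unfolding diff_coprime_def
proof (intro allI impI)
  fix d assume d: "\<forall>b\<in>B'. \<forall>b'\<in>B'. d dvd b - b'"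
  have dc: "d dvd b - c" if "b \<in> B" for b using assms(3,4) d that by blast
  have "d dvd b - b'" if "b \<in> B" "b' \<in> B" for b b'
    using dvd_diff[OF dc[OF that(1)] dc[OF that(2)]] by simp
  then show "d dvd 1" using assms(1) unfolding diff_coprime_def by blast
qed

text \<open>Minimality becomes non-divisibility: if \<open>h\<close> divided
  \<open>b - \<gamma>\<close>, or \<open>gcd h g1\<close> divided another step \<open>g2\<close>,
  the label of that step could be dropped. The assumption \<open>rest\<close> leaves out exactly the
  case of a single remaining label with odd step.\<close>

lemma haar_ray_minimal_columns:
  fixes B :: "int set"
  assumes B: "finite B" "diff_coprime B" and min: "\<And>b. b \<in> B \<Longrightarrow> \<not> diff_coprime (B - {b})"
    and abc: "\<alpha> \<in> B" "\<beta> \<in> B" "\<gamma> \<in> B"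
    and par: "\<alpha> < \<beta>" "even (\<beta> - \<alpha>)" "odd (\<gamma> - \<alpha>)" and ne: "2 * \<gamma> \<noteq> \<alpha> + \<beta>"
    and rest: "(\<forall>b\<in>B - {\<alpha>, \<beta>, \<gamma>}. even (b - \<gamma>)) \<or> card (B - {\<alpha>, \<beta>, \<gamma>}) \<ge> 2"
  shows "haar_ray B"
proof -
  define h where "h = gcd (\<beta> - \<alpha>) (\<gamma> - \<alpha>)"
  define D where "D = (\<lambda>b. b - \<gamma>) ` (B - {\<alpha>, \<beta>, \<gamma>})"
  have h: "h > 0" "odd h" using par unfolding h_def by auto
  have dvd_h: "d dvd h" if "\<forall>b\<in>B'. \<forall>b'\<in>B'. d dvd b - b'" "{\<alpha>, \<beta>, \<gamma>} \<subseteq> B'" for d B'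
    using that unfolding h_def by (intro gcd_greatest) auto
  have nd: "\<not> h dvd g" if "g \<in> D" for g
  proof
    assume "h dvd g"
    obtain b where b: "b \<in> B" "b \<notin> {\<alpha>, \<beta>, \<gamma>}" "g = b - \<gamma>" using \<open>g \<in> D\<close> unfolding D_def by blast
    have "diff_coprime (B - {b})"
    proof (rule diff_coprimeI[OF B(2), of _ \<gamma>])
      fix d b' assume d: "\<forall>b1\<in>B - {b}. \<forall>b2\<in>B - {b}. d dvd b1 - b2" "b' \<in> B - (B - {b})"
      have "d dvd h" by (rule dvd_h[OF d(1)]) (use b abc in auto)
      then show "d dvd b' - \<gamma>" using d(2) \<open>h dvd g\<close> b by (auto intro: dvd_trans)
    qed (use b abc in auto)
    then show False using min b by blast
  qed
  have nd2: "\<not> gcd h g1 dvd g2" if "g1 \<in> D" "g2 \<in> D" "g1 \<noteq> g2" for g1 g2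
  proof
    assume dvd: "gcd h g1 dvd g2"
    obtain b1 where b1: "b1 \<in> B" "b1 \<notin> {\<alpha>, \<beta>, \<gamma>}" "g1 = b1 - \<gamma>" using \<open>g1 \<in> D\<close> unfolding D_def by blast
    obtain b where b: "b \<in> B" "b \<notin> {\<alpha>, \<beta>, \<gamma>}" "g2 = b - \<gamma>" using \<open>g2 \<in> D\<close> unfolding D_def by blast
    have "diff_coprime (B - {b})"
    proof (rule diff_coprimeI[OF B(2), of _ \<gamma>])
      fix d b' assume d: "\<forall>b1\<in>B - {b}. \<forall>b2\<in>B - {b}. d dvd b1 - b2" "b' \<in> B - (B - {b})"
      have "d dvd h" by (rule dvd_h[OF d(1)]) (use b abc in auto)
      moreover have "d dvd g1" using d(1) b b1 abc that(3) by auto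
      ultimately have "d dvd gcd h g1" by (rule gcd_greatest)
      then show "d dvd b' - \<gamma>" using d(2) dvd b by (auto intro: dvd_trans)
    qed (use b abc in auto)
    then show False using min b by blast
  qed
  have "Gcd (insert h D) = 1"
  proof -
    define c where "c = Gcd (insert h D)"
    have c: "c dvd h" "\<And>g. g \<in> D \<Longrightarrow> c dvd g" unfolding c_def by (auto intro: Gcd_dvd simp del: Gcd_insert)
    have ca: "c dvd \<beta> - \<alpha>" "c dvd \<gamma> - \<alpha>" using c(1) unfolding h_def by auto
    have "c dvd b - \<alpha>" if "b \<in> B" for b
    proof (cases "b \<in> {\<alpha>, \<beta>, \<gamma>}")
      case False
      then have "c dvd (b - \<gamma>) + (\<gamma> - \<alpha>)" using c(2) ca that unfolding D_def by (intro dvd_add) auto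
      then show ?thesis by simp
    qed (use ca in auto)
    then have "c dvd (b - \<alpha>) - (b' - \<alpha>)" if "b \<in> B" "b' \<in> B" for b b'
      using that by (blast intro: dvd_diff)
    then have "c dvd 1" using B(2) unfolding diff_coprime_def by simp
    moreover have "c \<ge> 0" unfolding c_def by (simp del: Gcd_insert)
    ultimately show ?thesis unfolding c_def[symmetric] by simp
  qed
  moreover have "(\<forall>g\<in>D. even g) \<or> (\<exists>g1\<in>D. \<exists>g2\<in>D. odd g1 \<and> \<not> h dvd g1 \<and> \<not> gcd h g1 dvd g2)"
  proof (cases "\<forall>g\<in>D. even g")
    case False
    then obtain g1 where g1: "g1 \<in> D" "odd g1" by blast
    have "card D = card (B - {\<alpha>, \<beta>, \<gamma>})" unfolding D_def by (intro card_image) (auto simp: inj_on_def)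
    moreover have "\<not> (\<forall>b\<in>B - {\<alpha>, \<beta>, \<gamma>}. even (b - \<gamma>))" using False unfolding D_def by blast
    then have "card (B - {\<alpha>, \<beta>, \<gamma>}) \<ge> 2" using rest by blast
    ultimately have "card D \<ge> 2" by simp
    have "\<not> D \<subseteq> {g1}"
    proof
      assume "D \<subseteq> {g1}"
      then have "card D \<le> card {g1}" by (intro card_mono) auto
      then show False using \<open>card D \<ge> 2\<close> by simp
    qed
    then obtain g2 where "g2 \<in> D" "g1 \<noteq> g2" by blast
    then show ?thesis using g1 nd nd2 by blast
  qed blast
  moreover have "finite D" using B(1) unfolding D_def by simp
  ultimately obtain W where "half_section h 1 W" "strongly_walkable (2 * h) D W"
    using half_section_exists h by blast
  then show ?thesis
    using haar_ray_columns[OF B(1) abc par ne] nd unfolding h_def D_def by blast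
qed

lemma card_3_sorted:
  assumes "card T = 3"
  shows "\<exists>a b c :: int. a < b \<and> b < c \<and> T = {a, b, c}"
proof -
  obtain x y z where T: "T = {x, y, z}" "x \<noteq> y" "x \<noteq> z" "y \<noteq> z" using assms card_3_iff by metis
  consider "x < y" "y < z" | "x < z" "z < y" | "y < x" "x < z" | "y < z" "z < x" | "z < x" "x < y"
    | "z < y" "y < x"
    using T(2-4) by linarith
  then show ?thesis
  proof cases
    case 1 then show ?thesis using T(1) by blast
  next
    case 2 then show ?thesis using T(1) by (metis insert_commute)
  next
    case 3 then show ?thesis using T(1) by (metis insert_commute)
  next
    case 4 then show ?thesis using T(1) by (metis insert_commute)
  next
    case 5 then show ?thesis using T(1) by (metis insert_commute)
  next
    case 6 then show ?thesis using T(1) by (metis insert_commute)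
  qed
qed

text \<open>The larger parity class \<open>X1\<close> provides \<open>\<alpha>\<close> and
  \<open>\<beta>\<close>, the other one \<open>\<gamma>\<close>. If \<open>X1\<close> has two
  elements, all remaining labels have the parity of \<open>\<gamma>\<close>; with at least five
  labels, two remain. Sizes one and one give consecutive labels, sizes three and one the
  exception.\<close>

lemma haar_ray_minimal:
  fixes B :: "int set"
  assumes B: "finite B" "diff_coprime B" and min: "\<And>b. b \<in> B \<Longrightarrow> \<not> diff_coprime (B - {b})"
  shows "haar_ray B"
proof -
  define E1 where "E1 = {b \<in> B. even b}"
  define O1 where "O1 = {b \<in> B. odd b}"
  have not_all: "\<exists>b\<in>B. \<exists>b'\<in>B. odd (b - b')"
    using B(2) unfolding diff_coprime_def by (metis dvd_refl odd_one)
  then have ne: "E1 \<noteq> {}" "O1 \<noteq> {}" unfolding E1_def O1_def by auto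
  have "\<exists>V1 V2. V1 \<union> V2 = B \<and> V1 \<inter> V2 = {} \<and> V1 \<noteq> {} \<and> V2 \<noteq> {} \<and> card V2 \<le> card V1 \<and>
    (\<forall>x\<in>V1. \<forall>x'\<in>V1. even (x - x')) \<and> (\<forall>x\<in>V2. \<forall>x'\<in>V2. even (x - x')) \<and> (\<forall>x\<in>V1. \<forall>y\<in>V2. odd (y - x))"
  proof (cases "card O1 \<le> card E1")
    case True
    then show ?thesis using ne by (intro exI[of _ E1] exI[of _ O1]) (auto simp: E1_def O1_def)
  next
    case False
    then show ?thesis using ne by (intro exI[of _ O1] exI[of _ E1]) (auto simp: E1_def O1_def)
  qed
  then obtain X1 X2 where X: "X1 \<union> X2 = B \<and> X1 \<inter> X2 = {} \<and> X1 \<noteq> {} \<and> X2 \<noteq> {} \<and> card X2 \<le> card X1 \<and>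
    (\<forall>x\<in>X1. \<forall>x'\<in>X1. even (x - x')) \<and> (\<forall>x\<in>X2. \<forall>x'\<in>X2. even (x - x')) \<and> (\<forall>x\<in>X1. \<forall>y\<in>X2. odd (y - x))"
    by (elim exE) (rule that)
  then have X12: "X1 \<union> X2 = B" "X1 \<inter> X2 = {}" "X1 \<noteq> {}" "X2 \<noteq> {}" "card X2 \<le> card X1"
    by - (elim conjE, assumption)+
  have in1: "x \<in> B" if "x \<in> X1" for x using X12(1) that by blast
  have in2: "x \<in> B" if "x \<in> X2" for x using X12(1) that by blast
  have ev1: "even (x - x')" if "x \<in> X1" "x' \<in> X1" for x x' using X that by blast
  have ev2: "even (x - x')" if "x \<in> X2" "x' \<in> X2" for x x' using X that by blast
  have od: "odd (y - x)" if "x \<in> X1" "y \<in> X2" for x y using X that by blast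
  have fin: "finite X1" "finite X2" using B(1) X12(1) by auto
  have card_B: "card B = card X1 + card X2" using X12(1,2) fin card_Un_disjoint by blast
  have pos: "card X1 > 0" "card X2 > 0" using fin X12 by (auto simp: card_gt_0_iff)
  consider "card X1 = 1" | "card X1 = 2" | "card X1 = 3" "card X2 = 1" | "card X1 \<ge> 3" "card B \<ge> 5"
    using pos X12(5) card_B by linarith
  then show ?thesis
  proof cases
    case 1
    then have "card X2 = 1" using pos X12(5) by simp
    then obtain a g where ag: "X1 = {a}" "X2 = {g}" using 1 card_1_singletonE by metis
    then have Beq: "B = {a, g}" using X12(1) by auto
    have "g - a dvd 1"
    proof -
      have "\<forall>b\<in>B. \<forall>b'\<in>B. g - a dvd b - b'" unfolding Beq
        using dvd_minus_iff[of "g - a" "g - a"] by auto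
      then show ?thesis using B(2) unfolding diff_coprime_def by blast
    qed
    then have "g = a + 1 \<or> a = g + 1" by auto
    then show ?thesis using haar_ray_consecutive[of a B] haar_ray_consecutive[of g B] Beq by auto
  next
    case 2
    obtain \<alpha> \<beta> where ab: "X1 = {\<alpha>, \<beta>}" "\<alpha> < \<beta>"
    proof -
      obtain x y where "X1 = {x, y}" "x \<noteq> y" using 2 card_2_iff by metis
      then show ?thesis using that[of x y] that[of y x] by (cases "x < y") auto
    qed
    \<comment> \<open>If the midpoint is the only choice, then
      \<open>\<beta> - \<gamma> = \<gamma> - \<alpha>\<close>, so dropping \<open>\<beta>\<close>
      keeps the differences coprime.\<close>
    have "\<exists>\<gamma>\<in>X2. 2 * \<gamma> \<noteq> \<alpha> + \<beta>"
    proof (rule ccontr)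
      assume "\<not> ?thesis"
      then have all: "\<And>g. g \<in> X2 \<Longrightarrow> 2 * g = \<alpha> + \<beta>" by blast
      obtain \<gamma> where \<gamma>: "\<gamma> \<in> X2" using X12 by blast
      have "g = \<gamma>" if "g \<in> X2" for g using all[OF that] all[OF \<gamma>] by simp
      then have X2: "X2 = {\<gamma>}" using \<gamma> by blast
      have "\<beta> \<notin> X2" using X12 ab by blast
      then have "\<gamma> \<noteq> \<beta>" using \<gamma> by blast
      have "diff_coprime (B - {\<beta>})"
      proof (rule diff_coprimeI[OF B(2), of _ \<gamma>])
        fix d b assume d: "\<forall>b1\<in>B - {\<beta>}. \<forall>b2\<in>B - {\<beta>}. d dvd b1 - b2" "b \<in> B - (B - {\<beta>})"
        have "\<alpha> \<in> B - {\<beta>}" "\<gamma> \<in> B - {\<beta>}" using ab X12 \<gamma> \<open>\<gamma> \<noteq> \<beta>\<close> by auto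
        then have "d dvd \<gamma> - \<alpha>" using d(1) by blast
        moreover have "b - \<gamma> = \<gamma> - \<alpha>" using d(2) all[OF \<gamma>] by auto
        ultimately show "d dvd b - \<gamma>" by simp
      qed (use X12 \<gamma> \<open>\<gamma> \<noteq> \<beta>\<close> in auto)
      then show False using min ab X12 by blast
    qed
    then obtain \<gamma> where \<gamma>: "\<gamma> \<in> X2" "2 * \<gamma> \<noteq> \<alpha> + \<beta>" by blast
    show ?thesis
    proof (rule haar_ray_minimal_columns[OF B min, of \<alpha> \<beta> \<gamma>])
      have "b \<in> X2" if "b \<in> B - {\<alpha>, \<beta>, \<gamma>}" for b using X12(1) ab(1) that by blast
      then show "(\<forall>b\<in>B - {\<alpha>, \<beta>, \<gamma>}. even (b - \<gamma>)) \<or> 2 \<le> card (B - {\<alpha>, \<beta>, \<gamma>})"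
        using ev2[OF _ \<gamma>(1)] by blast
    qed (use in1[of \<alpha>] in1[of \<beta>] in2[of \<gamma>] ab \<gamma> ev1[of \<beta> \<alpha>] od[of \<alpha> \<gamma>] in simp_all)
  next
    case 3
    obtain \<alpha> c \<beta> where abc: "\<alpha> < c" "c < \<beta>" "X1 = {\<alpha>, c, \<beta>}" using card_3_sorted 3 by blast
    obtain \<gamma> where \<gamma>: "X2 = {\<gamma>}" using 3 card_1_singletonE by metis
    have Beq: "B = {\<alpha>, c, \<beta>, \<gamma>}" using abc \<gamma> X12(1) by auto
    show ?thesis
    proof (rule haar_ray_hexagonal[of \<alpha> _ c \<beta> \<gamma>])
      let ?d = "gcd (gcd (\<beta> - \<alpha>) (c - \<alpha>)) (\<gamma> - c)"
      have d1: "?d dvd \<beta> - \<alpha>" "?d dvd c - \<alpha>" by (meson dvd_trans gcd_dvd1 gcd_dvd2)+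
      have "?d dvd (\<gamma> - c) + (c - \<alpha>)" by (intro dvd_add d1) simp
      then have d2: "?d dvd b - \<alpha>" if "b \<in> B" for b using that d1 unfolding Beq by auto
      have "?d dvd b - b'" if "b \<in> B" "b' \<in> B" for b b'
        using dvd_diff[OF d2[OF that(1)] d2[OF that(2)]] by simp
      then have "?d dvd 1" using B(2) unfolding diff_coprime_def by blast
      then show "?d = 1" by simp
    qed (use Beq abc \<gamma> ev1[of \<beta> \<alpha>] ev1[of c \<alpha>] od[of c \<gamma>] in simp_all)
  next
    case 4
    obtain T where "T \<subseteq> X1" "card T = 3" using 4(1) obtain_subset_with_card_n by metis
    then obtain \<alpha> b c where abc: "\<alpha> < b" "b < c" "{\<alpha>, b, c} \<subseteq> X1" using card_3_sorted by metis
    obtain \<gamma> where \<gamma>: "\<gamma> \<in> X2" using X12 by blast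
    \<comment> \<open>The label \<open>\<gamma>\<close> is the midpoint of \<open>\<alpha>\<close>
      and at most one of the two candidates.\<close>
    obtain \<beta> where \<beta>: "\<beta> \<in> {b, c}" "2 * \<gamma> \<noteq> \<alpha> + \<beta>" using abc(2) by (cases "2 * \<gamma> = \<alpha> + b") auto
    show ?thesis
    proof (rule haar_ray_minimal_columns[OF B min, of \<alpha> \<beta> \<gamma>])
      have "card B - card {\<alpha>, \<beta>, \<gamma>} \<le> card (B - {\<alpha>, \<beta>, \<gamma>})" by (rule diff_card_le_card_Diff) simp
      moreover have "card {\<alpha>, \<beta>, \<gamma>} \<le> 3" using card_length[of "[\<alpha>, \<beta>, \<gamma>]"] by simp
      ultimately show "(\<forall>b\<in>B - {\<alpha>, \<beta>, \<gamma>}. even (b - \<gamma>)) \<or> 2 \<le> card (B - {\<alpha>, \<beta>, \<gamma>})"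
        using 4(2) by linarith
    qed (use in1[of \<alpha>] in1[of \<beta>] in2[of \<gamma>] abc \<beta> \<gamma> ev1[of \<beta> \<alpha>] od[of \<alpha> \<gamma>] in auto)
  qed
qed

lemma haar_ray_of_diff_coprime:
  "finite B \<Longrightarrow> diff_coprime B \<Longrightarrow> haar_ray B"
proof (induction "card B" arbitrary: B rule: less_induct)
  case less
  show ?case
  proof (cases "\<exists>b\<in>B. diff_coprime (B - {b})")
    case True
    then obtain b where b: "b \<in> B" "diff_coprime (B - {b})" by blast
    then have "haar_ray (B - {b})"
      using less.hyps[of "B - {b}"] less.prems by (simp add: card_Diff1_less del: card_Diff_insert)
    then show ?thesis by (rule haar_ray_mono) blast
  next
    case False
    then show ?thesis using haar_ray_minimal less.prems by blast
  qed
qed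

section \<open>Adding rotations\<close>

definition dihedral_adj :: "int set \<Rightarrow> int set \<Rightarrow> int \<times> bool \<Rightarrow> int \<times> bool \<Rightarrow> bool"
  where "dihedral_adj A B u v \<longleftrightarrow>
    (if snd u = snd v then fst v - fst u \<in> A \<or> fst u - fst v \<in> A
     else (if snd u then fst u - fst v else fst v - fst u) \<in> B)"

lemma dihedral_adj_translate:
  "dihedral_adj A B (fst u + x, snd u) (fst v + x, snd v) \<longleftrightarrow> dihedral_adj A B u v"
  unfolding dihedral_adj_def by simp

text \<open>The subgroup generated by the rotation by \<open>d\<close> and the reflection with index
  \<open>b\<close>.\<close>

definition dihedral_class :: "int \<Rightarrow> int \<Rightarrow> (int \<times> bool) set"
  where "dihedral_class d b = {v. d dvd (if snd v then fst v - b else fst v)}"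

definition dihedral_ray :: "int set \<Rightarrow> int set \<Rightarrow> (int \<times> bool) set \<Rightarrow> bool"
  where "dihedral_ray A B V \<longleftrightarrow>
    (\<exists>u :: int \<Rightarrow> int \<times> bool. bij_betw u UNIV V \<and> (\<forall>k. dihedral_adj A B (u k) (u (k + 1))))"

lemma dihedral_ray_alternating:
  fixes f r :: "int \<Rightarrow> int \<times> bool"
  assumes f: "bij_betw f UNIV (dihedral_class d b \<inter> {v. snd v})"
    and r: "bij_betw r UNIV (dihedral_class d b \<inter> {v. \<not> snd v})"
    and adj: "\<And>k. dihedral_adj A B (f k) (r k)" "\<And>k. dihedral_adj A B (r k) (f (k + 1))"
  shows "dihedral_ray A B (dihedral_class d b)"
proof -
  define u where "u k = (if even k then f (k div 2) else r (k div 2))" for k :: int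
  have fS: "snd (f k)" "f k \<in> dihedral_class d b" for k
    using bij_betw_apply[OF f, of k] by auto
  have rS: "\<not> snd (r k)" "r k \<in> dihedral_class d b" for k
    using bij_betw_apply[OF r, of k] by auto
  have u2: "u (2 * k) = f k" "u (2 * k + 1) = r k" for k by (simp_all add: u_def)
  have sn: "snd (u k) \<longleftrightarrow> even k" for k using fS(1) rS(1) by (simp add: u_def)
  have "inj u"
  proof (rule injI)
    fix k k' assume eq: "u k = u k'"
    then have par: "even k \<longleftrightarrow> even k'" using sn by metis
    have "k div 2 = k' div 2"
    proof (cases "even k")
      case True
      then have "f (k div 2) = f (k' div 2)" using eq par by (simp add: u_def)
      then show ?thesis using f unfolding bij_betw_def by (simp add: inj_eq)
    next
      case False
      then have "r (k div 2) = r (k' div 2)" using eq par by (simp add: u_def)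
      then show ?thesis using r unfolding bij_betw_def by (simp add: inj_eq)
    qed
    then show "k = k'" using par by presburger
  qed
  moreover have "range u = dihedral_class d b"
  proof
    show "range u \<subseteq> dihedral_class d b" using fS rS unfolding u_def by auto
    show "dihedral_class d b \<subseteq> range u"
    proof
      fix v assume v: "v \<in> dihedral_class d b"
      show "v \<in> range u"
      proof (cases "snd v")
        case True
        then obtain k where "v = f k" using v f unfolding bij_betw_def by blast
        then show ?thesis using u2 by (metis rangeI)
      next
        case False
        then obtain k where "v = r k" using v r unfolding bij_betw_def by blast
        then show ?thesis using u2 by (metis rangeI)
      qed
    qed
  qed
  moreover have "dihedral_adj A B (u k) (u (k + 1))" for k
  proof (cases "even k")
    case True
    then obtain j where "k = 2 * j" by blast
    then show ?thesis using u2 adj(1) by simp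
  next
    case False
    then obtain j where "k = 2 * j + 1" by (rule oddE)
    moreover from this have "k + 1 = 2 * (j + 1)" by simp
    ultimately show ?thesis using u2 adj(2) by metis
  qed
  ultimately show ?thesis unfolding dihedral_ray_def bij_betw_def by blast
qed

lemma dihedral_ray_of_haar_ray:
  assumes "d > 0" and B: "\<And>x. x \<in> B' \<Longrightarrow> b + d * x \<in> B" and "haar_ray B'"
  shows "dihedral_ray A B (dihedral_class d b)"
proof -
  obtain f r :: "int \<Rightarrow> int" where fr: "bij f" "bij r" "\<And>k. f k - r k \<in> B'" "\<And>k. f (k + 1) - r k \<in> B'"
    using assms(3) unfolding haar_ray_def by blast
  have lin: "bij_betw (\<lambda>n. (x + d * n, e)) UNIV {v. d dvd fst v - x \<and> snd v = e}" for x e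
    by (rule bij_betw_byWitness[where f' = "\<lambda>v. (fst v - x) div d"]) (use assms(1) in auto)
  show ?thesis
  proof (rule dihedral_ray_alternating)
    have "bij_betw ((\<lambda>n. (b + d * n, True)) \<circ> f) UNIV {v. d dvd fst v - b \<and> snd v = True}"
      using fr(1) lin by (rule bij_betw_trans)
    moreover have "{v. d dvd fst v - b \<and> snd v = True} = dihedral_class d b \<inter> {v. snd v}"
      unfolding dihedral_class_def by auto
    ultimately show "bij_betw (\<lambda>k. (b + d * f k, True)) UNIV (dihedral_class d b \<inter> {v. snd v})"
      by (simp add: o_def)
    have "bij_betw ((\<lambda>n. (0 + d * n, False)) \<circ> r) UNIV {v. d dvd fst v - 0 \<and> snd v = False}"
      using fr(2) lin by (rule bij_betw_trans)
    moreover have "{v. d dvd fst v - 0 \<and> snd v = False} = dihedral_class d b \<inter> {v. \<not> snd v}"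
      unfolding dihedral_class_def by auto
    ultimately show "bij_betw (\<lambda>k. (d * r k, False)) UNIV (dihedral_class d b \<inter> {v. \<not> snd v})"
      by (simp add: o_def)
  qed (use B[OF fr(3)] B[OF fr(4)] in \<open>simp_all add: dihedral_adj_def algebra_simps\<close>)
qed

text \<open>The edges of labels \<open>a\<close> and \<open>b\<close> form a ladder with rungs
  \<open>b\<close> and rails \<open>a\<close>. The ray crosses every rung and uses the two rails
  alternately.\<close>

lemma dihedral_ray_ladder:
  assumes a: "a \<in> A" "a \<noteq> 0" and b: "b \<in> B"
  shows "dihedral_ray A B (dihedral_class \<bar>a\<bar> b)"
proof -
  define u where "u k = (let t = k div 2 in
    if even k \<longleftrightarrow> even t then (t * a, False) else (b + t * a, True))" for k :: int
  define v where "v x = (let t = (if snd x then fst x - b else fst x) div a in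
    if snd x \<longleftrightarrow> even t then 2 * t + 1 else 2 * t)" for x :: "int \<times> bool"
  have u2: "u (2 * t) = (if even t then (t * a, False) else (b + t * a, True))"
    "u (2 * t + 1) = (if even t then (b + t * a, True) else (t * a, False))" for t
    by (simp_all add: u_def Let_def)
  have v2: "v (t * a, False) = (if even t then 2 * t else 2 * t + 1)"
    "v (b + t * a, True) = (if even t then 2 * t + 1 else 2 * t)" for t
    using a(2) by (simp_all add: v_def Let_def)
  have vu: "v (u k) = k" for k
  proof (cases "even k")
    case True
    then obtain t where "k = 2 * t" by blast
    then show ?thesis using u2 v2 by simp
  next
    case False
    then obtain t where "k = 2 * t + 1" by (rule oddE)
    then show ?thesis using u2 v2 by simp
  qed
  have uv: "u (v x) = x" if x: "x \<in> dihedral_class \<bar>a\<bar> b" for x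
  proof (cases "snd x")
    case True
    then have "a dvd fst x - b" using x by (simp add: dihedral_class_def)
    then obtain t where "fst x - b = a * t" by (rule dvdE)
    then have "fst x = b + t * a" by (simp add: algebra_simps)
    then have "x = (b + t * a, True)" using True by (simp add: prod_eq_iff)
    then show ?thesis using u2 v2 by simp
  next
    case False
    then have "a dvd fst x" using x by (simp add: dihedral_class_def)
    then obtain t where "fst x = a * t" by (rule dvdE)
    then have "x = (t * a, False)" using False by (simp add: prod_eq_iff)
    then show ?thesis using u2 v2 by simp
  qed
  have "bij_betw u UNIV (dihedral_class \<bar>a\<bar> b)"
    by (rule bij_betw_byWitness[where f' = v]) (use vu uv in \<open>auto simp: u_def dihedral_class_def Let_def\<close>)
  moreover have "dihedral_adj A B (u k) (u (k + 1))" for k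
  proof (cases "even k")
    case True
    then obtain t where k: "k = 2 * t" by blast
    show ?thesis unfolding k u2 using b by (simp add: dihedral_adj_def)
  next
    case False
    then obtain t where "k = 2 * t + 1" by (rule oddE)
    then have k: "u k = u (2 * t + 1)" "u (k + 1) = u (2 * (t + 1))" by (simp_all add: algebra_simps)
    show ?thesis unfolding k u2 using a(1) by (simp add: dihedral_adj_def algebra_simps)
  qed
  ultimately show ?thesis unfolding dihedral_ray_def by blast
qed

text \<open>
  The translates of the ray by \<open>0, a, \<dots>, (m - 1) * a\<close> are traversed in boustrophedon order: position
  \<open>q\<close> of all translates, forwards for even \<open>q\<close> and backwards for odd \<open>q\<close>.
\<close>

lemma dihedral_ray_add_rotation:
  assumes d: "d > 0" and a: "a \<in> A" and ray: "dihedral_ray A B (dihedral_class d b)"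
  shows "dihedral_ray A B (dihedral_class (gcd d a) b)"
proof -
  obtain u :: "int \<Rightarrow> int \<times> bool" where u: "bij_betw u UNIV (dihedral_class d b)"
    and adj: "\<And>k. dihedral_adj A B (u k) (u (k + 1))"
    using ray unfolding dihedral_ray_def by blast
  define m where "m = d div gcd d a"
  have "gcd d a > 0" "m * gcd d a = d" using d by (auto simp: m_def)
  then have m: "m > 0" using d by (metis zero_less_mult_pos2)
  define \<tau> where "\<tau> k = (if even (k div m) then k mod m else m - 1 - k mod m)" for k
  define u' where "u' k = (fst (u (k div m)) + a * \<tau> k, snd (u (k div m)))" for k
  define off where "off v = (if snd v then fst v - b else fst v)" for v :: "int \<times> bool"
  have cls: "v \<in> dihedral_class c b \<longleftrightarrow> c dvd off v" for v c
    unfolding dihedral_class_def off_def by simp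
  have off_u: "d dvd off (u q)" for q using bij_betw_apply[OF u, of q] cls by simp
  have off_u': "off (u' k) = off (u (k div m)) + a * \<tau> k" for k
    unfolding off_def u'_def by simp
  have \<tau>: "0 \<le> \<tau> k" "\<tau> k < m" for k using m pos_mod_bound[OF m, of k] pos_mod_sign[OF m, of k]
    unfolding \<tau>_def by auto
  have "inj u'"
  proof (rule injI)
    fix k k' assume eq: "u' k = u' k'"
    have "a * (\<tau> k - \<tau> k') = off (u (k' div m)) - off (u (k div m))"
      using off_u'[of k] off_u'[of k'] eq by (simp add: algebra_simps)
    then have "d dvd (\<tau> k - \<tau> k') * a" using off_u by (metis dvd_diff mult.commute)
    then have "d dvd (int (nat (\<tau> k)) - int (nat (\<tau> k'))) * a" using \<tau> by simp
    then have "nat (\<tau> k) = nat (\<tau> k')"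
      by (rule multiple_mod_gcd_unique[OF d, rotated 2])
        (use \<tau>[of k] \<tau>[of k'] in \<open>simp_all add: m_def[symmetric] nat_less_eq_zless\<close>)
    then have t: "\<tau> k = \<tau> k'" using \<tau>[of k] \<tau>[of k'] by linarith
    then have "u (k div m) = u (k' div m)" using eq unfolding u'_def by (simp add: prod_eq_iff)
    then have q: "k div m = k' div m" using u unfolding bij_betw_def by (simp add: inj_eq)
    then have "k mod m = k' mod m" using t unfolding \<tau>_def by (auto split: if_splits)
    then show "k = k'" using q by (metis div_mult_mod_eq)
  qed
  moreover have "range u' = dihedral_class (gcd d a) b"
  proof
    show "range u' \<subseteq> dihedral_class (gcd d a) b"
    proof
      fix v assume "v \<in> range u'"
      then obtain k where "v = u' k" by blast
      moreover have "gcd d a dvd off (u' k)" unfolding off_u'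
        using dvd_trans[OF gcd_dvd1 off_u] by (intro dvd_add) auto
      ultimately show "v \<in> dihedral_class (gcd d a) b" using cls by simp
    qed
    show "dihedral_class (gcd d a) b \<subseteq> range u'"
    proof
      fix v assume "v \<in> dihedral_class (gcd d a) b"
      then obtain j where j: "j < nat m" "d dvd off v - int j * a"
        using multiple_mod_gcd[OF d] cls unfolding m_def by blast
      define v' where "v' = (fst v - int j * a, snd v)"
      have "off v' = off v - int j * a" unfolding off_def v'_def by simp
      then have "v' \<in> dihedral_class d b" using j(2) cls by simp
      then obtain q where q: "u q = v'" using u unfolding bij_betw_def by (metis imageE)
      define t where "t = (if even q then int j else m - 1 - int j)"
      have t: "0 \<le> t" "t < m" using j(1) m unfolding t_def by auto
      define k where "k = m * q + t"
      have k: "k div m = q" "k mod m = t"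
        using t int_div_pos_eq[of k m q t] int_mod_pos_eq[of k m q t] unfolding k_def by auto
      have "\<tau> k = int j" unfolding \<tau>_def k t_def by simp
      then have "u' k = v" unfolding u'_def k q v'_def by simp
      then show "v \<in> range u'" by blast
    qed
  qed
  moreover have "dihedral_adj A B (u' k) (u' (k + 1))" for k
  proof -
    have k: "k = m * (k div m) + k mod m" "0 \<le> k mod m" "k mod m < m" using m by auto
    show ?thesis
    proof (cases "k mod m + 1 = m")
      case True
      then have "k + 1 = m * (k div m) + m" using k(1) by linarith
      then have "k + 1 = m * (k div m + 1)" by (simp add: distrib_left)
      then have k1: "(k + 1) div m = k div m + 1" "(k + 1) mod m = 0" using m by simp_all
      \<comment> \<open>At a turning point the translate stays the same and the position on the old
        ray advances, so the edge is a translated old edge.\<close>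
      have "\<tau> (k + 1) = \<tau> k" using True unfolding \<tau>_def k1 by auto
      then show ?thesis
        unfolding u'_def k1 using dihedral_adj_translate adj by metis
    next
      case False
      have "(k + 1) div m = k div m" "(k + 1) mod m = k mod m + 1"
        using False k(2,3) int_div_pos_eq[of "k + 1" m "k div m" "k mod m + 1"]
          int_mod_pos_eq[of "k + 1" m "k div m" "k mod m + 1"] k(1) by linarith+
      then show ?thesis
        using a unfolding u'_def \<tau>_def dihedral_adj_def by (auto simp: algebra_simps)
    qed
  qed
  ultimately show ?thesis unfolding dihedral_ray_def bij_betw_def by blast
qed

lemma dihedral_ray_add_rotations:
  assumes "finite F" "F \<subseteq> A" and d: "d > 0" and ray: "dihedral_ray A B (dihedral_class d b)"
  shows "dihedral_ray A B (dihedral_class (Gcd (insert d F)) b)"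
  using assms(1,2)
proof (induction F rule: finite_induct)
  case empty
  then show ?case using ray d by simp
next
  case (insert a F)
  define c where "c = Gcd (insert d F)"
  have "c dvd d" "c \<ge> 0" unfolding c_def by (auto intro: Gcd_dvd simp del: Gcd_insert)
  then have "c > 0" using d by (auto simp: le_less)
  then have "dihedral_ray A B (dihedral_class (gcd c a) b)"
    using insert dihedral_ray_add_rotation unfolding c_def by auto
  moreover have "gcd c a = Gcd (insert d (insert a F))" unfolding c_def by (simp add: ac_simps)
  ultimately show ?case by simp
qed

text \<open>The reflections alone give a ray on a subgroup with \<open>d\<close> the gcd of their
  index differences, after rescaling these by \<open>d\<close>. A lone reflection has no such
  \<open>d > 0\<close> and needs a nonzero rotation for a ladder. The rotations in \<open>A\<close>
  then bring the gcd down to \<open>1\<close>.\<close>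

lemma dihedral_ray_UNIV:
  assumes fin: "finite A" "finite B" and "B \<noteq> {}"
    and gen: "\<And>c. \<forall>a\<in>A. c dvd a \<Longrightarrow> \<forall>b\<in>B. \<forall>b'\<in>B. c dvd b - b' \<Longrightarrow> c dvd 1"
  shows "dihedral_ray A B UNIV"
proof -
  obtain b where b: "b \<in> B" using assms(3) by blast
  have "\<exists>d>0. dihedral_ray A B (dihedral_class d b) \<and> (\<forall>b1\<in>B. \<forall>b2\<in>B. d dvd b1 - b2)"
  proof (cases "B = {b}")
    case True
    \<comment> \<open>Otherwise \<open>gen\<close> would apply to \<open>c = 0\<close>, which does
      not divide \<open>1\<close>.\<close>
    have "\<exists>a\<in>A. a \<noteq> 0"
    proof (rule ccontr)
      assume "\<not> ?thesis"
      then have "(0::int) dvd 1" using True by (intro gen) auto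
      then show False by simp
    qed
    then obtain a where a: "a \<in> A" "a \<noteq> 0" by blast
    have "\<bar>a\<bar> > 0" using a(2) by simp
    moreover have "\<forall>b1\<in>B. \<forall>b2\<in>B. \<bar>a\<bar> dvd b1 - b2" using True by auto
    ultimately show ?thesis using dihedral_ray_ladder[OF a b] by blast
  next
    case False
    define d where "d = Gcd ((\<lambda>x. x - b) ` B)"
    have db: "d dvd x - b" if "x \<in> B" for x unfolding d_def using that by (intro Gcd_dvd) auto
    obtain b' where "b' \<in> B" "b' \<noteq> b" using False b by blast
    then have "d \<noteq> 0" using db[of b'] by auto
    moreover have "d \<ge> 0" unfolding d_def by simp
    ultimately have d: "d > 0" by simp
    have dB: "d dvd b1 - b2" if "b1 \<in> B" "b2 \<in> B" for b1 b2
      using dvd_diff[OF db[OF that(1)] db[OF that(2)]] by simp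
    define B' where "B' = (\<lambda>x. (x - b) div d) ` B"
    have B': "b + d * x \<in> B" if "x \<in> B'" for x
      using that db unfolding B'_def by (auto simp: dvd_mult_div_cancel)
    have "diff_coprime B'"
      unfolding diff_coprime_def
    proof (intro allI impI)
      fix c assume c: "\<forall>x\<in>B'. \<forall>y\<in>B'. c dvd x - y"
      have "d * c dvd x - b" if "x \<in> B" for x
      proof -
        have "(x - b) div d \<in> B'" "(b - b) div d \<in> B'" using that b unfolding B'_def by blast+
        then have "c dvd (x - b) div d - (b - b) div d" using c by blast
        then have "c dvd (x - b) div d" by simp
        then have "d * c dvd d * ((x - b) div d)" by (rule mult_dvd_mono[OF dvd_refl])
        then show ?thesis using db[OF that] by (simp add: dvd_mult_div_cancel)
      qed
      then have "d * c dvd d" unfolding d_def by (intro Gcd_greatest) auto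
      then show "c dvd 1" using d by auto
    qed
    moreover have "finite B'" unfolding B'_def using fin by simp
    ultimately have "haar_ray B'" by (intro haar_ray_of_diff_coprime)
    then show ?thesis using dihedral_ray_of_haar_ray[OF d B'] d dB by blast
  qed
  then obtain d where d: "d > 0" "dihedral_ray A B (dihedral_class d b)" "\<forall>b1\<in>B. \<forall>b2\<in>B. d dvd b1 - b2"
    by blast
  define c where "c = Gcd (insert d A)"
  have cA: "\<forall>a\<in>A. c dvd a" and cd: "c dvd d" and "c \<ge> 0"
    unfolding c_def by (auto intro: Gcd_dvd simp del: Gcd_insert)
  have "\<forall>b1\<in>B. \<forall>b2\<in>B. c dvd b1 - b2" using d(3) dvd_trans[OF cd] by blast
  then have "c dvd 1" using gen cA by blast
  then have c1: "c = 1" using \<open>c \<ge> 0\<close> by simp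
  have "dihedral_ray A B (dihedral_class c b)"
    unfolding c_def using dihedral_ray_add_rotations[OF fin(1) order_refl d(1,2)] .
  moreover have "dihedral_class 1 b = UNIV" unfolding dihedral_class_def by simp
  ultimately show ?thesis unfolding c1 by simp
qed

section \<open>Coordinates on the infinite dihedral group\<close>

lemma hamiltonian_double_ray_of_enumeration:
  fixes u :: "int \<Rightarrow> 'a"
  assumes simple: "simple_graph \<Gamma>" and u: "bij_betw u UNIV (verts \<Gamma>)"
    and adj: "\<And>k. {u k, u (k + 1)} \<in> edges \<Gamma>"
  shows "\<exists>\<Delta>. hamiltonian_double_ray \<Delta> \<Gamma>"
proof -
  define \<Delta> where "\<Delta> = \<lparr>verts = verts \<Gamma>, edges = range (\<lambda>k. {u k, u (k + 1)})\<rparr>"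
  have \<Delta>: "verts \<Delta> = verts \<Gamma>" "edges \<Delta> = range (\<lambda>k. {u k, u (k + 1)})" by (simp_all add: \<Delta>_def)
  have inj: "u i = u j \<longleftrightarrow> i = j" for i j using u unfolding bij_betw_def by (simp add: inj_eq)
  have rng: "verts \<Gamma> = range u" using u unfolding bij_betw_def by simp
  have sub: "edges \<Delta> \<subseteq> edges \<Gamma>" using adj unfolding \<Delta> by blast
  then have simple\<Delta>: "simple_graph \<Delta>" using simple \<Delta>(1) unfolding simple_graph_def by auto
  have inf: "infinite (verts \<Delta>)" using bij_betw_finite[OF u] \<Delta>(1) by (simp add: infinite_UNIV_int)
  have conn: "connected_graph \<Delta>"
  proof -
    let ?R = "{(x, y). {x, y} \<in> edges \<Delta>}"
    have step: "(u k, u (k + 1)) \<in> ?R" "(u (k + 1), u k) \<in> ?R" for k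
      unfolding \<Delta> by (auto simp: insert_commute)
    have right: "(u k, u (k + int t)) \<in> ?R\<^sup>*" for k t
    proof (induction t)
      case (Suc t)
      have "(u (k + int t), u (k + int (Suc t))) \<in> ?R" using step(1)[of "k + int t"] by (simp add: algebra_simps)
      then show ?case using Suc by (rule rtrancl_into_rtrancl[rotated])
    qed simp
    have left: "(u (k + int t), u k) \<in> ?R\<^sup>*" for k t
    proof (induction t)
      case (Suc t)
      have "(u (k + int (Suc t)), u (k + int t)) \<in> ?R" using step(2)[of "k + int t"] by (simp add: algebra_simps)
      then show ?case using Suc by (rule converse_rtrancl_into_rtrancl)
    qed simp
    have "(u i, u j) \<in> ?R\<^sup>*" for i j
      using right[of i "nat (j - i)"] left[of j "nat (i - j)"] by (cases "i \<le> j") auto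
    then show ?thesis unfolding connected_graph_def \<Delta>(1) rng by blast
  qed
  have reg: "regular_graph 2 \<Delta>"
    unfolding regular_graph_def
  proof
    fix v assume "v \<in> verts \<Delta>"
    then obtain k where v: "v = u k" unfolding \<Delta>(1) rng by blast
    have "{e \<in> edges \<Delta>. v \<in> e} = {{u (k - 1), u k}, {u k, u (k + 1)}}"
    proof
      show "{e \<in> edges \<Delta>. v \<in> e} \<subseteq> {{u (k - 1), u k}, {u k, u (k + 1)}}"
      proof
        fix e assume "e \<in> {e \<in> edges \<Delta>. v \<in> e}"
        then obtain j where j: "e = {u j, u (j + 1)}" "u k = u j \<or> u k = u (j + 1)"
          unfolding \<Delta> v by auto
        then have "j = k \<or> j = k - 1" unfolding inj by auto
        then show "e \<in> {{u (k - 1), u k}, {u k, u (k + 1)}}" using j(1) by auto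
      qed
      have "{u (k - 1), u (k - 1 + 1)} \<in> edges \<Delta>" "{u k, u (k + 1)} \<in> edges \<Delta>" unfolding \<Delta> by blast+
      then show "{{u (k - 1), u k}, {u k, u (k + 1)}} \<subseteq> {e \<in> edges \<Delta>. v \<in> e}" unfolding v by simp
    qed
    moreover have "{u (k - 1), u k} \<noteq> {u k, u (k + 1)}" by (simp add: doubleton_eq_iff inj)
    ultimately show "finite {e \<in> edges \<Delta>. v \<in> e} \<and> card {e \<in> edges \<Delta>. v \<in> e} = 2" by simp
  qed
  have "hamiltonian_double_ray \<Delta> \<Gamma>"
    unfolding hamiltonian_double_ray_def double_ray_def subgraph_def
    using simple simple\<Delta> inf conn reg sub \<Delta>(1) by simp
  then show ?thesis by blast
qed

section \<open>Reduced words as rotations and reflections\<close>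

fun letter_act :: "int + int \<Rightarrow> int \<times> bool \<Rightarrow> int \<times> bool"
  where "letter_act (Inl x) p = (- fst p, \<not> snd p)"
  | "letter_act (Inr x) p = (1 - fst p, \<not> snd p)"

definition coords :: "(int + int) list \<Rightarrow> int \<times> bool"
  where "coords w = foldr letter_act w (0, False)"

text \<open>The semidirect product of the integers with the sign change. For this product
  \<open>letter_act\<close> is left multiplication by the reflection with index \<open>0\<close> for
  \<open>Inl\<close> and \<open>1\<close> for \<open>Inr\<close>.\<close>

definition coord_mult :: "int \<times> bool \<Rightarrow> int \<times> bool \<Rightarrow> int \<times> bool"
  where "coord_mult p q = (if snd p then fst p - fst q else fst p + fst q, snd p \<noteq> snd q)"

abbreviation "dihedral_words \<equiv> reduced_words (integer_mod_group 2) (integer_mod_group 2)"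

lemma letters_two:
  "fp_letters (integer_mod_group 2) (integer_mod_group 2) = {Inl (1::int), Inr (1::int)}"
proof -
  have "carrier (integer_mod_group 2) - {\<one>\<^bsub>integer_mod_group 2\<^esub>} = {1::int}"
    by (auto simp: carrier_integer_mod_group)
  then show ?thesis by auto
qed

lemma coords_letter_mult:
  assumes "x \<in> {Inl 1, Inr 1}" "w \<in> dihedral_words"
  shows "coords (letter_mult (integer_mod_group 2) (integer_mod_group 2) x w) = letter_act x (coords w)"
proof (cases w)
  case Nil
  then show ?thesis using assms(1) by (auto simp: coords_def)
next
  case (Cons y v)
  have "y = Inl 1 \<or> y = Inr 1" using assms(2) unfolding Cons reduced_words_Cons letters_two by blast
  then show ?thesis using assms(1) unfolding Cons by (auto simp: coords_def)
qed

lemma letter_act_coord_mult: "letter_act x (coord_mult p q) = coord_mult (letter_act x p) q"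
  by (cases x) (auto simp: coord_mult_def)

lemma dihedral_words_mult:
  assumes "u \<in> dihedral_words" "w \<in> dihedral_words"
  shows "foldr (letter_mult (integer_mod_group 2) (integer_mod_group 2)) u w \<in> dihedral_words \<and>
    coords (foldr (letter_mult (integer_mod_group 2) (integer_mod_group 2)) u w) = coord_mult (coords u) (coords w)"
  using assms(1)
proof (induction u)
  case Nil
  then show ?case using assms(2) by (simp add: coords_def coord_mult_def)
next
  case (Cons x u)
  have x: "x \<in> fp_letters (integer_mod_group 2) (integer_mod_group 2)" and u: "u \<in> dihedral_words"
    using Cons.prems unfolding reduced_words_Cons by auto
  have "letter_act x (coords u) = coords (x # u)" by (simp add: coords_def)
  then show ?case
    using letter_mult_closed[OF group_integer_mod_group group_integer_mod_group x] Cons.IH[OF u]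
      coords_letter_mult x letter_act_coord_mult[of x "coords u" "coords w"]
    unfolding letters_two by simp
qed

text \<open>A ping-pong argument: the two reflections exchange the regions of nonpositive and
  positive indices, so the coordinates of a word reveal its leading letter and whether it is
  empty.\<close>

lemma coords_head:
  assumes "w \<in> dihedral_words" "w \<noteq> []"
  shows "if isl (hd w) then fst (coords w) \<le> 0 \<and> coords w \<noteq> (0, False) else fst (coords w) \<ge> 1"
  using assms
proof (induction w)
  case (Cons x w)
  have x: "x = Inl 1 \<or> x = Inr 1" and w: "w \<in> dihedral_words" "w \<noteq> [] \<Longrightarrow> isl x \<noteq> isl (hd w)"
    using Cons.prems unfolding reduced_words_Cons letters_two by auto
  have c: "coords (x # w) = letter_act x (coords w)" by (simp add: coords_def)
  show ?case
  proof (cases "w = []")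
    case True
    then show ?thesis using x unfolding c by (auto simp: coords_def)
  next
    case False
    then show ?thesis using x w Cons.IH unfolding c by (auto split: if_splits)
  qed
qed simp

lemma inj_on_coords: "inj_on coords dihedral_words"
proof (rule inj_onI)
  fix w w' assume "w \<in> dihedral_words" "w' \<in> dihedral_words" "coords w = coords w'"
  then show "w = w'"
  proof (induction w arbitrary: w')
    case Nil
    show ?case
    proof (rule ccontr)
      assume "[] \<noteq> w'"
      then show False using coords_head[of w'] Nil by (auto simp: coords_def split: if_splits)
    qed
  next
    case (Cons x w)
    have "w' \<noteq> []"
      using coords_head[OF Cons.prems(1)] Cons.prems(3) by (auto simp: coords_def split: if_splits)
    then obtain x' v where w': "w' = x' # v" by (cases w') auto
    have "isl x = isl x'"
      using coords_head[OF Cons.prems(1)] coords_head[OF Cons.prems(2)] Cons.prems(3) w'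
      by (auto split: if_splits)
    moreover have x: "x \<in> {Inl 1, Inr 1}" "x' \<in> {Inl 1, Inr 1}" "w \<in> dihedral_words" "v \<in> dihedral_words"
      using Cons.prems(1,2) unfolding w' reduced_words_Cons letters_two by auto
    ultimately have xx: "x = x'" by auto
    have "letter_act x (coords w) = letter_act x (coords v)"
      using Cons.prems(3) xx unfolding w' by (simp add: coords_def)
    then have "coords w = coords v" using x(1) by (auto simp: prod_eq_iff)
    then show ?case using Cons.IH x(3,4) xx w' by blast
  qed
qed

lemma coords_onto: "coords ` dihedral_words = UNIV"
proof -
  have act: "letter_act x p \<in> coords ` dihedral_words"
    if x: "x \<in> {Inl 1, Inr 1}" and p: "p \<in> coords ` dihedral_words" for x p
  proof -
    obtain w where w: "w \<in> dihedral_words" "p = coords w" using p by blast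
    have "x \<in> fp_letters (integer_mod_group 2) (integer_mod_group 2)" using x letters_two by simp
    then have "letter_mult (integer_mod_group 2) (integer_mod_group 2) x w \<in> dihedral_words"
      using letter_mult_closed[OF group_integer_mod_group group_integer_mod_group] w(1) by blast
    then show ?thesis using coords_letter_mult[OF x w(1)] w(2) by (metis imageI)
  qed
  have rot: "(n, False) \<in> coords ` dihedral_words" for n
  proof (induction n rule: int_induct[where k = 0])
    case base
    have "coords [] = (0, False)" by (simp add: coords_def)
    then show ?case by (metis imageI reduced_words_Nil)
  next
    case (step1 i)
    then show ?case using act[of "Inr 1" "letter_act (Inl 1) (i, False)"] act[of "Inl 1" "(i, False)"]
      by (simp add: add.commute)
  next
    case (step2 i)
    then show ?case using act[of "Inl 1" "letter_act (Inr 1) (i, False)"] act[of "Inr 1" "(i, False)"]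
      by simp
  qed
  have "p \<in> coords ` dihedral_words" for p
  proof (cases "snd p")
    case True
    then have "p = letter_act (Inl 1) (- fst p, False)" by (simp add: prod_eq_iff)
    also have "\<dots> \<in> coords ` dihedral_words" using rot by (intro act) auto
    finally show ?thesis .
  next
    case False
    then have "p = (fst p, False)" by (simp add: prod_eq_iff)
    then show ?thesis using rot[of "fst p"] by (simp only:)
  qed
  then show ?thesis by blast
qed

text \<open>Lets subgroups be handled in coordinates: one that contains the generators is
  everything. Closure under inverses is expressed through the product, which avoids a formula for
  the inverse.\<close>

lemma generate_coords:
  assumes S: "S \<subseteq> dihedral_words" "generate infinite_dihedral_group S = carrier infinite_dihedral_group"
    and K: "(0, False) \<in> K" "\<And>s. s \<in> S \<Longrightarrow> coords s \<in> K"
      "\<And>p q. p \<in> K \<Longrightarrow> q \<in> K \<Longrightarrow> coord_mult p q \<in> K"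
      "\<And>p q. q \<in> K \<Longrightarrow> coord_mult p q = (0, False) \<Longrightarrow> p \<in> K"
  shows "K = UNIV"
proof -
  interpret group infinite_dihedral_group by (rule group_infinite_dihedral_group)
  have car: "carrier infinite_dihedral_group = dihedral_words" and one: "\<one>\<^bsub>infinite_dihedral_group\<^esub> = []"
    by (simp_all add: infinite_dihedral_group_def free_product_def)
  have mult: "coords (u \<otimes>\<^bsub>infinite_dihedral_group\<^esub> w) = coord_mult (coords u) (coords w)"
    if "u \<in> dihedral_words" "w \<in> dihedral_words" for u w
    using dihedral_words_mult[OF that] by (simp add: infinite_dihedral_group_def free_product_def)
  have one0: "coords \<one>\<^bsub>infinite_dihedral_group\<^esub> = (0, False)" unfolding one by (simp add: coords_def)
  have "h \<in> carrier infinite_dihedral_group \<and> coords h \<in> K" if "h \<in> generate infinite_dihedral_group S" for h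
    using that
  proof (induction rule: generate.induct)
    case one
    then show ?case using one0 K(1) by simp
  next
    case (incl h)
    then show ?case using S(1) K(2) car by blast
  next
    case (inv h)
    then have h: "h \<in> carrier infinite_dihedral_group" "coords h \<in> K" using S(1) K(2) car by blast+
    then have "coord_mult (coords (inv\<^bsub>infinite_dihedral_group\<^esub> h)) (coords h) = (0, False)"
      using mult[of "inv\<^bsub>infinite_dihedral_group\<^esub> h" h] one0 inv_closed[OF h(1)] car by simp
    then show ?case using K(4) h by blast
  next
    case (eng h1 h2)
    then have h: "h1 \<in> dihedral_words" "h2 \<in> dihedral_words" "coords h1 \<in> K" "coords h2 \<in> K"
      using car by blast+
    have "h1 \<otimes>\<^bsub>infinite_dihedral_group\<^esub> h2 \<in> carrier infinite_dihedral_group"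
      using m_closed h(1,2) car by blast
    moreover have "coords (h1 \<otimes>\<^bsub>infinite_dihedral_group\<^esub> h2) \<in> K" unfolding mult[OF h(1,2)] using K(3) h by blast
    ultimately show ?case by blast
  qed
  then have "coords ` dihedral_words \<subseteq> K" using S(2) car by auto
  then show ?thesis using coords_onto by blast
qed

lemma dihedral_adj_generator:
  assumes "dihedral_adj {n. (n, False) \<in> T} {n. (n, True) \<in> T} p q"
  shows "\<exists>s\<in>T. coord_mult p s = q \<or> coord_mult q s = p"
proof -
  obtain n e m e' where pq: "p = (n, e)" "q = (m, e')" by (cases p, cases q)
  show ?thesis
  proof (cases "e = e'")
    case True
    then consider "(m - n, False) \<in> T" | "(n - m, False) \<in> T"
      using assms unfolding dihedral_adj_def pq by auto
    then show ?thesis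
    proof cases
      case 1
      then show ?thesis using True unfolding pq
        by (intro bexI[of _ "(m - n, False)"]) (auto simp: coord_mult_def)
    next
      case 2
      then show ?thesis using True unfolding pq
        by (intro bexI[of _ "(n - m, False)"]) (auto simp: coord_mult_def)
    qed
  next
    case False
    then have "((if e then n - m else m - n), True) \<in> T"
      using assms unfolding dihedral_adj_def pq by auto
    then show ?thesis using False unfolding pq
      by (intro bexI[of _ "((if e then n - m else m - n), True)"]) (auto simp: coord_mult_def)
  qed
qed

theorem corollary1p2:
  fixes S :: "(int + int) list set"
  assumes "S \<subseteq> carrier infinite_dihedral_group"
    and "finite S"
    and "\<one>\<^bsub>infinite_dihedral_group\<^esub> \<notin> S"
    and "generate infinite_dihedral_group S = carrier infinite_dihedral_group"
  shows "\<exists>\<Delta>. hamiltonian_double_ray \<Delta> (cayley_graph infinite_dihedral_group S)"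
proof -
  have car: "carrier infinite_dihedral_group = dihedral_words"
    by (simp add: infinite_dihedral_group_def free_product_def)
  have mult: "u \<otimes>\<^bsub>infinite_dihedral_group\<^esub> w \<in> dihedral_words"
    "coords (u \<otimes>\<^bsub>infinite_dihedral_group\<^esub> w) = coord_mult (coords u) (coords w)"
    if "u \<in> dihedral_words" "w \<in> dihedral_words" for u w
    using dihedral_words_mult[OF that] by (simp_all add: infinite_dihedral_group_def free_product_def)
  have S: "S \<subseteq> dihedral_words" using assms(1) car by simp
  define T where "T = coords ` S"
  define A where "A = {n. (n, False) \<in> T}"
  define B where "B = {n. (n, True) \<in> T}"
  have "finite T" using assms(2) unfolding T_def by simp
  then have fin: "finite A" "finite B"
    using finite_vimageI[of T "\<lambda>n. (n, False)"] finite_vimageI[of T "\<lambda>n. (n, True)"]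
    unfolding A_def B_def by (auto simp: vimage_def inj_def)
  note generated = generate_coords[OF S assms(4)]
  have "B \<noteq> {}"
  proof
    assume "B = {}"
    \<comment> \<open>Without a reflection in \<open>S\<close> the generated subgroup would consist
      of rotations only.\<close>
    have "{p. \<not> snd p} = (UNIV :: (int \<times> bool) set)"
    proof (rule generated)
      fix s assume "s \<in> S"
      then have "coords s \<in> T" unfolding T_def by blast
      then show "coords s \<in> {p. \<not> snd p}" using \<open>B = {}\<close> unfolding B_def by (cases "coords s") auto
    qed (auto simp: coord_mult_def)
    then have "(0, True) \<in> {p :: int \<times> bool. \<not> snd p}" by blast
    then show False by simp
  qed
  then obtain b where b: "b \<in> B" by blast
  have gen: "c dvd 1" if c: "\<forall>a\<in>A. c dvd a" "\<forall>x\<in>B. \<forall>y\<in>B. c dvd x - y" for c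
  proof -
    \<comment> \<open>For a common divisor \<open>c\<close> this subgroup contains \<open>S\<close>,
      so it contains the rotation by \<open>1\<close>, which forces \<open>c\<close> to divide
      \<open>1\<close>.\<close>
    have "dihedral_class c b = UNIV"
    proof (rule generated)
      fix s assume "s \<in> S"
      then have "coords s \<in> T" unfolding T_def by blast
      then show "coords s \<in> dihedral_class c b"
        using c b unfolding A_def B_def dihedral_class_def by (cases "coords s"; cases "snd (coords s)") auto
    next
      fix p q assume pq: "p \<in> dihedral_class c b" "q \<in> dihedral_class c b"
      show "coord_mult p q \<in> dihedral_class c b"
      proof (cases "snd p")
        case True
        then have "c dvd fst p - b" using pq(1) by (simp add: dihedral_class_def)
        then show ?thesis
        proof (cases "snd q")
          case q: True
          then have "c dvd fst q - b" using pq(2) by (simp add: dihedral_class_def)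
          then have "c dvd (fst p - b) - (fst q - b)" by (rule dvd_diff[OF \<open>c dvd fst p - b\<close>])
          then show ?thesis using True q by (simp add: dihedral_class_def coord_mult_def)
        next
          case q: False
          then have "c dvd fst q" using pq(2) by (simp add: dihedral_class_def)
          then have "c dvd (fst p - b) - fst q" by (rule dvd_diff[OF \<open>c dvd fst p - b\<close>])
          then show ?thesis using True q by (simp add: dihedral_class_def coord_mult_def algebra_simps)
        qed
      next
        case False
        then have "c dvd fst p" using pq(1) by (simp add: dihedral_class_def)
        moreover have "c dvd (if snd q then fst q - b else fst q)" using pq(2) by (simp add: dihedral_class_def)
        ultimately have "c dvd fst p + (if snd q then fst q - b else fst q)" by (rule dvd_add)
        then show ?thesis using False by (simp add: dihedral_class_def coord_mult_def algebra_simps split: if_splits)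
      qed
    next
      fix p q assume q: "q \<in> dihedral_class c b" "coord_mult p q = (0, False)"
      then have "snd p = snd q" "fst p = (if snd q then fst q else - fst q)"
        by (auto simp: coord_mult_def split: if_splits)
      then show "p \<in> dihedral_class c b" using q(1) by (auto simp: dihedral_class_def)
    qed (simp add: dihedral_class_def)
    then have "(1, False) \<in> dihedral_class c b" by blast
    then show ?thesis by (simp add: dihedral_class_def)
  qed
  obtain u :: "int \<Rightarrow> int \<times> bool" where u: "bij u" "\<And>k. dihedral_adj A B (u k) (u (k + 1))"
    using dihedral_ray_UNIV[OF fin \<open>B \<noteq> {}\<close> gen] unfolding dihedral_ray_def by blast
  define v where "v = inv_into dihedral_words coords \<circ> u"
  have bij: "bij_betw coords dihedral_words UNIV"
    using inj_on_coords coords_onto by (simp add: bij_betw_def)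
  have v: "coords (v k) = u k" "v k \<in> dihedral_words" for k
    unfolding v_def using coords_onto by (simp_all add: f_inv_into_f inv_into_into)
  have "bij_betw v UNIV dihedral_words"
    unfolding v_def using u(1) bij_betw_inv_into[OF bij] by (rule bij_betw_trans)
  moreover have "{v k, v (k + 1)} \<in> edges (cayley_graph infinite_dihedral_group S)" for k
  proof -
    have edge: "{g, h} \<in> edges (cayley_graph infinite_dihedral_group S)"
      if "g \<in> dihedral_words" "h \<in> dihedral_words" "s \<in> S" "coord_mult (coords g) (coords s) = coords h" for g h s
    proof -
      have s: "s \<in> dihedral_words" using that(3) S by blast
      have "coords (g \<otimes>\<^bsub>infinite_dihedral_group\<^esub> s) = coords h" using mult(2)[OF that(1) s] that(4) by simp
      then have "h = g \<otimes>\<^bsub>infinite_dihedral_group\<^esub> s"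
        using inj_on_coords mult(1)[OF that(1) s] that(2) by (metis inj_onD)
      then show ?thesis using that(1,3) unfolding cayley_graph_def car by auto
    qed
    have "\<exists>t\<in>T. coord_mult (u k) t = u (k + 1) \<or> coord_mult (u (k + 1)) t = u k"
      by (rule dihedral_adj_generator) (use u(2)[of k] in \<open>simp add: A_def B_def\<close>)
    then obtain s where s: "s \<in> S"
      "coord_mult (u k) (coords s) = u (k + 1) \<or> coord_mult (u (k + 1)) (coords s) = u k"
      unfolding T_def by blast
    from s(2) show ?thesis
    proof
      assume "coord_mult (u k) (coords s) = u (k + 1)"
      then show ?thesis using edge[OF v(2) v(2) s(1)] v(1) by simp
    next
      assume "coord_mult (u (k + 1)) (coords s) = u k"
      then have "{v (k + 1), v k} \<in> edges (cayley_graph infinite_dihedral_group S)"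
        using edge[OF v(2) v(2) s(1)] v(1) by simp
      then show ?thesis by (simp only: insert_commute)
    qed
  qed
  moreover have "verts (cayley_graph infinite_dihedral_group S) = dihedral_words"
    by (simp add: cayley_graph_def car)
  ultimately show ?thesis
    using hamiltonian_double_ray_of_enumeration[of "cayley_graph infinite_dihedral_group S" v]
      simple_graph_cayley_graph[OF group_infinite_dihedral_group assms(1,3)] by simp
qed

end
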